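(* Let $w\in C^2([-2,2])$, $\eta>0$, $\mu>0$, $\gamma>0$, $f_r,f_p\in L^2(-1,1)$ and $0<\beta\le\alpha\le2\beta$. Then the functional $$\begin{aligned}F_1(v_r,v_p)=\;&\alpha\,\sharp(S_{v_r})+\beta\,\sharp(S_{\dot v_r}\setminus S_{v_r})+\int_{-1}^1\big(\eta|\ddot v_r|^2-f_rv_r\big)\,dx\\&+\mu\int_{-1}^1|v_r-v_p|^2\,dx+\int_{-1}^1\big(\gamma|v_p''|^2-f_pv_p\big)\,dx\end{aligned}$$ achieves a finite minimum over the pairs $(v_r,v_p)\in\mathbf{H}^2(-2,2)\times H^2(-2,2)$ such that $v_r=v_p=w$ in $(-2,-1)\cup(1,2)$ and $v_r\ge v_p$ on $[-1,1]$.
   Context: $H^2$ is the usual Sobolev space. $\mathbf{H}^2(-2,2)$ is the set of functions $v:(-2,2)\to\mathbb{R}$ that are piecewise $H^2$, i.e. made of finitely many $H^2$ pieces: there is a finite partition $-2=s_0<\dots<s_n=2$ with $v\in H^2(s_{i-1},s_i)$ for each $i$. $\dot v$ is the absolutely continuous part of the distributional derivative $v'$, $\ddot v$ is the absolutely continuous part of $(\dot v)'$; $S_v$ and $S_{\dot v}$ are the sets of discontinuity points of $v$ and $\dot v$ in $(-2,2)$ (possibly including the points $\pm1$); $\sharp$ is the counting measure. $v^+$, $v^-$ denote right and left limits. The constraint "$v_r\ge v_p$ on $[-1,1]$" means: $v_r(x)\ge v_p(x)$ for $x\in[-1,1]\setminus S_{v_r}$; $v_r^+(x)\ge v_p(x)$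 for $x\in S_{v_r}\cup\{-1\}$; $v_r^-(x)\ge v_p(x)$ for $x\in S_{v_r}\cup\{1\}$. *)

theory Defs
  imports "HOL-Analysis.Analysis"
begin

text \<open>
  Elements of function spaces on an interval \<open>(a, b)\<close> are represented by total functions
  \<open>real \<Rightarrow> real\<close>; only the almost-everywhere class of the restriction to \<open>(a, b)\<close> matters:
  membership in the spaces, the derivatives, the discontinuity sets and the limits below do not
  change when such a function is modified on a null set.
\<close>

definition ae_eq :: "real \<Rightarrow> real \<Rightarrow> (real \<Rightarrow> real) \<Rightarrow> (real \<Rightarrow> real) \<Rightarrow> bool" where
  "ae_eq a b u v \<longleftrightarrow> (AE x in lebesgue_on {a<..<b}. u x = v x)"

definition L2 :: "real \<Rightarrow> real \<Rightarrow> (real \<Rightarrow> real) set" where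
  "L2 a b = {f. f \<in> borel_measurable (lebesgue_on {a<..<b}) \<and>
                integrable (lebesgue_on {a<..<b}) (\<lambda>x. (f x)\<^sup>2)}"

text \<open>\<open>C\<^sup>\<infinity>\<close> functions with compact support in \<open>(a, b)\<close>.\<close>

definition test_funs :: "real \<Rightarrow> real \<Rightarrow> (real \<Rightarrow> real) set" where
  "test_funs a b = {\<phi>. (\<forall>n. ((deriv ^^ n) \<phi>) differentiable_on UNIV) \<and>
                       compact (closure {x. \<phi> x \<noteq> 0}) \<and> closure {x. \<phi> x \<noteq> 0} \<subseteq> {a<..<b}}"

definition has_weak_deriv :: "real \<Rightarrow> real \<Rightarrow> (real \<Rightarrow> real) \<Rightarrow> (real \<Rightarrow> real) \<Rightarrow> bool" where
  "has_weak_deriv a b v g \<longleftrightarrow>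
     integrable (lebesgue_on {a<..<b}) v \<and> integrable (lebesgue_on {a<..<b}) g \<and>
     (\<forall>\<phi>\<in>test_funs a b.
        (\<integral>x. v x * deriv \<phi> x \<partial>lebesgue_on {a<..<b}) = - (\<integral>x. g x * \<phi> x \<partial>lebesgue_on {a<..<b}))"

definition weak_deriv :: "real \<Rightarrow> real \<Rightarrow> (real \<Rightarrow> real) \<Rightarrow> real \<Rightarrow> real" where
  "weak_deriv a b v = (SOME g. has_weak_deriv a b v g)"

definition H2 :: "real \<Rightarrow> real \<Rightarrow> (real \<Rightarrow> real) set" where
  "H2 a b = {v \<in> L2 a b. \<exists>g\<in>L2 a b. \<exists>h\<in>L2 a b. has_weak_deriv a b v g \<and> has_weak_deriv a b g h}"

definition piecewise_H2 :: "real \<Rightarrow> real \<Rightarrow> (real \<Rightarrow> real) set" where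
  "piecewise_H2 a b = {v. \<exists>(n::nat) s. s 0 = a \<and> s n = b \<and>
     (\<forall>i<n. s i < s (Suc i) \<and> v \<in> H2 (s i) (s (Suc i)))}"

text \<open>
  The distributional derivative of \<open>v\<close> on \<open>(a, b)\<close> is the finite signed measure
  \<open>g dx + M\<^sub>1 - M\<^sub>2\<close> with \<open>M\<^sub>1\<close> and \<open>M\<^sub>2\<close> singular to Lebesgue measure, i.e. \<open>g\<close> is the density
  of the absolutely continuous part in its Lebesgue decomposition.
\<close>

definition has_ac_deriv :: "real \<Rightarrow> real \<Rightarrow> (real \<Rightarrow> real) \<Rightarrow> (real \<Rightarrow> real) \<Rightarrow> bool" where
  "has_ac_deriv a b v g \<longleftrightarrow>
     integrable (lebesgue_on {a<..<b}) v \<and> integrable (lebesgue_on {a<..<b}) g \<and>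
     (\<exists>(M\<^sub>1 :: real measure) (M\<^sub>2 :: real measure) N.
        finite_measure M\<^sub>1 \<and> sets M\<^sub>1 = sets borel \<and> finite_measure M\<^sub>2 \<and> sets M\<^sub>2 = sets borel \<and>
        N \<in> null_sets lborel \<and> emeasure M\<^sub>1 (- N) = 0 \<and> emeasure M\<^sub>2 (- N) = 0 \<and>
        (\<forall>\<phi>\<in>test_funs a b.
           (\<integral>x. v x * deriv \<phi> x \<partial>lebesgue_on {a<..<b}) =
             - ((\<integral>x. g x * \<phi> x \<partial>lebesgue_on {a<..<b})
                 + (\<integral>x. \<phi> x \<partial>M\<^sub>1) - (\<integral>x. \<phi> x \<partial>M\<^sub>2))))"

definition ac_deriv :: "real \<Rightarrow> real \<Rightarrow> (real \<Rightarrow> real) \<Rightarrow> real \<Rightarrow> real" where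
  "ac_deriv a b v = (SOME g. has_ac_deriv a b v g)"

text \<open>
  Discontinuity points of an almost-everywhere class: the points of \<open>(a, b)\<close> at which no
  representative is continuous.
\<close>

definition disc :: "real \<Rightarrow> real \<Rightarrow> (real \<Rightarrow> real) \<Rightarrow> real set" where
  "disc a b u = {x\<in>{a<..<b}. \<not> (\<exists>u'. ae_eq a b u' u \<and> isCont u' x)}"

text \<open>
  The limit of a suitable representative along \<open>F\<close>. With \<open>F = at x\<close> and \<open>x \<notin> disc a b u\<close> this is
  the value at \<open>x\<close> of any representative continuous at \<open>x\<close>; with \<open>F = at_right x\<close> and
  \<open>F = at_left x\<close> these are the one-sided limits.
\<close>

definition ae_lim :: "real \<Rightarrow> real \<Rightarrow> (real \<Rightarrow> real) \<Rightarrow> real filter \<Rightarrow> real" where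
  "ae_lim a b u F = (THE l. \<exists>u'. ae_eq a b u' u \<and> (u' \<longlongrightarrow> l) F)"

definition C2_on :: "real \<Rightarrow> real \<Rightarrow> (real \<Rightarrow> real) \<Rightarrow> bool" where
  "C2_on a b w \<longleftrightarrow> (\<exists>w' w''.
     (\<forall>x\<in>{a..b}. (w has_real_derivative w' x) (at x within {a..b}) \<and>
                 (w' has_real_derivative w'' x) (at x within {a..b})) \<and>
     continuous_on {a..b} w'')"

definition obstacle :: "(real \<Rightarrow> real) \<Rightarrow> (real \<Rightarrow> real) \<Rightarrow> bool" where
  "obstacle v\<^sub>r v\<^sub>p \<longleftrightarrow>
     (\<forall>x\<in>{-1..1} - disc (-2) 2 v\<^sub>r. ae_lim (-2) 2 v\<^sub>r (at x) \<ge> ae_lim (-2) 2 v\<^sub>p (at x)) \<and>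
     (\<forall>x\<in>disc (-2) 2 v\<^sub>r \<union> {-1}. ae_lim (-2) 2 v\<^sub>r (at_right x) \<ge> ae_lim (-2) 2 v\<^sub>p (at x)) \<and>
     (\<forall>x\<in>disc (-2) 2 v\<^sub>r \<union> {1}. ae_lim (-2) 2 v\<^sub>r (at_left x) \<ge> ae_lim (-2) 2 v\<^sub>p (at x))"

definition admissible ::
    "(real \<Rightarrow> real) \<Rightarrow> ((real \<Rightarrow> real) \<times> (real \<Rightarrow> real)) set" where
  "admissible w = {(v\<^sub>r, v\<^sub>p). v\<^sub>r \<in> piecewise_H2 (-2) 2 \<and> v\<^sub>p \<in> H2 (-2) 2 \<and>
     ae_eq (-2) (-1) v\<^sub>r w \<and> ae_eq 1 2 v\<^sub>r w \<and>
     ae_eq (-2) (-1) v\<^sub>p w \<and> ae_eq 1 2 v\<^sub>p w \<and>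
     obstacle v\<^sub>r v\<^sub>p}"

definition counting :: "real set \<Rightarrow> ereal" where
  "counting S = enn2ereal (emeasure (count_space UNIV) S)"

definition F1 ::
    "real \<Rightarrow> real \<Rightarrow> real \<Rightarrow> real \<Rightarrow> real \<Rightarrow> (real \<Rightarrow> real) \<Rightarrow> (real \<Rightarrow> real) \<Rightarrow>
     (real \<Rightarrow> real) \<Rightarrow> (real \<Rightarrow> real) \<Rightarrow> ereal" where
  "F1 \<alpha> \<beta> \<eta> \<mu> \<gamma> f\<^sub>r f\<^sub>p v\<^sub>r v\<^sub>p =
    (let dv = ac_deriv (-2) 2 v\<^sub>r;
         ddv = ac_deriv (-2) 2 dv;
         vp'' = weak_deriv (-2) 2 (weak_deriv (-2) 2 v\<^sub>p)
     in ereal \<alpha> * counting (disc (-2) 2 v\<^sub>r)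
        + ereal \<beta> * counting (disc (-2) 2 dv - disc (-2) 2 v\<^sub>r)
        + ereal ((\<integral>x. \<eta> * \<bar>ddv x\<bar>\<^sup>2 - f\<^sub>r x * v\<^sub>r x \<partial>lebesgue_on {-1<..<1})
               + \<mu> * (\<integral>x. \<bar>v\<^sub>r x - v\<^sub>p x\<bar>\<^sup>2 \<partial>lebesgue_on {-1<..<1})
               + (\<integral>x. \<gamma> * \<bar>vp'' x\<bar>\<^sup>2 - f\<^sub>p x * v\<^sub>p x \<partial>lebesgue_on {-1<..<1})))"

end

theory Submission
  imports Defs
begin

text \<open>
  Along a minimizing sequence the numbers of jumps and creases may be taken constant, and these points
  converge. Coercivity, through a Poincare inequality for \<open>v\<^sub>p - w\<close>, bounds \<open>v\<^sub>r\<close>, \<open>v\<^sub>p\<close> and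
  their second derivatives in \<open>L\<^sup>2\<close>, and a weak cluster point inherits the obstacle and boundary
  conditions, satisfies \<open>v'' = h\<close> weakly off the limit points, hence is piecewise \<open>H\<^sup>2\<close>, and by convexity
  does not increase the integral part. A limit point reached by a single crease carries no jump: the
  crease strengths stay bounded, so in the limit \<open>v'' - h\<close> is at most a multiple of a point mass there.
  Every other jump of the limit is fed by a jump or by two creases, and \<open>\<beta> \<le> \<alpha> \<le> 2 * \<beta>\<close> makes the count
  lower semicontinuous.
\<close>

text \<open>The definitions of \<open>F1\<close> and \<open>admissible\<close> speak of a.e.
  classes, of \<open>SOME\<close>-chosen densities of measure derivatives and of one-sided limits,
  none of which is visibly stable under weak convergence. Everything is therefore recast as
  integrals: the integral of \<open>v * \<phi>''\<close> equals that of \<open>h * \<phi>\<close>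
  plus the sum of \<open>m s * \<phi> s\<close> over creases minus the sum of
  \<open>j s * \<phi>' s\<close> over jumps, and the obstacle becomes an a.e. inequality. For
  \<open>\<phi>\<close> supported away from the singular points the identity is linear in
  \<open>(v, h)\<close> alone and survives in a weak cluster point. Explicit primitives, steps and
  ramps turn it back into derivatives and discontinuity sets; the bridge is the uniqueness of the
  absolutely continuous part. When singular points merge, jump heights and crease strengths may blow
  up, so limits of \<open>j\<close> and \<open>m\<close> are never taken; the coefficients of the
  limit are obtained afresh from its own representation. The second derivative of \<open>v\<close>
  leaves an affine function free on each piece, so it is the \<mu> term that bounds
  \<open>v\<close>, by its distance to the obstacle.\<close>

abbreviation leb :: "real \<Rightarrow> real \<Rightarrow> real measure" where
  "leb a b \<equiv> lebesgue_on {a<..<b}"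

abbreviation pairing :: "real \<Rightarrow> real \<Rightarrow> (real \<Rightarrow> real) \<Rightarrow> (real \<Rightarrow> real) \<Rightarrow> real" where
  "pairing a b f g \<equiv> \<integral>x. f x * g x \<partial>leb a b"

abbreviation sqnorm :: "real \<Rightarrow> real \<Rightarrow> (real \<Rightarrow> real) \<Rightarrow> real" where
  "sqnorm a b f \<equiv> \<integral>x. (f x)\<^sup>2 \<partial>leb a b"


subsection \<open>Test functions\<close>

definition smooth :: "(real \<Rightarrow> real) \<Rightarrow> bool" where
  "smooth f \<longleftrightarrow> (\<forall>n. ((deriv ^^ n) f) differentiable_on UNIV)"

text \<open>Smoothness is treated as a greatest fixed point: a class that contains a derivative of
  each of its members consists of smooth functions. Higher derivatives then never have to be
  computed.\<close>

lemma smooth_coinduct: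
  assumes "P f"
    and step: "\<And>f. P f \<Longrightarrow> \<exists>f'. P f' \<and> (\<forall>x. (f has_real_derivative f' x) (at x))"
  shows "smooth f"
proof -
  have "P ((deriv ^^ n) f)" for n
  proof (induction n)
    case 0
    show ?case using assms(1) by simp
  next
    case (Suc n)
    obtain f' where f': "P f'" "\<And>x. ((deriv ^^ n) f has_real_derivative f' x) (at x)"
      using step[OF Suc] by blast
    have "deriv ((deriv ^^ n) f) = f'"
      using f'(2) by (intro ext DERIV_imp_deriv)
    then show ?case using f'(1) by simp
  qed
  then have "(deriv ^^ n) f differentiable_on UNIV" for n
    using step unfolding differentiable_on_def
    by (metis UNIV_I real_differentiable_def)
  then show ?thesis unfolding smooth_def by blast
qed

lemma smooth_has_deriv: "smooth f \<Longrightarrow> (f has_real_derivative deriv f x) (at x)"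
  unfolding smooth_def differentiable_on_def
  by (metis UNIV_I funpow_0 DERIV_deriv_iff_real_differentiable)

lemma smooth_deriv: "smooth f \<Longrightarrow> smooth (deriv f)"
  unfolding smooth_def by (metis comp_apply funpow_Suc_right)

lemma smooth_continuous_on: "smooth f \<Longrightarrow> continuous_on S f"
  by (meson DERIV_isCont continuous_at_imp_continuous_on smooth_has_deriv)

lemma smooth_isCont: "smooth f \<Longrightarrow> isCont f x"
  by (meson DERIV_isCont smooth_has_deriv)

text \<open>The derivative of a product is a sum of products, so the invariant of the coinduction
  has to be closed under sums and products together.\<close>

inductive smooth_algebra :: "(real \<Rightarrow> real) \<Rightarrow> bool" where
  base: "smooth f \<Longrightarrow> smooth_algebra f"
| add: "smooth_algebra f \<Longrightarrow> smooth_algebra g \<Longrightarrow> smooth_algebra (\<lambda>x. f x + g x)"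
| mult: "smooth_algebra f \<Longrightarrow> smooth_algebra g \<Longrightarrow> smooth_algebra (\<lambda>x. f x * g x)"

lemma smooth_algebra_deriv:
  "smooth_algebra f \<Longrightarrow> \<exists>f'. smooth_algebra f' \<and> (\<forall>x. (f has_real_derivative f' x) (at x))"
proof (induction rule: smooth_algebra.induct)
  case (base f)
  then show ?case using smooth_has_deriv smooth_deriv smooth_algebra.base by blast
next
  case (add f g)
  then obtain f' g' where "smooth_algebra f'" "smooth_algebra g'"
    and d: "\<And>x. (f has_real_derivative f' x) (at x)" "\<And>x. (g has_real_derivative g' x) (at x)"
    by blast
  then have "smooth_algebra (\<lambda>x. f' x + g' x)" by (intro smooth_algebra.add)
  moreover have "((\<lambda>x. f x + g x) has_real_derivative f' x + g' x) (at x)" for x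
    by (intro DERIV_add d)
  ultimately show ?case by (intro exI[of _ "\<lambda>x. f' x + g' x"]) blast
next
  case (mult f g)
  then obtain f' g' where s: "smooth_algebra f'" "smooth_algebra g'"
    and d: "\<And>x. (f has_real_derivative f' x) (at x)" "\<And>x. (g has_real_derivative g' x) (at x)"
    by blast
  have "smooth_algebra (\<lambda>x. f' x * g x + g' x * f x)"
    by (intro smooth_algebra.add smooth_algebra.mult s mult.hyps)
  moreover have "((\<lambda>x. f x * g x) has_real_derivative f' x * g x + g' x * f x) (at x)" for x
    by (intro DERIV_mult d)
  ultimately show ?case by (intro exI[of _ "\<lambda>x. f' x * g x + g' x * f x"]) blast
qed

lemma smooth_algebra_imp_smooth:
  assumes "smooth_algebra f"
  shows "smooth f"
  using assms
proof (rule smooth_coinduct[where P = smooth_algebra])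
  fix g assume "smooth_algebra g"
  then show "\<exists>g'. smooth_algebra g' \<and> (\<forall>x. (g has_real_derivative g' x) (at x))"
    by (rule smooth_algebra_deriv)
qed

lemma smooth_add: "smooth f \<Longrightarrow> smooth g \<Longrightarrow> smooth (\<lambda>x. f x + g x)"
  by (rule smooth_algebra_imp_smooth[OF smooth_algebra.add[OF smooth_algebra.base smooth_algebra.base]])

lemma smooth_mult: "smooth f \<Longrightarrow> smooth g \<Longrightarrow> smooth (\<lambda>x. f x * g x)"
  by (rule smooth_algebra_imp_smooth[OF smooth_algebra.mult[OF smooth_algebra.base smooth_algebra.base]])

lemma smooth_const: "smooth (\<lambda>x. c)"
  by (rule smooth_coinduct[where P = "\<lambda>f. \<exists>c. f = (\<lambda>x. c)"]) (auto intro!: derivative_eq_intros)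

lemma smooth_ident: "smooth (\<lambda>x. x)"
proof (rule smooth_coinduct[where P = "\<lambda>f. f = (\<lambda>x. x) \<or> smooth f"])
  fix f :: "real \<Rightarrow> real" assume "f = (\<lambda>x. x) \<or> smooth f"
  then show "\<exists>f'. (f' = (\<lambda>x. x) \<or> smooth f') \<and> (\<forall>x. (f has_real_derivative f' x) (at x))"
  proof
    assume "f = (\<lambda>x. x)"
    then show ?thesis
      using smooth_const[of 1] by (intro exI[of _ "\<lambda>x. 1"]) auto
  next
    assume "smooth f"
    then show ?thesis using smooth_deriv smooth_has_deriv by blast
  qed
qed simp

lemma smooth_affine_comp:
  assumes "smooth f"
  shows "smooth (\<lambda>x. f (a * x + b))"
proof -
  \<comment> \<open>The factor \<open>c\<close> collects the powers of \<open>a\<close> produced by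
    the chain rule.\<close>
  let ?P = "\<lambda>g. \<exists>c h. smooth h \<and> g = (\<lambda>x. c * h (a * x + b))"
  have "?P (\<lambda>x. f (a * x + b))" using assms by (intro exI[of _ 1] exI[of _ f]) simp
  then show ?thesis
  proof (rule smooth_coinduct[where P = ?P])
    fix g assume "?P g"
    then obtain c h where h: "smooth h" and g: "g = (\<lambda>x. c * h (a * x + b))" by blast
    have "(g has_real_derivative (c * a) * deriv h (a * x + b)) (at x)" for x
    proof -
      have "((\<lambda>x. a * x + b) has_real_derivative a) (at x)"
        by (auto intro!: derivative_eq_intros)
      from DERIV_cmult[OF DERIV_chain2[OF smooth_has_deriv[OF h] this], of c]
      show ?thesis unfolding g by (simp add: ac_simps)
    qed
    then show "\<exists>g'. ?P g' \<and> (\<forall>x. (g has_real_derivative g' x) (at x))"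
      using smooth_deriv[OF h]
      by (intro exI[of _ "\<lambda>x. (c * a) * deriv h (a * x + b)"]) blast
  qed
qed

section \<open>A smooth function that vanishes on a half-line\<close>

lemma poly_mult_exp_tendsto_0:
  fixes p :: "real poly"
  shows "((\<lambda>y. poly p y * exp (- y)) \<longlongrightarrow> 0) at_top"
proof -
  have mon: "((\<lambda>y::real. c * (y ^ i / exp y)) \<longlongrightarrow> 0) at_top" for c i
    using tendsto_mult[OF tendsto_const tendsto_power_div_exp_0[of i], of c] by simp
  have "((\<lambda>y. \<Sum>i\<le>degree p. coeff p i * (y ^ i / exp y)) \<longlongrightarrow> (\<Sum>i\<le>degree p. 0)) at_top"
    by (intro tendsto_sum mon)
  moreover have "(\<lambda>y. \<Sum>i\<le>degree p. coeff p i * (y ^ i / exp y)) = (\<lambda>y. poly p y * exp (- y))"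
    by (simp add: poly_altdef exp_minus sum_distrib_right sum_divide_distrib divide_inverse mult.assoc)
  ultimately show ?thesis by simp
qed

text \<open>Closed under differentiation, which gives the smoothness of \<open>exp (- 1 / x)\<close> at \<open>0\<close>.\<close>

definition flat_exp :: "real poly \<Rightarrow> real \<Rightarrow> real" where
  "flat_exp p x = (if x > 0 then poly p (1 / x) * exp (- (1 / x)) else 0)"

text \<open>With \<open>y = 1 / x\<close> one has \<open>y' = - y^2\<close>, so
  \<open>poly p y * exp (- y)\<close> has the derivative
  \<open>(p - p') y * y^2 * exp (- y)\<close>, and \<open>[:0, 0, 1:]\<close> is \<open>y^2\<close>.
  At 0 the division by \<open>h\<close> in the difference quotient is one more factor
  \<open>y\<close>, hence \<open>[:0, 1:]\<close>, and the exponential beats it.\<close>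

lemma flat_exp_has_deriv:
  "(flat_exp p has_real_derivative flat_exp ((p - pderiv p) * [:0, 0, 1:]) x) (at x)"
proof -
  let ?q = "(p - pderiv p) * [:0, 0, 1:]"
  consider "x > 0" | "x < 0" | "x = 0" by linarith
  then show ?thesis
  proof cases
    case 1
    have "((\<lambda>x. poly p (1 / x) * exp (- (1 / x))) has_real_derivative flat_exp ?q x) (at x)"
      using 1 unfolding flat_exp_def
      by (auto intro!: derivative_eq_intros DERIV_chain2[OF poly_DERIV]
          simp: field_simps power2_eq_square)
    then show ?thesis
    proof (rule has_field_derivative_transform_within_open)
      show "open {0::real<..}" by simp
    qed (use 1 in \<open>auto simp: flat_exp_def\<close>)
  next
    case 2
    have "((\<lambda>x. 0) has_real_derivative flat_exp ?q x) (at x)"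
      using 2 by (simp add: flat_exp_def)
    then show ?thesis
    proof (rule has_field_derivative_transform_within_open)
      show "open {..<0::real}" by simp
    qed (use 2 in \<open>auto simp: flat_exp_def\<close>)
  next
    case 3
    have "((\<lambda>h. poly (p * [:0, 1:]) (inverse h) * exp (- inverse h)) \<longlongrightarrow> 0) (at_right 0)"
      using filterlim_compose[OF poly_mult_exp_tendsto_0 filterlim_inverse_at_top_right] .
    then have R: "((\<lambda>h. flat_exp p h / h) \<longlongrightarrow> 0) (at_right 0)"
      by (rule Lim_transform_eventually)
        (auto simp: eventually_at_right_field flat_exp_def field_simps intro!: exI[of _ 1])
    have L: "((\<lambda>h. flat_exp p h / h) \<longlongrightarrow> 0) (at_left 0)"
      by (rule Lim_transform_eventually[OF tendsto_const])
        (auto simp: eventually_at_left_field flat_exp_def intro!: exI[of _ "-1"])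
    have "((\<lambda>h. flat_exp p h / h) \<longlongrightarrow> 0) (at 0)"
      using L R filterlim_split_at_real by blast
    then show ?thesis
      unfolding 3 DERIV_def by (simp add: flat_exp_def)
  qed
qed

lemma smooth_flat_exp: "smooth (flat_exp p)"
proof (rule smooth_coinduct[where P = "\<lambda>f. \<exists>p. f = flat_exp p"])
  fix f assume "\<exists>p. f = flat_exp p"
  then show "\<exists>f'. (\<exists>p. f' = flat_exp p) \<and> (\<forall>x. (f has_real_derivative f' x) (at x))"
    using flat_exp_has_deriv by blast
qed blast

text \<open>Two bounds strictly inside (a, b) are easier to carry through sums, products and
  derivatives than a compact closure. For the zero function the bounds may cross, which covers the
  empty support.\<close>

lemma test_funs_iff:
  "\<phi> \<in> test_funs a b \<longleftrightarrow> smooth \<phi> \<and> (\<exists>c d. a < c \<and> d < b \<and> (\<forall>x. \<phi> x \<noteq> 0 \<longrightarrow> c \<le> x \<and> x \<le> d))"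
proof
  assume L: "\<phi> \<in> test_funs a b"
  define K where "K = closure {x. \<phi> x \<noteq> 0}"
  have K: "compact K" "K \<subseteq> {a<..<b}" using L by (auto simp: test_funs_def K_def)
  have sub: "{x. \<phi> x \<noteq> 0} \<subseteq> K" unfolding K_def by (rule closure_subset)
  have "\<exists>c d. a < c \<and> d < b \<and> (\<forall>x. \<phi> x \<noteq> 0 \<longrightarrow> c \<le> x \<and> x \<le> d)"
  proof (cases "K = {}")
    case True
    then have "\<forall>x. \<not> \<phi> x \<noteq> 0" using sub by blast
    then show ?thesis by (intro exI[of _ "a + 1"] exI[of _ "b - 1"]) simp
  next
    case False
    obtain c where c: "c \<in> K" "\<And>x. x \<in> K \<Longrightarrow> c \<le> x"
      using compact_attains_inf[OF K(1) False] by blast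
    obtain d where d: "d \<in> K" "\<And>x. x \<in> K \<Longrightarrow> x \<le> d"
      using compact_attains_sup[OF K(1) False] by blast
    have "a < c" "d < b" using K(2) c(1) d(1) by auto
    then show ?thesis using c(2) d(2) sub by blast
  qed
  then show "smooth \<phi> \<and> (\<exists>c d. a < c \<and> d < b \<and> (\<forall>x. \<phi> x \<noteq> 0 \<longrightarrow> c \<le> x \<and> x \<le> d))"
    using L unfolding test_funs_def smooth_def by blast
next
  assume R: "smooth \<phi> \<and> (\<exists>c d. a < c \<and> d < b \<and> (\<forall>x. \<phi> x \<noteq> 0 \<longrightarrow> c \<le> x \<and> x \<le> d))"
  then obtain c d where cd: "a < c" "d < b" "\<And>x. \<phi> x \<noteq> 0 \<Longrightarrow> c \<le> x \<and> x \<le> d" by blast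
  have "closure {x. \<phi> x \<noteq> 0} \<subseteq> {c..d}"
    by (rule closure_minimal) (use cd in auto)
  moreover from this have "compact (closure {x. \<phi> x \<noteq> 0})"
    by (meson bounded_closed_interval bounded_subset closed_closure compact_eq_bounded_closed)
  moreover have "{c..d} \<subseteq> {a<..<b}" using cd by auto
  ultimately show "\<phi> \<in> test_funs a b"
    using R unfolding test_funs_def smooth_def by blast
qed

lemma test_funsI:
  assumes "smooth \<phi>" "a < c" "d < b" "\<And>x. \<phi> x \<noteq> 0 \<Longrightarrow> c \<le> x \<and> x \<le> d"
  shows "\<phi> \<in> test_funs a b"
  using assms unfolding test_funs_iff by blast

lemma test_funs_supportE:
  assumes "\<phi> \<in> test_funs a b" "a < b"
  obtains c d where "a < c" "c < d" "d < b" "\<And>x. x \<notin> {c<..<d} \<Longrightarrow> \<phi> x = 0"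
proof -
  obtain c d where cd: "a < c" "d < b" "\<forall>x. \<phi> x \<noteq> 0 \<longrightarrow> c \<le> x \<and> x \<le> d"
    using assms(1) unfolding test_funs_iff by blast
  \<comment> \<open>Comparing with the midpoint orders the new bounds even if \<open>c\<close> and
    \<open>d\<close> cross; moving halfway to the endpoints makes them strictly wider than the
    support, so that \<open>\<phi>\<close> vanishes outside the open interval.\<close>
  define c' where "c' = (a + min c ((a+b)/2)) / 2"
  define d' where "d' = (b + max d ((a+b)/2)) / 2"
  have "a < c'" "c' < (a+b)/2" "c' < c" "(a+b)/2 < d'" "d' < b" "d < d'"
    using cd(1,2) assms(2) by (auto simp: c'_def d'_def min_def max_def field_simps)
  then show ?thesis using cd(3) by (intro that[of c' d']) force+
qed

lemma test_funs_smooth: "\<phi> \<in> test_funs a b \<Longrightarrow> smooth \<phi>"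
  by (simp add: test_funs_iff)

lemma test_funs_zero_outside: "\<phi> \<in> test_funs a b \<Longrightarrow> x \<notin> {a<..<b} \<Longrightarrow> \<phi> x = 0"
  unfolding test_funs_iff by (metis greaterThanLessThan_iff less_le_trans le_less_trans)

lemma test_funs_mono:
  assumes "\<phi> \<in> test_funs a' b'" "a \<le> a'" "b' \<le> b"
  shows "\<phi> \<in> test_funs a b"
  using assms unfolding test_funs_iff by (meson le_less_trans less_le_trans)

lemma deriv_zero_outside:
  fixes \<phi> :: "real \<Rightarrow> real"
  assumes "\<And>x. x \<notin> {c..d} \<Longrightarrow> \<phi> x = 0" "x \<notin> {c..d}"
  shows "deriv \<phi> x = 0"
proof (rule DERIV_imp_deriv)
  have "((\<lambda>x. 0) has_real_derivative 0) (at x)" by simp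
  then show "(\<phi> has_real_derivative 0) (at x)"
  proof (rule has_field_derivative_transform_within_open)
    show "open (- {c..d})" by auto
  qed (use assms in auto)
qed

lemma test_funs_deriv:
  assumes "\<phi> \<in> test_funs a b"
  shows "deriv \<phi> \<in> test_funs a b"
proof -
  obtain c d where cd: "a < c" "d < b" "\<forall>x. \<phi> x \<noteq> 0 \<longrightarrow> c \<le> x \<and> x \<le> d"
    using assms unfolding test_funs_iff by blast
  have "deriv \<phi> x = 0" if "x \<notin> {c..d}" for x
    by (rule deriv_zero_outside[OF _ that]) (use cd(3) in auto)
  then show ?thesis
    using smooth_deriv[OF test_funs_smooth[OF assms]] cd(1,2)
    by (intro test_funsI[of _ a c d b]) force+
qed

lemma test_funs_add:
  assumes "\<phi> \<in> test_funs a b" "\<psi> \<in> test_funs a b"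
  shows "(\<lambda>x. \<phi> x + \<psi> x) \<in> test_funs a b"
proof -
  obtain c d where cd: "a < c" "d < b" "\<forall>x. \<phi> x \<noteq> 0 \<longrightarrow> c \<le> x \<and> x \<le> d"
    using assms unfolding test_funs_iff by blast
  obtain c' d' where cd': "a < c'" "d' < b" "\<forall>x. \<psi> x \<noteq> 0 \<longrightarrow> c' \<le> x \<and> x \<le> d'"
    using assms unfolding test_funs_iff by blast
  show ?thesis
  proof (rule test_funsI)
    show "smooth (\<lambda>x. \<phi> x + \<psi> x)" using assms smooth_add test_funs_smooth by blast
    show "a < min c c'" "max d d' < b" using cd cd' by auto
    fix x assume "\<phi> x + \<psi> x \<noteq> 0"
    then have "\<phi> x \<noteq> 0 \<or> \<psi> x \<noteq> 0" by auto
    then show "min c c' \<le> x \<and> x \<le> max d d'" using cd(3) cd'(3) by force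
  qed
qed

lemma test_funs_mult_smooth:
  assumes "\<phi> \<in> test_funs a b" "smooth f"
  shows "(\<lambda>x. f x * \<phi> x) \<in> test_funs a b"
proof -
  obtain c d where cd: "a < c" "d < b" "\<forall>x. \<phi> x \<noteq> 0 \<longrightarrow> c \<le> x \<and> x \<le> d"
    using assms unfolding test_funs_iff by blast
  show ?thesis
    by (rule test_funsI[OF _ cd(1,2)])
      (use cd(3) smooth_mult[OF assms(2) test_funs_smooth[OF assms(1)]] in auto)
qed

lemma test_funs_cmult: "\<phi> \<in> test_funs a b \<Longrightarrow> (\<lambda>x. c * \<phi> x) \<in> test_funs a b"
  using test_funs_mult_smooth[OF _ smooth_const] .

lemma test_funs_bounded:
  assumes "\<phi> \<in> test_funs a b"
  obtains B where "B > 0" "\<And>x. \<bar>\<phi> x\<bar> \<le> B"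
proof -
  have "compact (\<phi> ` {a..b})"
    by (intro compact_continuous_image smooth_continuous_on test_funs_smooth[OF assms]) simp
  then obtain B where B: "\<And>x. x \<in> {a..b} \<Longrightarrow> norm (\<phi> x) \<le> B"
    using compact_imp_bounded[OF \<open>compact (\<phi> ` {a..b})\<close>] unfolding bounded_iff by blast
  have "\<bar>\<phi> x\<bar> \<le> max B 1" for x
  proof (cases "x \<in> {a..b}")
    case True
    then show ?thesis using B[OF True] by auto
  next
    case False
    then show ?thesis using test_funs_zero_outside[OF assms, of x] by auto
  qed
  then show ?thesis by (intro that[of "max B 1"]) auto
qed

text \<open>One factor switches on at \<open>c\<close>, the other off at \<open>d\<close>. Dilation
  by \<open>n + 1\<close> steepens the edges and keeps the support, so the bumps tend to the
  indicator of the open interval; this is how test functions reach measures of intervals.\<close>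

definition bump :: "real \<Rightarrow> real \<Rightarrow> nat \<Rightarrow> real \<Rightarrow> real" where
  "bump c d n x = flat_exp 1 (real (Suc n) * (x - c)) * flat_exp 1 (real (Suc n) * (d - x))"

lemma flat_exp_1: "flat_exp 1 x = (if x > 0 then exp (- (1 / x)) else 0)"
  by (simp add: flat_exp_def)

lemma flat_exp_1_bounds: "0 \<le> flat_exp 1 x" "flat_exp 1 x \<le> 1"
  by (auto simp: flat_exp_1)

lemma bump_smooth: "smooth (bump c d n)"
proof -
  have "smooth (\<lambda>x. flat_exp 1 (real (Suc n) * x + (- real (Suc n) * c)) *
      flat_exp 1 ((- real (Suc n)) * x + real (Suc n) * d))"
    by (intro smooth_mult smooth_affine_comp smooth_flat_exp)
  moreover have "(\<lambda>x. flat_exp 1 (real (Suc n) * x + (- real (Suc n) * c)) *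
      flat_exp 1 ((- real (Suc n)) * x + real (Suc n) * d)) = bump c d n"
    by (rule ext) (simp only: bump_def, simp add: algebra_simps)
  ultimately show ?thesis by simp
qed

lemma bump_pos: "x \<in> {c<..<d} \<Longrightarrow> 0 < bump c d n x"
  by (auto simp: bump_def flat_exp_1 zero_less_mult_iff)

lemma bump_zero: "x \<notin> {c<..<d} \<Longrightarrow> bump c d n x = 0"
  by (auto simp: bump_def flat_exp_1 zero_less_mult_iff)

lemma bump_bounds: "0 \<le> bump c d n x" "bump c d n x \<le> 1"
  using flat_exp_1_bounds by (auto simp: bump_def intro!: mult_le_one)

lemma bump_test_funs: "a < c \<Longrightarrow> d < b \<Longrightarrow> bump c d n \<in> test_funs a b"
  by (rule test_funsI[OF bump_smooth, of a c d b])
    (metis bump_zero greaterThanLessThan_iff less_imp_le)+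

lemma flat_exp_1_scale_tendsto:
  assumes "t > 0"
  shows "(\<lambda>n. flat_exp 1 (real (Suc n) * t)) \<longlonglongrightarrow> 1"
proof -
  have "(\<lambda>n. exp (- ((1 / real (Suc n)) * (1 / t)))) \<longlonglongrightarrow> exp (- (0 * (1 / t)))"
    by (intro tendsto_intros LIMSEQ_Suc lim_1_over_n)
  then show ?thesis using assms by (simp add: flat_exp_1)
qed

lemma bump_tendsto_indicator: "(\<lambda>n. bump c d n x) \<longlonglongrightarrow> indicator {c<..<d} x"
proof (cases "x \<in> {c<..<d}")
  case True
  have "(\<lambda>n. bump c d n x) \<longlonglongrightarrow> 1 * 1"
    unfolding bump_def using True by (intro tendsto_mult flat_exp_1_scale_tendsto) auto
  then show ?thesis using True by simp
next
  case False
  then show ?thesis by (simp add: bump_zero)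
qed

lemma test_funs_integrable:
  assumes "\<phi> \<in> test_funs a b"
  shows "integrable lborel \<phi>" "integrable lebesgue \<phi>"
proof -
  have "integrable lborel (\<lambda>x. indicator {a..b} x *\<^sub>R \<phi> x)"
    by (intro borel_integrable_compact smooth_continuous_on test_funs_smooth[OF assms]) simp
  moreover have "(\<lambda>x. indicator {a..b} x *\<^sub>R \<phi> x) = \<phi>"
    using test_funs_zero_outside[OF assms]
    by (intro ext) (metis atLeastAtMost_iff greaterThanLessThan_iff indicator_simps(1) less_imp_le mult_1 mult_zero_right real_scaleR_def)
  ultimately show "integrable lborel \<phi>" by simp
  then show "integrable lebesgue \<phi>" using integrable_completion[of \<phi> lborel] by (simp add: borel_measurable_integrable)
qed

lemma test_funs_integral:
  assumes "\<phi> \<in> test_funs a b"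
  shows "(\<integral>x. \<phi> x \<partial>leb a b) = (\<integral>x. \<phi> x \<partial>lborel)"
proof -
  have "(\<integral>x. \<phi> x \<partial>leb a b) = (\<integral>x. indicator {a<..<b} x *\<^sub>R \<phi> x \<partial>lebesgue)"
    by (subst integral_restrict_space) auto
  also have "(\<lambda>x. indicator {a<..<b} x *\<^sub>R \<phi> x) = \<phi>"
    using test_funs_zero_outside[OF assms] by (intro ext) (auto simp: indicator_def)
  also have "integral\<^sup>L lebesgue \<phi> = integral\<^sup>L lborel \<phi>"
    by (rule integral_completion) (use test_funs_integrable[OF assms] in auto)
  finally show ?thesis .
qed

text \<open>Zero mean is exactly what makes the primitive taken from the left vanish again to the
  right of the support.\<close>

lemma test_funs_antiderivative:
  assumes \<phi>: "\<phi> \<in> test_funs a b" and "a < b" and int0: "(\<integral>x. \<phi> x \<partial>lborel) = 0"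
  obtains \<Phi> where "\<Phi> \<in> test_funs a b" "deriv \<Phi> = \<phi>"
proof -
  obtain c d where cd: "a < c" "c < d" "d < b" "\<And>x. x \<notin> {c<..<d} \<Longrightarrow> \<phi> x = 0"
    using test_funs_supportE[OF assms(1,2)] by blast
  have sm: "smooth \<phi>" by (rule test_funs_smooth[OF \<phi>])
  \<comment> \<open>For \<open>x \<le> c\<close> the interval is a single point. Below,
    \<open>base\<close> allows any lower limit to the left of the support, hence one that makes
    \<open>x\<close> an interior point for the fundamental theorem of calculus.\<close>
  define \<Phi> where "\<Phi> x = integral {min c x..x} \<phi>" for x
  have z: "integral {u..v} \<phi> = 0" if "v \<le> c" for u v
  proof -
    have "integral {u..v} \<phi> = integral {u..v} (\<lambda>x. 0)"
      by (rule integral_cong) (use that cd(4) in auto)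
    then show ?thesis by simp
  qed
  have z': "integral {u..v} \<phi> = 0" if "u \<ge> d" for u v
  proof -
    have "integral {u..v} \<phi> = integral {u..v} (\<lambda>x. 0)"
      by (rule integral_cong) (use that cd(4) in auto)
    then show ?thesis by simp
  qed
  have int: "\<phi> integrable_on {u..v}" for u v
    by (intro integrable_continuous_real smooth_continuous_on sm)
  have base: "\<Phi> x = integral {l..x} \<phi>" if "l \<le> c" for l x
  proof (cases "x \<le> c")
    case True
    then show ?thesis by (simp add: \<Phi>_def z)
  next
    case False
    have "integral {k..x} \<phi> = integral {c..x} \<phi>" if "k \<le> c" for k
      using Henstock_Kurzweil_Integration.integral_combine[OF that _ int, of x] False z[of c k] by simp
    from this[OF that] show ?thesis using False unfolding \<Phi>_def by (simp add: min_def)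
  qed
  have der: "(\<Phi> has_real_derivative \<phi> x) (at x)" for x
  proof -
    define l where "l = min c (x - 1)"
    have "((\<lambda>u. integral {l..u} \<phi>) has_real_derivative \<phi> x) (at x within {l..x + 1})"
      by (rule integral_has_real_derivative[OF smooth_continuous_on[OF sm]]) (auto simp: l_def)
    then have "((\<lambda>u. integral {l..u} \<phi>) has_real_derivative \<phi> x) (at x)"
      by (subst (asm) at_within_interior) (auto simp: l_def)
    moreover have "\<Phi> = (\<lambda>u. integral {l..u} \<phi>)"
      by (intro ext base) (simp add: l_def)
    ultimately show ?thesis by simp
  qed
  have dP: "deriv \<Phi> = \<phi>" using der by (intro ext DERIV_imp_deriv)
  have smP: "smooth \<Phi>"
  proof (rule smooth_coinduct[where P = "\<lambda>f. f = \<Phi> \<or> smooth f"])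
    fix f assume "f = \<Phi> \<or> smooth f"
    then show "\<exists>f'. (f' = \<Phi> \<or> smooth f') \<and> (\<forall>x. (f has_real_derivative f' x) (at x))"
      using der sm smooth_deriv smooth_has_deriv by blast
  qed simp
  have full: "integral {c..d} \<phi> = 0"
  proof -
    have "integral {c..d} \<phi> = (\<integral>x. indicator {c..d} x *\<^sub>R \<phi> x \<partial>lborel)"
      using set_borel_integral_eq_integral(2)[OF borel_integrable_compact[of "{c..d}" \<phi>, folded set_integrable_def]]
        smooth_continuous_on[OF sm] by (simp add: set_lebesgue_integral_def)
    also have "(\<lambda>x. indicator {c..d} x *\<^sub>R \<phi> x) = \<phi>"
      using cd(4)
      by (intro ext) (metis atLeastAtMost_iff greaterThanLessThan_iff indicator_simps(1) less_imp_le mult_1 mult_zero_right real_scaleR_def)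
    finally show ?thesis using int0 by simp
  qed
  have "\<Phi> x = 0" if "x > d" for x
    using Henstock_Kurzweil_Integration.integral_combine[of c d x \<phi>] cd that full z' int base[of c x] by auto
  moreover have "\<Phi> x = 0" if "x < c" for x
    using that by (simp add: \<Phi>_def z)
  ultimately have "\<Phi> \<in> test_funs a b"
    by (intro test_funsI[OF smP \<open>a < c\<close> \<open>d < b\<close>]) (metis not_le)
  then show ?thesis using dP that by blast
qed


subsection \<open>Uniqueness of the absolutely continuous derivative\<close>

text \<open>Finite signed measures enter as linear combinations of finite measures.\<close>

lemma signed_measure_eq_0:
  fixes M :: "nat \<Rightarrow> real measure"
  assumes I: "finite I" and fin: "\<And>i. i \<in> I \<Longrightarrow> finite_measure (M i)"
    and sets: "\<And>i. i \<in> I \<Longrightarrow> sets (M i) = sets borel"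
    and test: "\<And>\<phi>. \<phi> \<in> test_funs a b \<Longrightarrow> (\<Sum>i\<in>I. \<epsilon> i * (\<integral>x. \<phi> x \<partial>M i)) = 0"
    and A: "A \<in> sets borel"
  shows "(\<Sum>i\<in>I. \<epsilon> i * measure (M i) (A \<inter> {a<..<b})) = 0"
proof -
  define D where "D A = (\<Sum>i\<in>I. \<epsilon> i * measure (M i) A)" for A
  have inner: "D {c<..<d} = 0" if cd: "a < c" "d < b" for c d
  proof -
    have "(\<lambda>n. \<integral>x. bump c d n x \<partial>M i) \<longlonglongrightarrow> measure (M i) {c<..<d}" if i: "i \<in> I" for i
    proof -
      interpret finite_measure "M i" using fin[OF i] .
      have m: "f \<in> borel_measurable (M i)" if "f \<in> borel_measurable borel" for f :: "real \<Rightarrow> real"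
        using that measurable_cong_sets[OF sets[OF i] refl] by blast
      have "(\<lambda>n. \<integral>x. bump c d n x \<partial>M i) \<longlonglongrightarrow> (\<integral>x. indicator {c<..<d} x \<partial>M i)"
      proof (rule integral_dominated_convergence[where w = "\<lambda>_. 1"])
        show "AE x in M i. (\<lambda>n. bump c d n x) \<longlonglongrightarrow> indicat_real {c<..<d} x"
          by (rule AE_I2) (rule bump_tendsto_indicator)
        show "AE x in M i. norm (bump c d n x) \<le> 1" for n
          by (rule AE_I2) (simp add: bump_bounds)
        show "indicat_real {c<..<d} \<in> borel_measurable (M i)"
          by (rule m) (rule borel_measurable_indicator, simp)
        show "bump c d n \<in> borel_measurable (M i)" for n
          by (rule m) (rule borel_measurable_continuous_onI[OF smooth_continuous_on[OF bump_smooth]])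
      qed simp
      then show ?thesis using sets[OF i] sets_eq_imp_space_eq[OF sets[OF i]] by simp
    qed
    then have "(\<lambda>n. \<Sum>i\<in>I. \<epsilon> i * (\<integral>x. bump c d n x \<partial>M i)) \<longlonglongrightarrow> D {c<..<d}"
      unfolding D_def by (intro tendsto_sum tendsto_mult_left)
    moreover have "(\<Sum>i\<in>I. \<epsilon> i * (\<integral>x. bump c d n x \<partial>M i)) = 0" for n
      by (rule test) (rule bump_test_funs[OF cd])
    ultimately show ?thesis by (simp add: LIMSEQ_const_iff)
  qed
  \<comment> \<open>Intervals reaching an endpoint of (a, b) are exhausted from inside, since only
    bumps supported strictly inside are test functions.\<close>
  have outer: "D ({c<..<d} \<inter> {a<..<b}) = 0" for c d
  proof -
    define A where "A n = {max c (a + inverse (real (Suc n)))<..<min d (b - inverse (real (Suc n)))}" for n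
    have "incseq A"
    proof (rule incseq_SucI)
      fix n
      have "inverse (real (Suc (Suc n))) \<le> inverse (real (Suc n))" by (rule le_imp_inverse_le) auto
      then have "max c (a + inverse (real (Suc (Suc n)))) \<le> max c (a + inverse (real (Suc n)))"
          "min d (b - inverse (real (Suc n))) \<le> min d (b - inverse (real (Suc (Suc n))))"
        by linarith+
      then show "A n \<subseteq> A (Suc n)" unfolding A_def greaterThanLessThan_subseteq_greaterThanLessThan by blast
    qed
    have U: "(\<Union>n. A n) = {c<..<d} \<inter> {a<..<b}"
    proof
      have "A n \<subseteq> {c<..<d} \<inter> {a<..<b}" for n
      proof
        fix x assume "x \<in> A n"
        moreover have "0 < inverse (real (Suc n))" by simp
        ultimately show "x \<in> {c<..<d} \<inter> {a<..<b}"
          unfolding A_def Int_iff greaterThanLessThan_iff max_less_iff_conj min_less_iff_conj by linarith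
      qed
      then show "(\<Union>n. A n) \<subseteq> {c<..<d} \<inter> {a<..<b}" by blast
      show "{c<..<d} \<inter> {a<..<b} \<subseteq> (\<Union>n. A n)"
      proof
        fix x assume x: "x \<in> {c<..<d} \<inter> {a<..<b}"
        then have "0 < min (x - a) (b - x)" by auto
        then obtain n where "inverse (real (Suc n)) < min (x - a) (b - x)"
          using reals_Archimedean by blast
        then have "x \<in> A n" using x unfolding A_def by auto
        then show "x \<in> (\<Union>n. A n)" by blast
      qed
    qed
    have "(\<lambda>n. measure (M i) (A n)) \<longlonglongrightarrow> measure (M i) (\<Union>n. A n)" if i: "i \<in> I" for i
      by (rule finite_measure.finite_Lim_measure_incseq[OF fin[OF i] _ \<open>incseq A\<close>])
        (auto simp: sets[OF i] A_def)
    then have "(\<lambda>n. D (A n)) \<longlonglongrightarrow> D ({c<..<d} \<inter> {a<..<b})"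
      unfolding D_def U by (intro tendsto_sum tendsto_mult_left)
    moreover have "D (A n) = 0" for n
      unfolding A_def by (rule inner) (auto simp: less_max_iff_disj min_less_iff_disj)
    ultimately show ?thesis by (simp add: LIMSEQ_const_iff)
  qed
  have sig: "sets borel = sigma_sets UNIV (range (\<lambda>(c, d). {c<..<d::real}))"
    unfolding borel_eq_box box_real by (rule sets_measure_of) simp
  have A': "A \<in> sigma_sets UNIV (range (\<lambda>(c, d). {c<..<d::real}))" using A sig by simp
  \<comment> \<open>\<open>D\<close> is signed, so rather than comparing two measures the pi-lambda
    induction from open intervals is run on \<open>D\<close> itself.\<close>
  have "D (A \<inter> {a<..<b}) = 0"
  proof (rule sigma_sets_induct_disjoint[OF _ _ A', where P = "\<lambda>A. D (A \<inter> {a<..<b}) = 0"])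
    show "Int_stable (range (\<lambda>(c, d). {c<..<d::real}))"
      by (auto simp: Int_stable_def Int_greaterThanLessThan)
  next
    fix A assume "A \<in> range (\<lambda>(c, d). {c<..<d::real})"
    then show "D (A \<inter> {a<..<b}) = 0" using outer by auto
  next
    show "D ({} \<inter> {a<..<b}) = 0" by (simp add: D_def)
  next
    fix A assume "A \<in> sigma_sets UNIV (range (\<lambda>(c, d). {c<..<d::real}))" and 0: "D (A \<inter> {a<..<b}) = 0"
    then have A: "A \<in> sets borel" using sig by simp
    have "measure (M i) ((UNIV - A) \<inter> {a<..<b}) = measure (M i) {a<..<b} - measure (M i) (A \<inter> {a<..<b})"
      if i: "i \<in> I" for i
    proof -
      have "(UNIV - A) \<inter> {a<..<b} = {a<..<b} - A \<inter> {a<..<b}" by blast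
      then show ?thesis
        using finite_measure.finite_measure_Diff[OF fin[OF i], of "{a<..<b}" "A \<inter> {a<..<b}"] A sets[OF i]
        by simp
    qed
    then have "D ((UNIV - A) \<inter> {a<..<b}) = D {a<..<b} - D (A \<inter> {a<..<b})"
      unfolding D_def by (simp add: sum_subtractf right_diff_distrib)
    then show "D ((UNIV - A) \<inter> {a<..<b}) = 0" using outer[of a b] 0 by simp
  next
    fix A :: "nat \<Rightarrow> real set"
    assume d: "disjoint_family A" and r: "range A \<subseteq> sigma_sets UNIV (range (\<lambda>(c, d). {c<..<d::real}))"
      and z: "\<And>i. D (A i \<inter> {a<..<b}) = 0"
    have A: "A n \<in> sets borel" for n using r sig by blast
    have "(\<lambda>n. measure (M i) (A n \<inter> {a<..<b})) sums measure (M i) (\<Union>n. A n \<inter> {a<..<b})" if i: "i \<in> I" for i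
      by (rule finite_measure.finite_measure_UNION[OF fin[OF i]])
        (use A d in \<open>auto simp: sets[OF i] disjoint_family_on_def\<close>)
    then have "(\<lambda>n. D (A n \<inter> {a<..<b})) sums D (\<Union>n. A n \<inter> {a<..<b})"
      unfolding D_def by (intro sums_sum sums_mult)
    then show "D (\<Union> (range A) \<inter> {a<..<b}) = 0" using z by (simp add: sums_unique2)
  qed auto
  then show ?thesis by (simp add: D_def)
qed

lemma test_integral_lebesgue:
  assumes "\<phi> \<in> test_funs a b"
  shows "pairing a b f \<phi> = (\<integral>x. f x * \<phi> x \<partial>lebesgue)"
proof -
  have "pairing a b f \<phi> = (\<integral>x. indicator {a<..<b} x *\<^sub>R (f x * \<phi> x) \<partial>lebesgue)"
    by (subst integral_restrict_space) auto
  also have "(\<lambda>x. indicator {a<..<b} x *\<^sub>R (f x * \<phi> x)) = (\<lambda>x. f x * \<phi> x)"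
  proof (rule ext)
    fix x show "indicator {a<..<b} x *\<^sub>R (f x * \<phi> x) = f x * \<phi> x"
      using test_funs_zero_outside[OF assms, of x] by (cases "x \<in> {a<..<b}") auto
  qed
  finally show ?thesis .
qed

lemma test_integral_subinterval:
  assumes "\<phi> \<in> test_funs a' b'" "a \<le> a'" "b' \<le> b"
  shows "pairing a b f \<phi> = pairing a' b' f \<phi>"
  using test_integral_lebesgue[OF assms(1)] test_integral_lebesgue[OF test_funs_mono[OF assms]] by simp

lemma smooth_borel_measurable: "smooth f \<Longrightarrow> f \<in> borel_measurable borel"
  by (rule borel_measurable_continuous_onI[OF smooth_continuous_on])

lemma smooth_lebesgue_measurable: "smooth f \<Longrightarrow> f \<in> borel_measurable (lebesgue_on S)"
  using smooth_borel_measurable by (intro measurable_restrict_space1 measurable_completion) simp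

lemma integrable_mult_test:
  assumes f: "integrable (lebesgue_on S) f" and "\<phi> \<in> test_funs a b"
  shows "integrable (lebesgue_on S) (\<lambda>x. f x * \<phi> x)"
proof -
  obtain B where B: "B > 0" "\<And>x. \<bar>\<phi> x\<bar> \<le> B" using test_funs_bounded[OF assms(2)] by blast
  show ?thesis
  proof (rule Bochner_Integration.integrable_bound)
    show "integrable (lebesgue_on S) (\<lambda>x. B * f x)" using f by simp
    show "(\<lambda>x. f x * \<phi> x) \<in> borel_measurable (lebesgue_on S)"
      using borel_measurable_integrable[OF f] smooth_lebesgue_measurable[OF test_funs_smooth[OF assms(2)]]
      by (rule borel_measurable_times)
    show "AE x in lebesgue_on S. norm (f x * \<phi> x) \<le> norm (B * f x)"
      using B by (intro AE_I2) (simp add: abs_mult mult.commute mult_right_mono)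
  qed
qed

lemma finite_measure_density_pos_part:
  assumes "integrable lborel k"
  shows "finite_measure (density lborel (\<lambda>x. ennreal (max 0 (k x))))"
proof (rule finite_measureI)
  have "integrable lborel (\<lambda>x. max 0 (k x))" using assms by simp
  then have "(\<integral>\<^sup>+x. ennreal (max 0 (k x)) \<partial>lborel) = ennreal (\<integral>x. max 0 (k x) \<partial>lborel)"
    by (intro nn_integral_eq_integral) auto
  then show "emeasure (density lborel (\<lambda>x. ennreal (max 0 (k x))))
      (space (density lborel (\<lambda>x. ennreal (max 0 (k x))))) \<noteq> \<infinity>"
    using assms by (subst emeasure_density) (auto simp: borel_measurable_integrable)
qed

text \<open>The difference of the two decompositions is a signed measure that annihilates all test
  functions, so it is zero on (a, b). Evaluated where \<open>g\<^sub>1 > g\<^sub>2\<close>, off the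
  null sets carrying the singular parts, it reduces to the density
  \<open>g\<^sub>1 - g\<^sub>2\<close>, and this set must be null.\<close>

lemma has_ac_deriv_le:
  assumes 1: "has_ac_deriv a b v g\<^sub>1" and 2: "has_ac_deriv a b v g\<^sub>2"
  shows "AE x in leb a b. g\<^sub>1 x \<le> g\<^sub>2 x"
proof -
  let ?I = "{a<..<b}"
  obtain M1 M2 :: "real measure" and N where
    g1: "integrable (lebesgue_on ?I) g\<^sub>1" and
    M: "finite_measure M1" "sets M1 = sets borel" "finite_measure M2" "sets M2 = sets borel"
      "N \<in> null_sets lborel" "emeasure M1 (- N) = 0" "emeasure M2 (- N) = 0" and
    eq1: "\<And>\<phi>. \<phi> \<in> test_funs a b \<Longrightarrow> (\<integral>x. v x * deriv \<phi> x \<partial>lebesgue_on ?I) =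
             - ((\<integral>x. g\<^sub>1 x * \<phi> x \<partial>lebesgue_on ?I) + (\<integral>x. \<phi> x \<partial>M1) - (\<integral>x. \<phi> x \<partial>M2))"
    using 1 unfolding has_ac_deriv_def by blast
  obtain M1' M2' :: "real measure" and N' where
    g2: "integrable (lebesgue_on ?I) g\<^sub>2" and
    M': "finite_measure M1'" "sets M1' = sets borel" "finite_measure M2'" "sets M2' = sets borel"
      "N' \<in> null_sets lborel" "emeasure M1' (- N') = 0" "emeasure M2' (- N') = 0" and
    eq2: "\<And>\<phi>. \<phi> \<in> test_funs a b \<Longrightarrow> (\<integral>x. v x * deriv \<phi> x \<partial>lebesgue_on ?I) =
             - ((\<integral>x. g\<^sub>2 x * \<phi> x \<partial>lebesgue_on ?I) + (\<integral>x. \<phi> x \<partial>M1') - (\<integral>x. \<phi> x \<partial>M2'))"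
    using 2 unfolding has_ac_deriv_def by blast
  define G where "G x = indicator ?I x *\<^sub>R (g\<^sub>1 x - g\<^sub>2 x)" for x
  have "integrable (lebesgue_on ?I) (\<lambda>x. g\<^sub>1 x - g\<^sub>2 x)" using g1 g2 by simp
  then have Gi: "integrable lebesgue G"
    unfolding G_def by (subst (asm) integrable_restrict_space) (auto simp: set_integrable_def)
  \<comment> \<open>Densities with respect to \<open>lborel\<close> have to be Borel, so the
    Lebesgue measurable \<open>G\<close> is replaced by a Borel version.\<close>
  obtain k where km: "k \<in> borel_measurable lborel" and kae: "AE x in lborel. G x = k x"
    using completion_ex_borel_measurable_real[OF borel_measurable_integrable[OF Gi]] by blast
  have kae': "AE x in lebesgue. G x = k x" using kae by (rule AE_completion)
  have ki': "integrable lebesgue k"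
    by (rule integrable_cong_AE_imp[OF Gi measurable_completion[OF km] kae'])
  then have ki: "integrable lborel k" using integrable_completion[OF km] by simp
  define N1 where "N1 = density lborel (\<lambda>x. ennreal (max 0 (k x)))"
  define N2 where "N2 = density lborel (\<lambda>x. ennreal (max 0 (- k x)))"
  have fin1: "finite_measure N1"
    unfolding N1_def using ki by (rule finite_measure_density_pos_part)
  have fin2: "finite_measure N2"
    unfolding N2_def using ki by (intro finite_measure_density_pos_part integrable_minus)
  \<comment> \<open>The positive and negative part of \<open>(g\<^sub>1 - g\<^sub>2) dx\<close> and
    the four singular measures, with the signs they have in the difference of the two
    identities.\<close>
  define MM where "MM i = [N1, N2, M1, M2, M1', M2'] ! i" for i :: nat
  define \<epsilon> where "\<epsilon> i = [1, -1, 1, -1, -1, 1 :: real] ! i" for i :: nat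
  have MM: "MM 0 = N1" "MM 1 = N2" "MM 2 = M1" "MM 3 = M2" "MM 4 = M1'" "MM 5 = M2'"
    by (simp_all add: MM_def eval_nat_numeral)
  have I6: "i \<in> {..<6::nat} \<longleftrightarrow> i = 0 \<or> i = 1 \<or> i = 2 \<or> i = 3 \<or> i = 4 \<or> i = 5" for i by auto
  have sum6: "(\<Sum>i<6. \<epsilon> i * F (MM i)) = F N1 - F N2 + F M1 - F M2 - F M1' + F M2'" for F :: "real measure \<Rightarrow> real"
    by (simp add: eval_nat_numeral \<epsilon>_def MM_def)
  have D0: "measure N1 (A \<inter> ?I) - measure N2 (A \<inter> ?I) + measure M1 (A \<inter> ?I) - measure M2 (A \<inter> ?I)
      - measure M1' (A \<inter> ?I) + measure M2' (A \<inter> ?I) = 0" if A: "A \<in> sets borel" for A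
    unfolding sum6[symmetric, of "\<lambda>M. measure M (A \<inter> ?I)"]
  proof (rule signed_measure_eq_0[OF _ _ _ _ A])
    show "finite_measure (MM i)" if "i \<in> {..<6}" for i
      using that unfolding I6 by (elim disjE) (simp_all only: MM fin1 fin2 M M')
    show "sets (MM i) = sets borel" if "i \<in> {..<6}" for i
      using that unfolding I6
      by (elim disjE) (simp_all only: MM M M' N1_def N2_def sets_density sets_lborel)
    fix \<phi> assume \<phi>: "\<phi> \<in> test_funs a b"
    have pm: "\<phi> \<in> borel_measurable lborel" using smooth_borel_measurable[OF test_funs_smooth[OF \<phi>]] by simp
    obtain B where B: "B > 0" "\<And>x. \<bar>\<phi> x\<bar> \<le> B" using test_funs_bounded[OF \<phi>] by blast
    have bi: "integrable lborel (\<lambda>x. f x * \<phi> x)" if "integrable lborel f" for f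
    proof (rule Bochner_Integration.integrable_bound)
      show "integrable lborel (\<lambda>x. B * f x)" using that by simp
      show "(\<lambda>x. f x * \<phi> x) \<in> borel_measurable lborel"
        using borel_measurable_integrable[OF that] pm by (rule borel_measurable_times)
      show "AE x in lborel. norm (f x * \<phi> x) \<le> norm (B * f x)"
        using B by (intro AE_I2) (simp add: abs_mult mult.commute mult_right_mono)
    qed
    have "(\<integral>x. \<phi> x \<partial>N1) = (\<integral>x. max 0 (k x) * \<phi> x \<partial>lborel)"
    proof -
      have "(\<lambda>x. max 0 (k x)) \<in> borel_measurable lborel"
        by (intro borel_measurable_max borel_measurable_const km)
      from integral_density[OF pm this] show ?thesis unfolding N1_def by simp
    qed
    moreover have "(\<integral>x. \<phi> x \<partial>N2) = (\<integral>x. max 0 (- k x) * \<phi> x \<partial>lborel)"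
    proof -
      have "(\<lambda>x. max 0 (- k x)) \<in> borel_measurable lborel"
        by (intro borel_measurable_max borel_measurable_const borel_measurable_uminus km)
      from integral_density[OF pm this] show ?thesis unfolding N2_def by simp
    qed
    ultimately have "(\<integral>x. \<phi> x \<partial>N1) - (\<integral>x. \<phi> x \<partial>N2)
        = (\<integral>x. max 0 (k x) * \<phi> x \<partial>lborel) - (\<integral>x. max 0 (- k x) * \<phi> x \<partial>lborel)" by simp
    also have "\<dots> = (\<integral>x. max 0 (k x) * \<phi> x - max 0 (- k x) * \<phi> x \<partial>lborel)"
      by (rule Bochner_Integration.integral_diff[symmetric]) (intro bi integrable_max ki integrable_zero integrable_minus)+
    also have "(\<lambda>x. max 0 (k x) * \<phi> x - max 0 (- k x) * \<phi> x) = (\<lambda>x. k x * \<phi> x)"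
      by (auto simp: max_def fun_eq_iff)
    also have "(\<integral>x. k x * \<phi> x \<partial>lborel) = (\<integral>x. k x * \<phi> x \<partial>lebesgue)"
      by (rule integral_completion[symmetric]) (use km pm in simp)
    also have "\<dots> = (\<integral>x. G x * \<phi> x \<partial>lebesgue)"
    proof (rule integral_cong_AE)
      show "(\<lambda>x. k x * \<phi> x) \<in> borel_measurable lebesgue"
        using km pm by (intro measurable_completion borel_measurable_times)
      show "(\<lambda>x. G x * \<phi> x) \<in> borel_measurable lebesgue"
        using borel_measurable_integrable[OF Gi] measurable_completion[OF pm] by (rule borel_measurable_times)
      show "AE x in lebesgue. k x * \<phi> x = G x * \<phi> x" using kae' by eventually_elim simp
    qed
    also have "\<dots> = (\<integral>x. (g\<^sub>1 x - g\<^sub>2 x) * \<phi> x \<partial>lebesgue_on ?I)"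
      unfolding G_def test_integral_lebesgue[OF \<phi>]
    proof (rule Bochner_Integration.integral_cong[OF refl])
      fix x show "indicator ?I x *\<^sub>R (g\<^sub>1 x - g\<^sub>2 x) * \<phi> x = (g\<^sub>1 x - g\<^sub>2 x) * \<phi> x"
        using test_funs_zero_outside[OF \<phi>, of x] by (cases "x \<in> ?I") auto
    qed
    also have "\<dots> = (\<integral>x. g\<^sub>1 x * \<phi> x \<partial>lebesgue_on ?I) - (\<integral>x. g\<^sub>2 x * \<phi> x \<partial>lebesgue_on ?I)"
      unfolding left_diff_distrib
      by (rule Bochner_Integration.integral_diff) (intro integrable_mult_test[OF _ \<phi>] g1 g2)+
    finally show "(\<Sum>i<6. \<epsilon> i * (\<integral>x. \<phi> x \<partial>MM i)) = 0"
      unfolding sum6[of "\<lambda>M. \<integral>x. \<phi> x \<partial>M"] using eq1[OF \<phi>] eq2[OF \<phi>] by linarith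
  qed simp
  \<comment> \<open>All four singular measures vanish on \<open>A\<close> because it avoids
    \<open>N\<close> and \<open>N'\<close>, and so does \<open>N2\<close> because \<open>k\<close>
    is positive there; only \<open>N1\<close> is left.\<close>
  define A where "A = {x. k x > 0} - N - N'"
  have Nb: "N \<in> sets borel" "N' \<in> sets borel" using M(5) M'(5) by (auto dest: null_setsD2)
  have A: "A \<in> sets borel" unfolding A_def using km Nb by measurable
  have sing: "measure \<nu> (A \<inter> ?I) = 0" if "sets \<nu> = sets borel" "emeasure \<nu> (- L) = 0" "L \<in> sets borel" "A \<subseteq> - L" for \<nu> :: "real measure" and L
  proof -
    have "emeasure \<nu> (A \<inter> ?I) \<le> emeasure \<nu> (- L)"
      using that by (intro emeasure_mono) auto
    then show ?thesis using that(2) by (simp add: measure_def)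
  qed
  have "measure M1 (A \<inter> ?I) = 0" "measure M2 (A \<inter> ?I) = 0"
    by (rule sing[OF M(2,6) Nb(1)], force simp: A_def, rule sing[OF M(4,7) Nb(1)], force simp: A_def)
  moreover have "measure M1' (A \<inter> ?I) = 0" "measure M2' (A \<inter> ?I) = 0"
    by (rule sing[OF M'(2,6) Nb(2)], force simp: A_def, rule sing[OF M'(4,7) Nb(2)], force simp: A_def)
  moreover have "emeasure N2 (A \<inter> ?I) = 0"
  proof -
    have "emeasure N2 (A \<inter> ?I) = (\<integral>\<^sup>+x. ennreal (max 0 (- k x)) * indicator (A \<inter> ?I) x \<partial>lborel)"
      unfolding N2_def using km A by (subst emeasure_density) auto
    also have "\<dots> = (\<integral>\<^sup>+x. 0 \<partial>(lborel :: real measure))"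
      by (rule nn_integral_cong) (auto simp: A_def indicator_def)
    finally show ?thesis by simp
  qed
  ultimately have "measure N1 (A \<inter> ?I) = 0" using D0[OF A] by (simp add: measure_def)
  then have "emeasure N1 (A \<inter> ?I) = 0" using finite_measure.emeasure_eq_measure[OF fin1] by simp
  moreover have "emeasure N1 (A \<inter> ?I) = (\<integral>\<^sup>+x. ennreal (max 0 (k x)) * indicator (A \<inter> ?I) x \<partial>lborel)"
    unfolding N1_def using km A by (subst emeasure_density) auto
  ultimately have "AE x in lborel. ennreal (max 0 (k x)) * indicator (A \<inter> ?I) x = 0"
    using km A by (intro nn_integral_0_iff_AE[THEN iffD1]) (simp_all, measurable)
  moreover have "AE x in lborel. x \<notin> N" "AE x in lborel. x \<notin> N'"
    using M(5) M'(5) by (auto intro: AE_not_in)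
  ultimately have "AE x in lborel. x \<in> ?I \<longrightarrow> g\<^sub>1 x \<le> g\<^sub>2 x"
    using kae
  proof eventually_elim
    case (elim x)
    then show ?case
      by (auto simp: A_def G_def indicator_def split: if_splits)
  qed
  then have "AE x in lebesgue. x \<in> ?I \<longrightarrow> g\<^sub>1 x \<le> g\<^sub>2 x" by (rule AE_completion)
  then show ?thesis by (subst AE_restrict_space_iff) auto
qed

lemma has_ac_deriv_unique:
  assumes "has_ac_deriv a b v g\<^sub>1" "has_ac_deriv a b v g\<^sub>2"
  shows "ae_eq a b g\<^sub>1 g\<^sub>2"
  unfolding ae_eq_def using has_ac_deriv_le[OF assms] has_ac_deriv_le[OF assms(2,1)]
  by eventually_elim simp

lemma has_weak_deriv_imp_has_ac_deriv:
  assumes "has_weak_deriv a b v g"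
  shows "has_ac_deriv a b v g"
proof -
  have "finite_measure (null_measure (borel :: real measure))"
    by (rule finite_measureI) (simp add: space_null_measure emeasure_null_measure)
  then show ?thesis
    using assms unfolding has_weak_deriv_def has_ac_deriv_def
    by (auto intro!: exI[of _ "null_measure borel"] exI[of _ "{}"])
qed

text \<open>Both \<open>f\<close> and 0 are weak derivatives of 0, so the uniqueness of the
  absolutely continuous derivative applies.\<close>

lemma fundamental_lemma:
  assumes "integrable (leb a b) f"
    and "\<And>\<phi>. \<phi> \<in> test_funs a b \<Longrightarrow> (pairing a b f \<phi>) = 0"
  shows "AE x in leb a b. f x = 0"
proof -
  have "has_weak_deriv a b (\<lambda>x. 0) f" using assms by (simp add: has_weak_deriv_def)
  moreover have "has_weak_deriv a b (\<lambda>x. 0) (\<lambda>x. 0)" by (simp add: has_weak_deriv_def)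
  ultimately show ?thesis
    using has_ac_deriv_unique has_weak_deriv_imp_has_ac_deriv unfolding ae_eq_def by blast
qed


subsection \<open>The lemma of du Bois-Reymond and primitives\<close>

lemma test_deriv_ray:
  assumes \<phi>: "\<phi> \<in> test_funs a b"
  shows "(\<integral>x. (if s < x then deriv \<phi> x else 0) \<partial>lborel) = - \<phi> s"
proof -
  \<comment> \<open>\<open>\<phi>\<close> vanishes from \<open>b\<close> on; the maximum keeps
    \<open>{s..T}\<close> nonempty when \<open>s\<close> lies beyond \<open>b\<close>.\<close>
  define T where "T = max s b"
  have sm: "smooth \<phi>" by (rule test_funs_smooth[OF \<phi>])
  have "(\<integral>x. deriv \<phi> x * indicator {s..T} x \<partial>lborel) = \<phi> T - \<phi> s"
    by (rule integral_FTC_Icc_real)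
      (use smooth_has_deriv[OF sm] smooth_isCont[OF smooth_deriv[OF sm]] in \<open>auto simp: T_def\<close>)
  moreover have "\<phi> T = 0" by (rule test_funs_zero_outside[OF \<phi>]) (simp add: T_def)
  moreover have "(\<integral>x. (if s < x then deriv \<phi> x else 0) \<partial>lborel)
      = (\<integral>x. deriv \<phi> x * indicator {s..T} x \<partial>lborel)"
  proof (rule integral_cong_AE)
    have m: "deriv \<phi> \<in> borel_measurable borel" by (rule smooth_borel_measurable[OF smooth_deriv[OF sm]])
    show "(\<lambda>x. if s < x then deriv \<phi> x else 0) \<in> borel_measurable lborel" using m by measurable
    show "(\<lambda>x. deriv \<phi> x * indicator {s..T} x) \<in> borel_measurable lborel" using m by measurable
    have z: "deriv \<phi> x = 0" if "x > T" for x
      by (rule test_funs_zero_outside[OF test_funs_deriv[OF \<phi>]]) (use that in \<open>simp add: T_def\<close>)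
    show "AE x in lborel. (if s < x then deriv \<phi> x else 0) = deriv \<phi> x * indicator {s..T} x"
      using AE_lborel_singleton[of s]
    proof eventually_elim
      case (elim x)
      then show ?case using z[of x] by (cases "x > T") (auto simp: indicator_def)
    qed
  qed
  ultimately show ?thesis by simp
qed

lemma test_deriv_integral_0:
  assumes \<phi>: "\<phi> \<in> test_funs a b"
  shows "(\<integral>x. deriv \<phi> x \<partial>lborel) = 0"
proof -
  have "(\<lambda>x. if a < x then deriv \<phi> x else 0) = deriv \<phi>"
    using test_funs_zero_outside[OF test_funs_deriv[OF \<phi>]] by (intro ext) simp
  then show ?thesis
    using test_deriv_ray[OF \<phi>, of a] test_funs_zero_outside[OF \<phi>, of a] by simp
qed

lemma test_funs_times_shift:
  assumes \<phi>: "\<phi> \<in> test_funs a b"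
  shows "(\<lambda>x. (x - s) * \<phi> x) \<in> test_funs a b"
    and "deriv (\<lambda>x. (x - s) * \<phi> x) = (\<lambda>x. \<phi> x + (x - s) * deriv \<phi> x)"
proof -
  have "smooth (\<lambda>x. x + (- s))" by (intro smooth_add smooth_ident smooth_const)
  then show "(\<lambda>x. (x - s) * \<phi> x) \<in> test_funs a b" using test_funs_mult_smooth[OF \<phi>] by simp
  show "deriv (\<lambda>x. (x - s) * \<phi> x) = (\<lambda>x. \<phi> x + (x - s) * deriv \<phi> x)"
  proof (intro ext DERIV_imp_deriv)
    fix x
    have "((\<lambda>x. x - s) has_real_derivative 1) (at x)" by (auto intro!: derivative_eq_intros)
    from DERIV_mult[OF this smooth_has_deriv[OF test_funs_smooth[OF \<phi>]]]
    show "((\<lambda>x. (x - s) * \<phi> x) has_real_derivative \<phi> x + (x - s) * deriv \<phi> x) (at x)"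
      by (simp add: mult.commute)
  qed
qed

text \<open>\<open>\<phi>\<close> minus its integral times \<open>\<rho>\<close> has mean zero and
  hence a primitive that is again a test function. Derivatives of test functions thus have
  codimension one, which lets constants be recovered from one integral against
  \<open>\<rho>\<close>.\<close>

lemma test_decompose:
  assumes "a < b"
  obtains \<rho> where "\<rho> \<in> test_funs a b" "(\<integral>x. \<rho> x \<partial>lborel) = 1"
    "\<And>\<phi>. \<phi> \<in> test_funs a b \<Longrightarrow> \<exists>\<Phi>\<in>test_funs a b. \<phi> = (\<lambda>x. (\<integral>x. \<phi> x \<partial>lborel) * \<rho> x + deriv \<Phi> x)"
proof -
  define c where "c = (2 * a + b) / 3"
  define d where "d = (a + 2 * b) / 3"
  have cd: "a < c" "c < d" "d < b" using assms by (auto simp: c_def d_def field_simps)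
  have bt: "bump c d 0 \<in> test_funs a b" by (rule bump_test_funs[OF cd(1,3)])
  have bi: "integrable lborel (bump c d 0)" by (rule test_funs_integrable[OF bt])
  define J where "J = (\<integral>x. bump c d 0 x \<partial>lborel)"
  have "J \<noteq> 0"
  proof
    assume "J = 0"
    then have "AE x in lborel. bump c d 0 x = 0"
      using integral_nonneg_eq_0_iff_AE[OF bi] bump_bounds(1) by (simp add: J_def)
    then have "AE x in lborel. x \<notin> {c<..<d}"
      by eventually_elim (metis bump_pos less_irrefl)
    then have "emeasure lborel {x \<in> space lborel. x \<in> {c<..<d}} = 0" by (rule emeasure_eq_0_AE)
    moreover have "{x \<in> space lborel. x \<in> {c<..<d}} = {c<..<d}" by auto
    ultimately have "emeasure lborel {c<..<d} = 0" by metis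
    then show False using cd by simp
  qed
  define \<rho> where "\<rho> x = (1 / J) * bump c d 0 x" for x
  have \<rho>: "\<rho> \<in> test_funs a b" unfolding \<rho>_def by (rule test_funs_cmult[OF bt])
  have \<rho>1: "(\<integral>x. \<rho> x \<partial>lborel) = 1"
    unfolding \<rho>_def using \<open>J \<noteq> 0\<close> by (simp add: J_def)
  have "\<exists>\<Phi>\<in>test_funs a b. \<phi> = (\<lambda>x. (\<integral>x. \<phi> x \<partial>lborel) * \<rho> x + deriv \<Phi> x)"
    if \<phi>: "\<phi> \<in> test_funs a b" for \<phi>
  proof -
    define C where "C = (\<integral>x. \<phi> x \<partial>lborel)"
    have t: "(\<lambda>x. \<phi> x + (- C) * \<rho> x) \<in> test_funs a b"
      by (intro test_funs_add \<phi> test_funs_cmult \<rho>)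
    have "(\<integral>x. \<phi> x + (- C) * \<rho> x \<partial>lborel) = C + (- C) * 1"
      using test_funs_integrable(1)[OF \<phi>] test_funs_integrable(1)[OF \<rho>] \<rho>1 by (simp add: C_def)
    then obtain \<Phi> where "\<Phi> \<in> test_funs a b" "deriv \<Phi> = (\<lambda>x. \<phi> x + (- C) * \<rho> x)"
      using test_funs_antiderivative[OF t assms] by auto
    then show ?thesis unfolding C_def by (intro bexI[of _ \<Phi>]) auto
  qed
  then show ?thesis by (rule that[OF \<rho> \<rho>1])
qed

lemma continuous_integrable_interval:
  fixes f :: "real \<Rightarrow> real"
  assumes "continuous_on {a..b} f"
  shows "integrable (leb a b) f"
proof -
  have "integrable (lebesgue_on {a..b}) f" by (rule continuous_imp_integrable_real[OF assms])
  then have "set_integrable lebesgue {a..b} f"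
    by (subst (asm) integrable_restrict_space) (auto simp: set_integrable_def)
  then have "set_integrable lebesgue {a<..<b} f" by (rule set_integrable_subset) auto
  then show ?thesis by (subst integrable_restrict_space) (auto simp: set_integrable_def)
qed

lemma test_x_deriv:
  assumes \<phi>: "\<phi> \<in> test_funs a b"
  shows "(\<integral>x. x * deriv \<phi> x \<partial>leb a b) = - (\<integral>x. \<phi> x \<partial>lborel)"
proof -
  have "(\<integral>x. x * deriv \<phi> x \<partial>leb a b) + (\<integral>x. \<phi> x \<partial>leb a b)
      = (\<integral>x. deriv (\<lambda>x. (x - 0) * \<phi> x) x \<partial>leb a b)"
    unfolding test_funs_times_shift(2)[OF \<phi>]
  proof (subst Bochner_Integration.integral_add[symmetric])
    show "integrable (leb a b) (\<lambda>x. x * deriv \<phi> x)"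
      by (rule integrable_mult_test[OF continuous_integrable_interval[OF continuous_on_id] test_funs_deriv[OF \<phi>]])
    show "integrable (leb a b) \<phi>"
      by (rule continuous_integrable_interval[OF smooth_continuous_on[OF test_funs_smooth[OF \<phi>]]])
  qed (simp add: add.commute)
  also have "\<dots> = 0"
    using test_funs_integral[OF test_funs_deriv[OF test_funs_times_shift(1)[OF \<phi>, of 0]]]
      test_deriv_integral_0[OF test_funs_times_shift(1)[OF \<phi>, of 0]] by simp
  finally show ?thesis using test_funs_integral[OF \<phi>] by simp
qed

lemma deriv_lincomb:
  assumes "smooth f" "smooth g"
  shows "deriv (\<lambda>x. c * f x + g x) = (\<lambda>x. c * deriv f x + deriv g x)"
  by (intro ext DERIV_imp_deriv DERIV_add DERIV_cmult smooth_has_deriv assms)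

text \<open>The decomposition is used twice. Applied to \<open>u\<close>, it identifies the weak
  derivative with the constant \<open>l\<close>, so \<open>u - l x\<close> kills all derivatives of
  test functions; applied to \<open>u - l x\<close>, it identifies this function with a
  constant.\<close>

lemma weak_affine:
  assumes "a < b" and u: "integrable (leb a b) u"
    and z: "\<And>\<phi>. \<phi> \<in> test_funs a b \<Longrightarrow> (pairing a b u (deriv (deriv \<phi>))) = 0"
  shows "\<exists>k l. AE x in leb a b. u x = k + l * x"
proof -
  let ?M = "leb a b"
  obtain \<rho> where \<rho>: "\<rho> \<in> test_funs a b" "(\<integral>x. \<rho> x \<partial>lborel) = 1" and
    dec: "\<And>\<phi>. \<phi> \<in> test_funs a b \<Longrightarrow> \<exists>\<Phi>\<in>test_funs a b. \<phi> = (\<lambda>x. (\<integral>x. \<phi> x \<partial>lborel) * \<rho> x + deriv \<Phi> x)"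
    using test_decompose[OF \<open>a < b\<close>] by blast
  \<comment> \<open>As \<open>\<rho>\<close> has integral 1, this is the only possible value of a
    constant weak derivative of \<open>u\<close>.\<close>
  define l where "l = - pairing a b u (deriv \<rho>)"
  define w where "w x = u x - l * x" for x
  have xi: "integrable ?M (\<lambda>x. x)" by (rule continuous_integrable_interval[OF continuous_on_id])
  have wi: "integrable ?M w" unfolding w_def using u xi by simp
  have w0: "pairing a b w (deriv \<phi>) = 0" if \<phi>: "\<phi> \<in> test_funs a b" for \<phi>
  proof -
    define c where "c = (\<integral>x. \<phi> x \<partial>lborel)"
    obtain \<Phi> where \<Phi>: "\<Phi> \<in> test_funs a b" "\<phi> = (\<lambda>x. c * \<rho> x + deriv \<Phi> x)"
      using dec[OF \<phi>] unfolding c_def by blast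
    have d: "deriv \<phi> = (\<lambda>x. c * deriv \<rho> x + deriv (deriv \<Phi>) x)"
      unfolding \<Phi>(2) by (rule deriv_lincomb[OF test_funs_smooth[OF \<rho>(1)] smooth_deriv[OF test_funs_smooth[OF \<Phi>(1)]]])
    have "pairing a b u (deriv \<phi>) = (\<integral>x. c * (u x * deriv \<rho> x) + u x * deriv (deriv \<Phi>) x \<partial>?M)"
      unfolding d by (simp add: algebra_simps)
    also have "\<dots> = c * pairing a b u (deriv \<rho>) + pairing a b u (deriv (deriv \<Phi>))"
      using integrable_mult_test[OF u test_funs_deriv[OF \<rho>(1)]]
        integrable_mult_test[OF u test_funs_deriv[OF test_funs_deriv[OF \<Phi>(1)]]] by simp
    finally have 1: "pairing a b u (deriv \<phi>) = - l * c" using z[OF \<Phi>(1)] by (simp add: l_def)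
    have "pairing a b w (deriv \<phi>) = (\<integral>x. u x * deriv \<phi> x - l * (x * deriv \<phi> x) \<partial>?M)"
      unfolding w_def by (simp add: algebra_simps)
    also have "\<dots> = pairing a b u (deriv \<phi>) - l * (\<integral>x. x * deriv \<phi> x \<partial>?M)"
      using integrable_mult_test[OF u test_funs_deriv[OF \<phi>]] integrable_mult_test[OF xi test_funs_deriv[OF \<phi>]]
      by simp
    finally show ?thesis using 1 test_x_deriv[OF \<phi>] by (simp add: c_def)
  qed
  \<comment> \<open>Likewise the only constant that \<open>w\<close> can equal.\<close>
  define k where "k = pairing a b w \<rho>"
  have "AE x in ?M. w x - k = 0"
  proof (rule fundamental_lemma)
    have ci: "integrable ?M (\<lambda>x. k)" by (rule continuous_integrable_interval) simp
    then show "integrable ?M (\<lambda>x. w x - k)" using wi by simp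
    fix \<phi> assume \<phi>: "\<phi> \<in> test_funs a b"
    define c where "c = (\<integral>x. \<phi> x \<partial>lborel)"
    obtain \<Phi> where \<Phi>: "\<Phi> \<in> test_funs a b" "\<phi> = (\<lambda>x. c * \<rho> x + deriv \<Phi> x)"
      using dec[OF \<phi>] unfolding c_def by blast
    have "pairing a b w \<phi> = (\<integral>x. c * (w x * \<rho> x) + w x * deriv \<Phi> x \<partial>?M)"
      unfolding \<Phi>(2) by (simp add: algebra_simps)
    also have "\<dots> = c * k + 0"
      using integrable_mult_test[OF wi \<rho>(1)] integrable_mult_test[OF wi test_funs_deriv[OF \<Phi>(1)]]
        w0[OF \<Phi>(1)] by (simp add: k_def)
    finally have 1: "pairing a b w \<phi> = c * k" by simp
    have "(\<integral>x. (w x - k) * \<phi> x \<partial>?M) = (\<integral>x. w x * \<phi> x - k * \<phi> x \<partial>?M)"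
      by (simp add: algebra_simps)
    also have "\<dots> = c * k - k * c"
      using integrable_mult_test[OF wi \<phi>] integrable_mult_test[OF ci \<phi>] 1 test_funs_integral[OF \<phi>]
      by (subst Bochner_Integration.integral_diff) (simp_all add: c_def)
    finally show "(\<integral>x. (w x - k) * \<phi> x \<partial>?M) = 0" by simp
  qed
  then have "AE x in ?M. u x = k + l * x" by eventually_elim (simp add: w_def)
  then show ?thesis by blast
qed

text \<open>The primitive that is zero at minus infinity. Being defined on the whole line, it is
  continuous everywhere and has no special behaviour at the ends of an interval; the interval is
  imposed on the integrand instead.\<close>

definition prim :: "(real \<Rightarrow> real) \<Rightarrow> real \<Rightarrow> real" where
  "prim h x = (\<integral>t. (if t < x then h t else 0) \<partial>lebesgue)"

lemma integrable_if_less: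
  fixes h :: "real \<Rightarrow> real"
  assumes "integrable lebesgue h"
  shows "integrable lebesgue (\<lambda>t. if t < x then h t else (0::real))"
proof -
  have "integrable lebesgue (\<lambda>t. indicator {..<x} t *\<^sub>R h t)"
    by (rule integrable_mult_indicator[OF sets_completionI_sets assms]) simp
  moreover have "(\<lambda>t. indicator {..<x} t *\<^sub>R h t) = (\<lambda>t. if t < x then h t else 0)"
    by (auto simp: indicator_def)
  ultimately show ?thesis by simp
qed

lemma prim_abs_le:
  assumes "integrable lebesgue h"
  shows "\<bar>prim h x\<bar> \<le> (\<integral>t. \<bar>h t\<bar> \<partial>lebesgue)"
proof -
  have "\<bar>prim h x\<bar> \<le> (\<integral>t. \<bar>if t < x then h t else 0\<bar> \<partial>lebesgue)"
    unfolding prim_def by (rule integral_abs_bound)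
  also have "\<dots> \<le> (\<integral>t. \<bar>h t\<bar> \<partial>lebesgue)"
    by (rule integral_mono) (use assms integrable_if_less[OF assms] in auto)
  finally show ?thesis .
qed

lemma AE_lebesgue_neq: "AE t in lebesgue. t \<noteq> (x::real)"
  by (rule AE_completion[OF AE_lborel_singleton])

lemma prim_isCont:
  assumes h: "integrable lebesgue h"
  shows "isCont (prim h) x"
proof (rule continuous_at_sequentiallyI)
  fix u assume u: "u \<longlonglongrightarrow> x"
  show "(\<lambda>n. prim h (u n)) \<longlonglongrightarrow> prim h x"
    unfolding prim_def
  proof (rule integral_dominated_convergence[where w = "\<lambda>t. \<bar>h t\<bar>"])
    show "AE t in lebesgue. (\<lambda>n. if t < u n then h t else 0) \<longlonglongrightarrow> (if t < x then h t else 0)"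
      using AE_lebesgue_neq[of x]
    proof eventually_elim
      case (elim t)
      have "\<forall>\<^sub>F n in sequentially. (if t < x then h t else 0) = (if t < u n then h t else 0)"
      proof (cases "t < x")
        case True
        then have "\<forall>\<^sub>F n in sequentially. t < u n" using u order_tendstoD(1) by blast
        then show ?thesis by eventually_elim (simp add: True)
      next
        case False
        then have "x < t" using elim by simp
        then have "\<forall>\<^sub>F n in sequentially. u n < t" using u order_tendstoD(2) by blast
        then show ?thesis by eventually_elim (use \<open>x < t\<close> in auto)
      qed
      then show ?case by (rule Lim_transform_eventually[OF tendsto_const])
    qed
  qed (use h integrable_if_less[OF h] in \<open>auto simp: borel_measurable_integrable\<close>)
qed

text \<open>Fubini over the half-plane \<open>t < x\<close>: the inner integral of
  \<open>deriv \<phi>\<close> over the ray \<open>x > t\<close> is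
  \<open>- \<phi> t\<close>.\<close>

lemma prim_by_parts:
  assumes h: "integrable lebesgue h" and \<phi>: "\<phi> \<in> test_funs a b"
  shows "(\<integral>x. prim h x * deriv \<phi> x \<partial>lebesgue) = - (\<integral>x. h x * \<phi> x \<partial>lebesgue)"
proof -
  \<comment> \<open>Joint measurability is available for Borel functions, so Fubini is applied to a
    Borel version of \<open>h\<close>.\<close>
  obtain k where km: "k \<in> borel_measurable lborel" and kae: "AE x in lborel. h x = k x"
    using completion_ex_borel_measurable_real[OF borel_measurable_integrable[OF h]] by blast
  have kae': "AE x in lebesgue. h x = k x" using kae by (rule AE_completion)
  have "integrable lebesgue k"
    by (rule integrable_cong_AE_imp[OF h measurable_completion[OF km] kae'])
  then have ki: "integrable lborel k" using integrable_completion[OF km] by simp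
  have km': "k \<in> borel_measurable borel" using km by simp
  define \<psi> where "\<psi> = deriv \<phi>"
  have \<psi>: "\<psi> \<in> test_funs a b" unfolding \<psi>_def by (rule test_funs_deriv[OF \<phi>])
  have \<psi>i: "integrable lborel \<psi>" by (rule test_funs_integrable[OF \<psi>])
  have \<psi>m: "\<psi> \<in> borel_measurable borel" by (rule smooth_borel_measurable[OF test_funs_smooth[OF \<psi>]])
  have \<phi>m: "\<phi> \<in> borel_measurable borel" by (rule smooth_borel_measurable[OF test_funs_smooth[OF \<phi>]])
  have P: "prim h x = (\<integral>t. (if t < x then k t else 0) \<partial>lborel)" for x
  proof -
    have m: "(\<lambda>t. if t < x then k t else 0) \<in> borel_measurable lborel" using km' by measurable
    have "prim h x = (\<integral>t. (if t < x then k t else 0) \<partial>lebesgue)"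
      unfolding prim_def
    proof (rule integral_cong_AE)
      show "(\<lambda>t. if t < x then h t else 0) \<in> borel_measurable lebesgue"
        by (rule borel_measurable_integrable[OF integrable_if_less[OF h]])
      show "(\<lambda>t. if t < x then k t else 0) \<in> borel_measurable lebesgue"
        by (rule measurable_completion[OF m])
      show "AE t in lebesgue. (if t < x then h t else 0) = (if t < x then k t else 0)"
        using kae' by eventually_elim simp
    qed
    then show ?thesis using integral_completion[OF m] by simp
  qed
  define f where "f x t = (if t < x then k t * \<psi> x else 0)" for x t
  have fm: "case_prod f \<in> borel_measurable (lborel \<Otimes>\<^sub>M lborel)"
    unfolding f_def using km' \<psi>m by measurable
  have gm: "(\<lambda>(x, t). \<psi> x * k t) \<in> borel_measurable (lborel \<Otimes>\<^sub>M lborel)"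
    using km' \<psi>m by measurable
  have gi: "integrable (lborel \<Otimes>\<^sub>M lborel) (\<lambda>(x, t). \<psi> x * k t)"
  proof (rule lborel_pair.Fubini_integrable[OF gm])
    show "integrable lborel (\<lambda>x. \<integral>t. norm (case (x, t) of (x, t) \<Rightarrow> \<psi> x * k t) \<partial>lborel)"
      using \<psi>i by (simp add: abs_mult)
    show "AE x in lborel. integrable lborel (\<lambda>t. case (x, t) of (x, t) \<Rightarrow> \<psi> x * k t)"
      using ki by simp
  qed
  have fi: "integrable (lborel \<Otimes>\<^sub>M lborel) (case_prod f)"
    by (rule Bochner_Integration.integrable_bound[OF gi fm]) (auto simp: f_def abs_mult intro!: AE_I2)
  have cont: "prim h \<in> borel_measurable borel"
    by (rule borel_measurable_continuous_onI) (simp add: continuous_at_imp_continuous_on prim_isCont[OF h])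
  have "(\<integral>x. prim h x * deriv \<phi> x \<partial>lebesgue) = (\<integral>x. prim h x * \<psi> x \<partial>lborel)"
    unfolding \<psi>_def[symmetric] by (rule integral_completion) (use cont \<psi>m in measurable)
  also have "\<dots> = (\<integral>x. (\<integral>t. f x t \<partial>lborel) \<partial>lborel)"
  proof (rule Bochner_Integration.integral_cong[OF refl])
    fix x
    have "(\<integral>t. f x t \<partial>lborel) = (\<integral>t. (if t < x then k t else 0) * \<psi> x \<partial>lborel)"
      by (rule Bochner_Integration.integral_cong[OF refl]) (simp add: f_def)
    then show "prim h x * \<psi> x = (\<integral>t. f x t \<partial>lborel)" by (simp add: P)
  qed
  also have "\<dots> = (\<integral>t. (\<integral>x. f x t \<partial>lborel) \<partial>lborel)"
    by (rule lborel_pair.Fubini_integral[OF fi, symmetric])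
  also have "\<dots> = (\<integral>t. - (k t * \<phi> t) \<partial>lborel)"
  proof (rule Bochner_Integration.integral_cong[OF refl])
    fix t
    have "(\<integral>x. f x t \<partial>lborel) = (\<integral>x. k t * (if t < x then deriv \<phi> x else 0) \<partial>lborel)"
      by (rule Bochner_Integration.integral_cong[OF refl]) (simp add: f_def \<psi>_def)
    then show "(\<integral>x. f x t \<partial>lborel) = - (k t * \<phi> t)" using test_deriv_ray[OF \<phi>, of t] by simp
  qed
  also have "\<dots> = - (\<integral>t. k t * \<phi> t \<partial>lborel)" by simp
  also have "(\<integral>t. k t * \<phi> t \<partial>lborel) = (\<integral>t. k t * \<phi> t \<partial>lebesgue)"
    by (rule integral_completion[symmetric]) (use km' \<phi>m in measurable)
  also have "\<dots> = (\<integral>t. h t * \<phi> t \<partial>lebesgue)"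
  proof (rule integral_cong_AE)
    have p: "\<phi> \<in> borel_measurable lebesgue" using \<phi>m by (intro measurable_completion) simp
    show "(\<lambda>t. k t * \<phi> t) \<in> borel_measurable lebesgue"
      by (rule borel_measurable_times[OF measurable_completion[OF km] p])
    show "(\<lambda>t. h t * \<phi> t) \<in> borel_measurable lebesgue"
      by (rule borel_measurable_times[OF borel_measurable_integrable[OF h] p])
    show "AE t in lebesgue. k t * \<phi> t = h t * \<phi> t" using kae' by eventually_elim simp
  qed
  finally show ?thesis .
qed


subsection \<open>Piecewise \<open>H\<^sup>2\<close> functions\<close>

lemma AE_lebesgue_on_interval:
  "(AE x in leb a b. P x) \<longleftrightarrow> (AE x in lebesgue. a < x \<and> x < b \<longrightarrow> P x)"
  by (subst AE_restrict_space_iff) auto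

lemma AE_interval_mono:
  assumes "AE x in leb a b. P x" "a \<le> c" "d \<le> b"
  shows "AE x in leb c d. P x"
  using assms(1) unfolding AE_lebesgue_on_interval
  by eventually_elim (use assms in auto)

lemma integrable_interval_iff:
  fixes f :: "real \<Rightarrow> real"
  shows "integrable (leb a b) f \<longleftrightarrow> integrable lebesgue (\<lambda>x. indicator {a<..<b} x * f x)"
  by (subst integrable_restrict_space) auto

lemma integrable_interval_mono:
  fixes f :: "real \<Rightarrow> real"
  assumes "integrable (leb a b) f" "a \<le> c" "d \<le> b"
  shows "integrable (leb c d) f"
proof -
  have "set_integrable lebesgue {a<..<b} f"
    using assms(1) unfolding integrable_interval_iff by (simp add: set_integrable_def)
  then have "set_integrable lebesgue {c<..<d} f" by (rule set_integrable_subset) (use assms in auto)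
  then show ?thesis unfolding integrable_interval_iff by (simp add: set_integrable_def)
qed

lemma measurable_interval_AE:
  fixes f g :: "real \<Rightarrow> real"
  assumes f: "f \<in> borel_measurable (leb a b)" and ae: "AE x in leb a b. f x = g x"
  shows "g \<in> borel_measurable (leb a b)"
proof -
  have "(\<lambda>x. indicator {a<..<b} x *\<^sub>R f x) \<in> borel_measurable lebesgue"
    using f by (subst (asm) borel_measurable_restrict_space_iff) auto
  then have "(\<lambda>x. indicator {a<..<b} x *\<^sub>R g x) \<in> borel_measurable lebesgue"
  proof (rule borel_measurable_AE)
    show "AE x in lebesgue. indicator {a<..<b} x *\<^sub>R f x = indicator {a<..<b} x *\<^sub>R g x"
      using ae unfolding AE_lebesgue_on_interval by eventually_elim (simp add: indicator_def)
  qed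
  then show ?thesis by (subst borel_measurable_restrict_space_iff) auto
qed

lemma integrable_interval_AE:
  fixes f g :: "real \<Rightarrow> real"
  assumes "integrable (leb a b) f" and "AE x in leb a b. f x = g x"
  shows "integrable (leb a b) g"
  using integrable_cong_AE_imp[OF assms(1) measurable_interval_AE[OF borel_measurable_integrable[OF assms(1)] assms(2)] assms(2)] .

lemma integral_interval_AE:
  fixes f g :: "real \<Rightarrow> real"
  assumes "f \<in> borel_measurable (leb a b)" and "AE x in leb a b. f x = g x"
  shows "integral\<^sup>L (leb a b) f = integral\<^sup>L (leb a b) g"
  by (rule integral_cong_AE[OF assms(1) measurable_interval_AE[OF assms] assms(2)])

lemma L2_AE:
  assumes "f \<in> L2 a b" "AE x in leb a b. f x = g x"
  shows "g \<in> L2 a b"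
proof -
  have ae: "AE x in leb a b. (f x)\<^sup>2 = (g x)\<^sup>2" using assms(2) by eventually_elim simp
  have f: "f \<in> borel_measurable (leb a b)" "integrable (leb a b) (\<lambda>x. (f x)\<^sup>2)"
    using assms(1) unfolding L2_def by blast+
  have "integrable (leb a b) (\<lambda>x. (g x)\<^sup>2)"
    by (rule integrable_interval_AE[OF f(2) ae])
  then show ?thesis using measurable_interval_AE[OF f(1) assms(2)] unfolding L2_def by blast
qed

lemma L2_measurable: "f \<in> L2 a b \<Longrightarrow> f \<in> borel_measurable (leb a b)"
  by (simp add: L2_def)

lemma L2_mult_integrable:
  assumes "f \<in> L2 a b" "g \<in> L2 a b"
  shows "integrable (leb a b) (\<lambda>x. f x * g x)"
proof (rule Bochner_Integration.integrable_bound)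
  show "integrable (leb a b) (\<lambda>x. (f x)\<^sup>2 + (g x)\<^sup>2)" using assms by (simp add: L2_def)
  show "(\<lambda>x. f x * g x) \<in> borel_measurable (leb a b)"
    by (intro borel_measurable_times L2_measurable assms)
  have "\<bar>x * y\<bar> \<le> \<bar>x\<^sup>2 + y\<^sup>2\<bar>" for x y :: real
  proof -
    have "2 * (\<bar>x\<bar> * \<bar>y\<bar>) \<le> x\<^sup>2 + y\<^sup>2" using sum_squares_bound[of "\<bar>x\<bar>" "\<bar>y\<bar>"] by simp
    moreover have "0 \<le> \<bar>x\<bar> * \<bar>y\<bar>" by simp
    ultimately show ?thesis unfolding abs_mult by linarith
  qed
  then show "AE x in leb a b. norm (f x * g x) \<le> norm ((f x)\<^sup>2 + (g x)\<^sup>2)"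
    by (intro AE_I2) (simp only: real_norm_def)
qed

lemma L2_add:
  assumes "f \<in> L2 a b" "g \<in> L2 a b"
  shows "(\<lambda>x. f x + g x) \<in> L2 a b"
proof -
  have "integrable (leb a b) (\<lambda>x. (f x)\<^sup>2 + (g x)\<^sup>2 + 2 * (f x * g x))"
    using assms L2_mult_integrable[OF assms] by (simp add: L2_def)
  moreover have "(\<lambda>x. (f x)\<^sup>2 + (g x)\<^sup>2 + 2 * (f x * g x)) = (\<lambda>x. (f x + g x)\<^sup>2)"
    by (simp add: power2_sum mult.assoc)
  moreover have "(\<lambda>x. f x + g x) \<in> borel_measurable (leb a b)"
    by (intro borel_measurable_add L2_measurable assms)
  ultimately show ?thesis by (simp add: L2_def)
qed

lemma L2_cmult: "f \<in> L2 a b \<Longrightarrow> (\<lambda>x. c * f x) \<in> L2 a b"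
  by (auto simp: L2_def power_mult_distrib)

lemma L2_diff:
  assumes "f \<in> L2 a b" "g \<in> L2 a b"
  shows "(\<lambda>x. f x - g x) \<in> L2 a b"
  using L2_add[OF assms(1) L2_cmult[OF assms(2), of "-1"]] by simp

lemma L2_continuous:
  assumes "continuous_on {a..b} f"
  shows "f \<in> L2 a b"
  using continuous_integrable_interval[OF assms]
    continuous_integrable_interval[OF continuous_on_power[OF assms, of 2]]
  unfolding L2_def by (simp add: borel_measurable_integrable)

lemma L2_test: "\<phi> \<in> test_funs c d \<Longrightarrow> \<phi> \<in> L2 a b"
  by (intro L2_continuous smooth_continuous_on test_funs_smooth)

lemma L2_integrable: "f \<in> L2 a b \<Longrightarrow> integrable (leb a b) f"
  using L2_mult_integrable[OF _ L2_continuous[of a b "\<lambda>_. 1"]] by simp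

lemma L2_sum:
  assumes "finite I" "\<And>i. i \<in> I \<Longrightarrow> f i \<in> L2 a b"
  shows "(\<lambda>x. \<Sum>i\<in>I. f i x) \<in> L2 a b"
  using assms
proof (induction I rule: finite_induct)
  case empty
  then show ?case using L2_continuous[of a b "\<lambda>_. 0"] by simp
next
  case (insert i I)
  then show ?case using L2_add[of "f i" a b "\<lambda>x. \<Sum>i\<in>I. f i x"] by simp
qed

definition cut :: "real \<Rightarrow> real \<Rightarrow> (real \<Rightarrow> real) \<Rightarrow> real \<Rightarrow> real" where
  "cut a b f x = (if a < x \<and> x < b then f x else 0)"

lemma cut_indicator: "cut a b f x = indicator {a<..<b} x *\<^sub>R f x"
  by (simp add: cut_def indicator_def)

lemma integrable_cut: "integrable (leb a b) f \<Longrightarrow> integrable lebesgue (cut a b f)"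
  unfolding integrable_interval_iff cut_indicator by simp

lemma cut_L2:
  assumes f: "f \<in> L2 c d" and "a \<le> c" "d \<le> b"
  shows "cut c d f \<in> L2 a b"
proof -
  have "f \<in> borel_measurable (leb c d)" using f by (simp add: L2_def)
  then have m: "cut c d f \<in> borel_measurable lebesgue"
    unfolding cut_indicator by (subst (asm) borel_measurable_restrict_space_iff) auto
  have "integrable lebesgue (cut c d (\<lambda>x. (f x)\<^sup>2))" using f by (intro integrable_cut) (simp add: L2_def)
  then have i: "integrable lebesgue (\<lambda>x. (cut c d f x)\<^sup>2)"
    by (rule Bochner_Integration.integrable_cong[THEN iffD1, rotated -1]) (auto simp: cut_def)
  have "integrable lebesgue (\<lambda>x. indicat_real {a<..<b} x *\<^sub>R (cut c d f x)\<^sup>2)"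
    by (rule integrable_mult_indicator[OF _ i]) simp
  then show ?thesis
    unfolding L2_def integrable_interval_iff using measurable_restrict_space1[OF m] by simp
qed

text \<open>A continuous function whose weak second derivative on (a, b) is \<open>h\<close>.
  Subtracting it turns the equation \<open>v'' = h\<close> into \<open>u'' = 0\<close>, to which
  \<open>weak_affine\<close> applies.\<close>

definition dprim :: "real \<Rightarrow> real \<Rightarrow> (real \<Rightarrow> real) \<Rightarrow> real \<Rightarrow> real" where
  "dprim a b h = prim (cut a b (prim (cut a b h)))"

lemma prim_cut_continuous_on:
  "integrable (leb a b) h \<Longrightarrow> continuous_on S (prim (cut a b h))"
  by (simp add: continuous_at_imp_continuous_on prim_isCont integrable_cut)

lemma dprim_inner_integrable:
  "integrable (leb a b) h \<Longrightarrow> integrable (leb a b) (prim (cut a b h))"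
  by (rule continuous_integrable_interval[OF prim_cut_continuous_on])

lemma dprim_isCont: "integrable (leb a b) h \<Longrightarrow> isCont (dprim a b h) x"
  unfolding dprim_def by (intro prim_isCont integrable_cut dprim_inner_integrable)

lemma dprim_integrable:
  "integrable (leb a b) h \<Longrightarrow> integrable (leb a b) (dprim a b h)"
  unfolding dprim_def
  by (rule continuous_integrable_interval[OF prim_cut_continuous_on[OF dprim_inner_integrable]])

lemma prim_cut_deriv:
  assumes h: "integrable (leb a b) h" and \<phi>: "\<phi> \<in> test_funs a b"
  shows "pairing a b (prim (cut a b h)) (deriv \<phi>) = - pairing a b h \<phi>"
proof -
  have "pairing a b h \<phi> = (\<integral>x. cut a b h x * \<phi> x \<partial>lebesgue)"
    unfolding test_integral_lebesgue[OF \<phi>]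
  proof (rule Bochner_Integration.integral_cong[OF refl])
    fix x show "h x * \<phi> x = cut a b h x * \<phi> x"
      using test_funs_zero_outside[OF \<phi>, of x] by (auto simp: cut_def)
  qed
  then show ?thesis
    using prim_by_parts[OF integrable_cut[OF h] \<phi>] test_integral_lebesgue[OF test_funs_deriv[OF \<phi>]] by simp
qed

lemma dprim_deriv:
  assumes h: "integrable (leb a b) h" and \<phi>: "\<phi> \<in> test_funs a b"
  shows "pairing a b (dprim a b h) (deriv \<phi>)
    = - pairing a b (prim (cut a b h)) \<phi>"
  unfolding dprim_def by (rule prim_cut_deriv[OF dprim_inner_integrable[OF h] \<phi>])

lemma dprim_deriv2:
  assumes h: "integrable (leb a b) h" and \<phi>: "\<phi> \<in> test_funs a b"
  shows "pairing a b (dprim a b h) (deriv (deriv \<phi>)) = pairing a b h \<phi>"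
  using dprim_deriv[OF h test_funs_deriv[OF \<phi>]] prim_cut_deriv[OF h \<phi>] by simp

section \<open>Steps, ramps and the normal form of a piecewise H^2 function\<close>

definition step :: "real \<Rightarrow> real \<Rightarrow> real" where
  "step s x = (if s < x then 1 else 0)"

definition ramp :: "real \<Rightarrow> real \<Rightarrow> real" where
  "ramp s x = max 0 (x - s)"

lemma step_integrable: "integrable (leb a b) (step s)"
proof -
  have "integrable lebesgue (\<lambda>x. indicat_real {a<..<b} x * 1)"
    using continuous_integrable_interval[of a b "\<lambda>_. 1"] unfolding integrable_interval_iff by simp
  then have "integrable lebesgue (\<lambda>x. indicat_real {s<..} x *\<^sub>R (indicat_real {a<..<b} x * 1))"
    by (rule integrable_mult_indicator[rotated]) simp
  moreover have "(\<lambda>x. indicat_real {s<..} x *\<^sub>R (indicat_real {a<..<b} x * 1)) = (\<lambda>x. indicator {a<..<b} x * step s x)"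
    by (auto simp: indicator_def step_def fun_eq_iff)
  ultimately show ?thesis unfolding integrable_interval_iff by simp
qed

lemma ramp_integrable: "integrable (leb a b) (ramp s)"
  unfolding ramp_def by (intro continuous_integrable_interval continuous_intros)

lemma step_deriv:
  assumes \<phi>: "\<phi> \<in> test_funs a b"
  shows "pairing a b (step s) (deriv \<phi>) = - \<phi> s"
proof -
  have m: "deriv \<phi> \<in> borel_measurable borel"
    by (rule smooth_borel_measurable[OF smooth_deriv[OF test_funs_smooth[OF \<phi>]]])
  have "pairing a b (step s) (deriv \<phi>) = (\<integral>x. (if s < x then deriv \<phi> x else 0) \<partial>lebesgue)"
    unfolding test_integral_lebesgue[OF test_funs_deriv[OF \<phi>]]
    by (rule Bochner_Integration.integral_cong) (auto simp: step_def)
  also have "\<dots> = (\<integral>x. (if s < x then deriv \<phi> x else 0) \<partial>lborel)"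
    by (rule integral_completion) (use m in measurable)
  finally show ?thesis using test_deriv_ray[OF \<phi>] by simp
qed

text \<open>Test the step with \<open>(x - s) * \<phi> x\<close>: the point mass at \<open>s\<close>
  does not see it, and the product rule splits its derivative into the two integrals.\<close>

lemma ramp_deriv:
  assumes \<phi>: "\<phi> \<in> test_funs a b"
  shows "pairing a b (ramp s) (deriv \<phi>) = - pairing a b (step s) \<phi>"
proof -
  note sh = test_funs_times_shift[OF \<phi>, of s]
  have "0 = (\<integral>x. step s x * (\<phi> x + (x - s) * deriv \<phi> x) \<partial>leb a b)"
    using step_deriv[OF sh(1), of s] unfolding sh(2) by simp
  also have "\<dots> = (\<integral>x. step s x * \<phi> x + ramp s x * deriv \<phi> x \<partial>leb a b)"
    by (rule Bochner_Integration.integral_cong) (auto simp: step_def ramp_def)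
  also have "\<dots> = pairing a b (step s) \<phi> + pairing a b (ramp s) (deriv \<phi>)"
    by (rule Bochner_Integration.integral_add)
      (intro integrable_mult_test[OF step_integrable \<phi>] integrable_mult_test[OF ramp_integrable test_funs_deriv[OF \<phi>]])+
  finally show ?thesis by simp
qed

text \<open>
  \<open>h\<close> is the density of the second derivative, \<open>j s\<close> the jump of the function and \<open>m s\<close> the jump of its
  first derivative at \<open>s \<in> S\<close>.
\<close>

definition pw_fun where
  "pw_fun a b h k l S j m x =
    (dprim a b h x + k + l * x + (\<Sum>s\<in>S. m s * ramp s x)) + (\<Sum>s\<in>S. j s * step s x)"

definition pw_der where
  "pw_der a b h l S m x = (prim (cut a b h) x + l) + (\<Sum>s\<in>S. m s * step s x)"

lemma integrable_id: "integrable (leb a b) (\<lambda>x::real. x)"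
  by (rule continuous_integrable_interval[OF continuous_on_id])

lemma integrable_const': "integrable (leb a b) (\<lambda>x. c::real)"
  by (rule continuous_integrable_interval) simp

lemma pw_fun_integrable:
  "integrable (leb a b) h \<Longrightarrow> integrable (leb a b) (pw_fun a b h k l S j m)"
  unfolding pw_fun_def
  by (intro Bochner_Integration.integrable_add Bochner_Integration.integrable_sum dprim_integrable
      integrable_const' integrable_mult_right integrable_id ramp_integrable step_integrable)

lemma pw_der_integrable:
  "integrable (leb a b) h \<Longrightarrow> integrable (leb a b) (pw_der a b h l S m)"
  unfolding pw_der_def
  by (intro Bochner_Integration.integrable_add Bochner_Integration.integrable_sum dprim_inner_integrable
      integrable_const' integrable_mult_right step_integrable)

lemma integral_test_add:
  fixes f g :: "real \<Rightarrow> real"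
  assumes "integrable (leb a b) f" "integrable (leb a b) g" "\<phi> \<in> test_funs c d"
  shows "(\<integral>x. (f x + g x) * \<phi> x \<partial>leb a b)
    = pairing a b f \<phi> + pairing a b g \<phi>"
  unfolding distrib_right
  by (rule Bochner_Integration.integral_add) (intro integrable_mult_test[OF _ assms(3)] assms(1,2))+

lemma integral_test_diff:
  fixes f g :: "real \<Rightarrow> real"
  assumes "integrable (leb a b) f" "integrable (leb a b) g" "\<phi> \<in> test_funs c d"
  shows "(\<integral>x. (f x - g x) * \<phi> x \<partial>leb a b)
    = pairing a b f \<phi> - pairing a b g \<phi>"
  unfolding left_diff_distrib
  by (rule Bochner_Integration.integral_diff) (intro integrable_mult_test[OF _ assms(3)] assms(1,2))+

lemma integral_test_sum:
  fixes f :: "real \<Rightarrow> real \<Rightarrow> real"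
  assumes "\<And>s. s \<in> S \<Longrightarrow> integrable (leb a b) (f s)" "\<phi> \<in> test_funs c d"
  shows "(\<integral>x. (\<Sum>s\<in>S. m s * f s x) * \<phi> x \<partial>leb a b)
    = (\<Sum>s\<in>S. m s * pairing a b (f s) \<phi>)"
proof -
  have i: "integrable (leb a b) (\<lambda>x. f s x * \<phi> x)" if "s \<in> S" for s
    by (rule integrable_mult_test[OF assms(1)[OF that] assms(2)])
  have "(\<integral>x. (\<Sum>s\<in>S. m s * f s x) * \<phi> x \<partial>leb a b)
      = (\<integral>x. (\<Sum>s\<in>S. m s * (f s x * \<phi> x)) \<partial>leb a b)"
    by (simp add: sum_distrib_right mult.assoc)
  also have "\<dots> = (\<Sum>s\<in>S. (\<integral>x. m s * (f s x * \<phi> x) \<partial>leb a b))"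
    by (rule Bochner_Integration.integral_sum) (intro integrable_mult_right i)
  finally show ?thesis by simp
qed

lemma integral_const_deriv:
  assumes "\<phi> \<in> test_funs a b"
  shows "(\<integral>x. c * deriv \<phi> x \<partial>leb a b) = 0"
  using test_funs_integral[OF test_funs_deriv[OF assms]] test_deriv_integral_0[OF assms] by simp

lemma pw_der_deriv:
  assumes h: "integrable (leb a b) h" and \<phi>: "\<phi> \<in> test_funs a b"
  shows "pairing a b (pw_der a b h l S m) (deriv \<phi>)
    = - (pairing a b h \<phi> + (\<Sum>s\<in>S. m s * \<phi> s))"
proof -
  note d = test_funs_deriv[OF \<phi>]
  note ii = dprim_inner_integrable[OF h] integrable_const' step_integrable
  have s: "integrable (leb a b) (\<lambda>x. \<Sum>s\<in>S. m s * step s x)"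
    by (intro Bochner_Integration.integrable_sum integrable_mult_right ii)
  have "pairing a b (pw_der a b h l S m) (deriv \<phi>)
      = pairing a b (prim (cut a b h)) (deriv \<phi>)
        + (\<integral>x. l * deriv \<phi> x \<partial>leb a b)
        + (\<Sum>s\<in>S. m s * pairing a b (step s) (deriv \<phi>))"
    unfolding pw_der_def
    by (subst integral_test_add[OF _ s d], intro Bochner_Integration.integrable_add ii,
        subst integral_test_add[OF ii(1,2) d], subst integral_test_sum[OF ii(3) d], rule refl)
  then show ?thesis
    unfolding prim_cut_deriv[OF h \<phi>] integral_const_deriv[OF \<phi>] step_deriv[OF \<phi>]
    by (simp add: sum_negf)
qed

lemma pw_fun_deriv:
  assumes h: "integrable (leb a b) h" and \<phi>: "\<phi> \<in> test_funs a b"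
  shows "pairing a b (pw_fun a b h k l S j m) (deriv \<phi>)
    = - (pairing a b (pw_der a b h l S m) \<phi> + (\<Sum>s\<in>S. j s * \<phi> s))"
proof -
  let ?M = "leb a b"
  note d = test_funs_deriv[OF \<phi>]
  have lx: "integrable ?M (\<lambda>x. l * x)" by (rule integrable_mult_right[OF integrable_id])
  note ii = dprim_integrable[OF h] integrable_const' lx
  have s: "integrable ?M (\<lambda>x. \<Sum>s\<in>S. j s * step s x)" "integrable ?M (\<lambda>x. \<Sum>s\<in>S. m s * step s x)"
    "integrable ?M (\<lambda>x. \<Sum>s\<in>S. m s * ramp s x)"
    by (intro Bochner_Integration.integrable_sum integrable_mult_right step_integrable ramp_integrable)+
  have i2: "integrable ?M (\<lambda>x. dprim a b h x + k)" by (rule Bochner_Integration.integrable_add[OF ii(1,2)])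
  have i3: "integrable ?M (\<lambda>x. dprim a b h x + k + l * x)" by (rule Bochner_Integration.integrable_add[OF i2 ii(3)])
  have i4: "integrable ?M (\<lambda>x. dprim a b h x + k + l * x + (\<Sum>s\<in>S. m s * ramp s x))"
    by (rule Bochner_Integration.integrable_add[OF i3 s(3)])
  have "pairing a b (pw_fun a b h k l S j m) (deriv \<phi>)
      = pairing a b (dprim a b h) (deriv \<phi>) + (\<integral>x. k * deriv \<phi> x \<partial>?M) + (\<integral>x. l * x * deriv \<phi> x \<partial>?M)
        + (\<Sum>s\<in>S. m s * pairing a b (ramp s) (deriv \<phi>)) + (\<Sum>s\<in>S. j s * pairing a b (step s) (deriv \<phi>))"
    unfolding pw_fun_def integral_test_add[OF i4 s(1) d] integral_test_add[OF i3 s(3) d]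
      integral_test_add[OF i2 ii(3) d] integral_test_add[OF ii(1,2) d]
      integral_test_sum[OF ramp_integrable d] integral_test_sum[OF step_integrable d] by (rule refl)
  also have "\<dots> = - pairing a b (prim (cut a b h)) \<phi> + 0 + (- l * (\<integral>x. \<phi> x \<partial>?M))
      - (\<Sum>s\<in>S. m s * pairing a b (step s) \<phi>) - (\<Sum>s\<in>S. j s * \<phi> s)"
    unfolding dprim_deriv[OF h \<phi>] integral_const_deriv[OF \<phi>] step_deriv[OF \<phi>] ramp_deriv[OF \<phi>]
    using test_x_deriv[OF \<phi>] test_funs_integral[OF \<phi>] by (simp add: sum_negf mult.assoc)
  also have "\<dots> = - (pairing a b (pw_der a b h l S m) \<phi> + (\<Sum>s\<in>S. j s * \<phi> s))"
    unfolding pw_der_def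
    by (subst integral_test_add[OF _ s(2) \<phi>], intro Bochner_Integration.integrable_add dprim_inner_integrable[OF h] ii,
        subst integral_test_add[OF dprim_inner_integrable[OF h] ii(2) \<phi>],
        subst integral_test_sum[OF step_integrable \<phi>], simp)
  finally show ?thesis .
qed

text \<open>A finite sum of point masses is carried by the null set \<open>S\<close>; the positive
  and the negative parts of the weights supply the two singular measures that the definition asks
  for.\<close>

lemma has_ac_derivI:
  assumes u: "integrable (leb a b) u" and g: "integrable (leb a b) g" and S: "finite S"
    and eq: "\<And>\<phi>. \<phi> \<in> test_funs a b \<Longrightarrow> (pairing a b u (deriv \<phi>))
      = - (pairing a b g \<phi> + (\<Sum>s\<in>S. j s * \<phi> s))"
  shows "has_ac_deriv a b u g"
proof -
  define M where "M c = distr (point_measure S (\<lambda>s. ennreal (max 0 (c s)))) borel (\<lambda>x. x)" for c :: "real \<Rightarrow> real"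
  have id: "(\<lambda>x. x) \<in> measurable (point_measure S f) borel" for f by simp
  have sp: "space (point_measure S f) = S" for f by (simp add: space_point_measure)
  have fin: "finite_measure (M c)" for c
  proof (rule finite_measureI)
    have "emeasure (M c) (space (M c)) = emeasure (point_measure S (\<lambda>s. ennreal (max 0 (c s)))) S"
      unfolding M_def by (subst emeasure_distr[OF id]) (auto simp: sp)
    also have "\<dots> = (\<Sum>s\<in>S. ennreal (max 0 (c s)))"
      using S by (rule emeasure_point_measure_finite) simp
    also have "\<dots> \<noteq> \<infinity>" using S by (simp add: sum_ennreal)
    finally show "emeasure (M c) (space (M c)) \<noteq> \<infinity>" .
  qed
  have sets: "sets (M c) = sets borel" for c unfolding M_def by simp
  have nul: "emeasure (M c) (- S) = 0" for c
    unfolding M_def using S by (subst emeasure_distr[OF id]) (auto simp: sp finite_imp_closed)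
  have int: "(\<integral>x. \<phi> x \<partial>M c) = (\<Sum>s\<in>S. max 0 (c s) * \<phi> s)" if "\<phi> \<in> test_funs a b" for c \<phi>
  proof -
    have "(\<integral>x. \<phi> x \<partial>M c) = (\<integral>x. \<phi> x \<partial>point_measure S (\<lambda>s. ennreal (max 0 (c s))))"
      unfolding M_def by (rule integral_distr[OF id smooth_borel_measurable[OF test_funs_smooth[OF that]]])
    also have "\<dots> = (\<Sum>s\<in>S. max 0 (c s) *\<^sub>R \<phi> s)"
      by (rule lebesgue_integral_point_measure_finite[OF S]) simp
    finally show ?thesis by simp
  qed
  have "pairing a b u (deriv \<phi>)
      = - (pairing a b g \<phi> + (\<integral>x. \<phi> x \<partial>M j) - (\<integral>x. \<phi> x \<partial>M (\<lambda>s. - j s)))"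
    if \<phi>: "\<phi> \<in> test_funs a b" for \<phi>
  proof -
    have "(\<Sum>s\<in>S. j s * \<phi> s) = (\<Sum>s\<in>S. max 0 (j s) * \<phi> s) - (\<Sum>s\<in>S. max 0 (- j s) * \<phi> s)"
      unfolding sum_subtractf[symmetric] by (rule sum.cong) (auto simp: max_def)
    then show ?thesis using eq[OF \<phi>] int[OF \<phi>] by simp
  qed
  then show ?thesis
    unfolding has_ac_deriv_def
    by (intro conjI u g exI[of _ "M j"] exI[of _ "M (\<lambda>s. - j s)"] exI[of _ S] fin sets nul
        finite_imp_null_set_lborel[OF S] ballI)
qed

lemma pw_fun_has_ac_deriv:
  assumes "integrable (leb a b) h" "finite S"
  shows "has_ac_deriv a b (pw_fun a b h k l S j m) (pw_der a b h l S m)"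
  using has_ac_derivI[OF pw_fun_integrable[OF assms(1)] pw_der_integrable[OF assms(1)] assms(2) pw_fun_deriv[OF assms(1)]] .

lemma pw_der_has_ac_deriv:
  assumes "integrable (leb a b) h" "finite S"
  shows "has_ac_deriv a b (pw_der a b h l S m) h"
  using has_ac_derivI[OF pw_der_integrable[OF assms(1)] assms(1) assms(2) pw_der_deriv[OF assms(1)]] .


subsection \<open>Limits and discontinuities of almost-everywhere classes\<close>

lemma AE_interval_ex:
  assumes "AE x in leb a b. P x" "a \<le> c" "c < d" "d \<le> b"
  shows "\<exists>x\<in>{c<..<d}. P x"
proof (rule ccontr)
  assume n: "\<not> (\<exists>x\<in>{c<..<d}. P x)"
  have "AE x in lebesgue. x \<notin> {c<..<d}"
    using assms(1) unfolding AE_lebesgue_on_interval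
    by eventually_elim (use n assms(2,4) in auto)
  then have "AE x in lborel. x \<notin> {c<..<d}" using AE_completion_iff by blast
  then have "emeasure lborel {x \<in> space lborel. x \<in> {c<..<d}} = 0" by (rule emeasure_eq_0_AE)
  moreover have "{x \<in> space lborel. x \<in> {c<..<d}} = {c<..<d}" by auto
  ultimately have "emeasure lborel {c<..<d} = 0" by metis
  then show False using assms(3) by simp
qed

text \<open>A set of full measure meets every one-sided neighbourhood. Hence relations that hold
  almost everywhere pass to one-sided limits, and these limits do not depend on the
  representative.\<close>

lemma AE_interval_frequently:
  assumes ae: "AE x in leb a b. P x" and x: "a < x" "x < b"
    and F: "F = at x \<or> F = at_left x \<or> F = at_right x"
  shows "frequently P F"
proof -
  have R: "frequently P (at_right x)"
    unfolding frequently_def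
  proof
    assume "eventually (\<lambda>y. \<not> P y) (at_right x)"
    then obtain d where d: "d > x" "\<And>y. x < y \<Longrightarrow> y < d \<Longrightarrow> \<not> P y"
      unfolding eventually_at_right_field by blast
    have "\<exists>y\<in>{x<..<min d b}. P y" by (rule AE_interval_ex[OF ae]) (use x d in auto)
    then show False using d by auto
  qed
  have L: "frequently P (at_left x)"
    unfolding frequently_def
  proof
    assume "eventually (\<lambda>y. \<not> P y) (at_left x)"
    then obtain d where d: "d < x" "\<And>y. d < y \<Longrightarrow> y < x \<Longrightarrow> \<not> P y"
      unfolding eventually_at_left_field by blast
    have "\<exists>y\<in>{max d a<..<x}. P y" by (rule AE_interval_ex[OF ae]) (use x d in auto)
    then show False using d by auto
  qed
  have "frequently P (at x)"
    using R unfolding frequently_def eventually_at_split by blast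
  then show ?thesis using F R L by blast
qed

lemma AE_interval_limit_le:
  fixes u w :: "real \<Rightarrow> real"
  assumes ae: "AE x in leb a b. u x \<le> w x" and x: "a < x" "x < b"
    and F: "F = at x \<or> F = at_left x \<or> F = at_right x"
    and lim: "(u \<longlongrightarrow> l) F" "(w \<longlongrightarrow> l') F"
  shows "l \<le> l'"
proof (rule ccontr)
  assume "\<not> l \<le> l'"
  then have "0 < l - l'" by simp
  moreover have "((\<lambda>y. u y - w y) \<longlongrightarrow> l - l') F" by (rule tendsto_diff[OF lim])
  ultimately have "eventually (\<lambda>y. 0 < u y - w y) F" by (rule order_tendstoD(1)[rotated])
  then have "eventually (\<lambda>y. \<not> u y \<le> w y) F" by eventually_elim simp
  moreover have "frequently (\<lambda>y. u y \<le> w y) F" by (rule AE_interval_frequently[OF ae x F])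
  ultimately show False by (simp add: frequently_def)
qed

lemma ae_eq_limit_unique:
  assumes "ae_eq a b u w" "a < x" "x < b" "F = at x \<or> F = at_left x \<or> F = at_right x"
    and lim: "(u \<longlongrightarrow> l) F" "(w \<longlongrightarrow> l') F"
  shows "l = l'"
proof (rule antisym)
  show "l \<le> l'"
    by (rule AE_interval_limit_le[OF _ assms(2-4) lim])
      (use assms(1) in \<open>auto simp: ae_eq_def elim: eventually_mono\<close>)
  show "l' \<le> l"
    by (rule AE_interval_limit_le[OF _ assms(2-4) lim(2,1)])
      (use assms(1) in \<open>auto simp: ae_eq_def elim: eventually_mono\<close>)
qed

lemma ae_eq_sym: "ae_eq a b u v \<Longrightarrow> ae_eq a b v u"
  unfolding ae_eq_def by (rule AE_mp) (auto intro: AE_I2)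

lemma ae_eq_trans: "ae_eq a b u v \<Longrightarrow> ae_eq a b v w \<Longrightarrow> ae_eq a b u w"
  unfolding ae_eq_def by (elim AE_mp) (auto intro: AE_I2)

text \<open>Limits of a.e. equal functions coincide, so the \<open>THE\<close> in
  \<open>ae_lim\<close> is settled by any representative that has a limit.\<close>

lemma ae_lim_eq:
  assumes "ae_eq a b u V" "a < x" "x < b" "F = at x \<or> F = at_left x \<or> F = at_right x"
    and "(V \<longlongrightarrow> l) F"
  shows "ae_lim a b u F = l"
  unfolding ae_lim_def
proof (rule the_equality)
  show "\<exists>u'. ae_eq a b u' u \<and> (u' \<longlongrightarrow> l) F" using ae_eq_sym[OF assms(1)] assms(5) by blast
  fix l' assume "\<exists>u'. ae_eq a b u' u \<and> (u' \<longlongrightarrow> l') F"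
  then obtain u' where "ae_eq a b u' u" "(u' \<longlongrightarrow> l') F" by blast
  then show "l' = l" using ae_eq_limit_unique[OF ae_eq_trans[OF _ assms(1)] assms(2-4)] assms(5) by blast
qed

lemma disc_ae_eq:
  assumes "ae_eq a b u V"
  shows "disc a b u = disc a b V"
  unfolding disc_def using ae_eq_trans[OF _ assms] ae_eq_trans[OF _ ae_eq_sym[OF assms]] by blast

text \<open>The strict inequality in \<open>step\<close> makes it left-continuous: left limits are
  values, and right limits differ from values by the jump.\<close>

lemma step_tendsto_left: "(step s \<longlongrightarrow> step s x) (at_left x)"
proof (rule Lim_transform_eventually[OF tendsto_const])
  show "\<forall>\<^sub>F y in at_left x. step s x = step s y"
    unfolding eventually_at_left_field step_def by (cases "s < x") (auto intro: exI[of _ s] exI[of _ "x - 1"])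
qed

lemma step_tendsto_right: "(step s \<longlongrightarrow> step s x + (if s = x then 1 else 0)) (at_right x)"
proof (rule Lim_transform_eventually[OF tendsto_const])
  show "\<forall>\<^sub>F y in at_right x. step s x + (if s = x then 1 else 0) = step s y"
    unfolding eventually_at_right_field step_def by (cases "x < s") (auto intro: exI[of _ s] exI[of _ "x + 1"])
qed

lemma jump_tendsto_left:
  assumes "isCont C x"
  shows "((\<lambda>x. C x + (\<Sum>s\<in>S. j s * step s x)) \<longlongrightarrow> C x + (\<Sum>s\<in>S. j s * step s x)) (at_left x)"
proof -
  have "(C \<longlongrightarrow> C x) (at_left x)" using assms filterlim_at_split isContD by blast
  then show ?thesis by (intro tendsto_add tendsto_sum tendsto_mult_left step_tendsto_left)
qed

lemma jump_tendsto_right: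
  assumes "isCont C x" "finite S"
  shows "((\<lambda>x. C x + (\<Sum>s\<in>S. j s * step s x)) \<longlongrightarrow>
    C x + (\<Sum>s\<in>S. j s * step s x) + (if x \<in> S then j x else 0)) (at_right x)"
proof -
  have "(C \<longlongrightarrow> C x) (at_right x)" using assms(1) filterlim_at_split isContD by blast
  then have "((\<lambda>x. C x + (\<Sum>s\<in>S. j s * step s x)) \<longlongrightarrow>
      C x + (\<Sum>s\<in>S. j s * (step s x + (if s = x then 1 else 0)))) (at_right x)"
    by (intro tendsto_add tendsto_sum tendsto_mult_left step_tendsto_right)
  moreover have "(\<Sum>s\<in>S. j s * (step s x + (if s = x then 1 else 0)))
      = (\<Sum>s\<in>S. j s * step s x) + (if x \<in> S then j x else 0)"
  proof -
    have "(\<Sum>s\<in>S. j s * (step s x + (if s = x then 1 else 0)))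
        = (\<Sum>s\<in>S. j s * step s x) + (\<Sum>s\<in>S. if s = x then j s else 0)"
      unfolding sum.distrib[symmetric] by (rule sum.cong) (auto simp: algebra_simps)
    then show ?thesis using assms(2) by (simp add: sum.delta')
  qed
  ultimately show ?thesis by (simp add: add.assoc)
qed

text \<open>One-sided limits are invariants of the a.e. class. They differ by \<open>j x\<close> at
  a node, which excludes a continuous representative unless \<open>j x = 0\<close>; elsewhere the
  function itself is continuous. Both \<open>pw_fun\<close> and \<open>pw_der\<close> are bracketed
  to fit this shape.\<close>

lemma disc_jump:
  assumes "\<And>x. isCont C x" "finite S"
  shows "disc a b (\<lambda>x. C x + (\<Sum>s\<in>S. j s * step s x)) = {s \<in> S. a < s \<and> s < b \<and> j s \<noteq> 0}"
proof -
  let ?J = "\<lambda>x. C x + (\<Sum>s\<in>S. j s * step s x)"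
  have "(\<exists>u'. ae_eq a b u' ?J \<and> isCont u' x) \<longleftrightarrow> \<not> (x \<in> S \<and> j x \<noteq> 0)" if x: "a < x" "x < b" for x
  proof
    assume "\<exists>u'. ae_eq a b u' ?J \<and> isCont u' x"
    then obtain u' where u: "ae_eq a b u' ?J" "isCont u' x" by blast
    have "(u' \<longlongrightarrow> u' x) (at_left x)" "(u' \<longlongrightarrow> u' x) (at_right x)"
      using u(2) filterlim_at_split isContD by blast+
    then have "u' x = ?J x" "u' x = ?J x + (if x \<in> S then j x else 0)"
      using ae_eq_limit_unique[OF u(1) x] jump_tendsto_left[OF assms(1)] jump_tendsto_right[OF assms] by blast+
    then show "\<not> (x \<in> S \<and> j x \<noteq> 0)" by auto
  next
    assume "\<not> (x \<in> S \<and> j x \<noteq> 0)"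
    then have "(?J \<longlongrightarrow> ?J x) (at_right x)" using jump_tendsto_right[OF assms, of j x] by (simp split: if_splits)
    then have "isCont ?J x"
      unfolding isCont_def filterlim_at_split using jump_tendsto_left[OF assms(1)] by blast
    then show "\<exists>u'. ae_eq a b u' ?J \<and> isCont u' x" by (intro exI[of _ ?J]) (simp add: ae_eq_def)
  qed
  then show ?thesis unfolding disc_def by auto
qed

lemma ramp_isCont: "isCont (ramp s) x"
  unfolding ramp_def by (intro continuous_intros)

lemma pw_fun_smooth_part_isCont:
  assumes "integrable (leb a b) h"
  shows "isCont (\<lambda>x. dprim a b h x + k + l * x + (\<Sum>s\<in>S. m s * ramp s x)) x"
  by (intro continuous_intros dprim_isCont assms ramp_isCont)

lemma disc_pw_fun:
  assumes "integrable (leb a b) h" "finite S"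
  shows "disc a b (pw_fun a b h k l S j m) = {s \<in> S. a < s \<and> s < b \<and> j s \<noteq> 0}"
  unfolding pw_fun_def[abs_def] by (rule disc_jump[OF pw_fun_smooth_part_isCont[OF assms(1)] assms(2)])

lemma disc_pw_der:
  assumes "integrable (leb a b) h" "finite S"
  shows "disc a b (pw_der a b h l S m) = {s \<in> S. a < s \<and> s < b \<and> m s \<noteq> 0}"
  unfolding pw_der_def[abs_def]
  by (rule disc_jump[OF _ assms(2)]) (intro continuous_intros prim_isCont integrable_cut assms(1))

lemma pw_fun_tendsto_left:
  assumes "integrable (leb a b) h"
  shows "(pw_fun a b h k l S j m \<longlongrightarrow> pw_fun a b h k l S j m x) (at_left x)"
  unfolding pw_fun_def[abs_def] by (rule jump_tendsto_left[OF pw_fun_smooth_part_isCont[OF assms]])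

lemma pw_fun_tendsto_right:
  assumes "integrable (leb a b) h" "finite S"
  shows "\<exists>r. (pw_fun a b h k l S j m \<longlongrightarrow> r) (at_right x)"
  unfolding pw_fun_def[abs_def]
  using jump_tendsto_right[OF pw_fun_smooth_part_isCont[OF assms(1)] assms(2)] by blast

lemma pw_fun_isCont:
  assumes h: "integrable (leb a b) h" and "finite S" "x \<in> S \<Longrightarrow> j x = 0"
  shows "isCont (pw_fun a b h k l S j m) x"
proof -
  have "(pw_fun a b h k l S j m \<longlongrightarrow> pw_fun a b h k l S j m x) (at_right x)"
    unfolding pw_fun_def[abs_def]
    using jump_tendsto_right[OF pw_fun_smooth_part_isCont[OF h] assms(2), of k l m S j x] assms(3)
    by (simp split: if_splits)
  then show ?thesis unfolding isCont_def filterlim_at_split using pw_fun_tendsto_left[OF h] by blast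
qed

section \<open>Gluing local descriptions into a global representation\<close>

lemma sequence_strict_mono:
  fixes s :: "nat \<Rightarrow> real"
  assumes "\<And>i. i < n \<Longrightarrow> s i < s (Suc i)" "i < k" "k \<le> n"
  shows "s i < s k"
  using assms(2,3)
proof (induction k)
  case (Suc k)
  then show ?case using assms(1)[of k] by (cases "i = k") auto
qed simp

text \<open>Induction on the number of pieces: a new piece is reached by correcting slope and value
  at the last node with one ramp and one step. Only interior nodes occur, so the first piece
  contributes none and fixes \<open>k\<close> and \<open>l\<close>.\<close>

lemma piecewise_affine:
  fixes s :: "nat \<Rightarrow> real"
  assumes "\<And>i. i < n \<Longrightarrow> s i < s (Suc i)"
    and "\<And>i. i < n \<Longrightarrow> AE x in lebesgue. s i < x \<and> x < s (Suc i) \<longrightarrow> u x = \<alpha> i + \<beta> i * x"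
  shows "\<exists>k l j m. AE x in lebesgue. s 0 < x \<and> x < s n \<longrightarrow>
    u x = k + l * x + (\<Sum>p\<in>s ` {1..<n}. m p * ramp p x) + (\<Sum>p\<in>s ` {1..<n}. j p * step p x)"
  using assms
proof (induction n)
  case 0
  then show ?case by auto
next
  case (Suc n)
  have mono: "s i < s k" if "i < k" "k \<le> Suc n" for i k
    using sequence_strict_mono[of "Suc n" s] Suc.prems(1) that by blast
  show ?case
  proof (cases "n = 0")
    case True
    have e: "s ` {1..<Suc n} = {}" using True by simp
    show ?thesis
      unfolding e using Suc.prems(2)[of 0] True
      by (intro exI[of _ "\<alpha> 0"] exI[of _ "\<beta> 0"]) simp
  next
    case False
    let ?P = "s ` {1..<n}"
    obtain k l j m where ih: "AE x in lebesgue. s 0 < x \<and> x < s n \<longrightarrow>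
        u x = k + l * x + (\<Sum>p\<in>?P. m p * ramp p x) + (\<Sum>p\<in>?P. j p * step p x)"
      using Suc.IH Suc.prems by (meson less_Suc_eq)
    have P3: "p < s n" if p: "p \<in> ?P" for p
    proof -
      obtain i where "i < n" "p = s i" using p by auto
      then show ?thesis using mono[of i n] by simp
    qed
    have P: "finite ?P" "s n \<notin> ?P" using P3 by blast+
    have ins: "s ` {1..<Suc n} = insert (s n) ?P" using False by (auto simp: less_Suc_eq)
    \<comment> \<open>To the right of \<open>s n\<close> all earlier ramps and steps are affine, so
      the old formula continues there as \<open>A + B * x\<close>.\<close>
    define B where "B = l + (\<Sum>p\<in>?P. m p)"
    define A where "A = k + (\<Sum>p\<in>?P. j p) - (\<Sum>p\<in>?P. m p * p)"
    \<comment> \<open>The change of slope and, in the next line, of value at \<open>s n\<close>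
      between the continued old formula and the new piece.\<close>
    define m' where "m' = m(s n := \<beta> n - B)"
    define j' where "j' = j(s n := (\<alpha> n + \<beta> n * s n) - (A + B * s n))"
    have mj: "m' p = m p" "j' p = j p" if "p \<in> ?P" for p
      using that P(2) unfolding m'_def j'_def by (metis fun_upd_other)+
    have mm: "(\<Sum>p\<in>?P. m' p * f p) = (\<Sum>p\<in>?P. m p * f p)" for f
      by (rule sum.cong[OF refl]) (simp only: mj)
    have jj: "(\<Sum>p\<in>?P. j' p * f p) = (\<Sum>p\<in>?P. j p * f p)" for f
      by (rule sum.cong[OF refl]) (simp only: mj)
    have right: "k + l * x + (\<Sum>p\<in>?P. m p * ramp p x) + (\<Sum>p\<in>?P. j p * step p x) = A + B * x" if "x > s n" for x
    proof -
      have l: "p < x" if "p \<in> ?P" for p using P3[OF that] \<open>x > s n\<close> by simp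
      have "(\<Sum>p\<in>?P. m p * ramp p x) = (\<Sum>p\<in>?P. m p * x - m p * p)"
      proof (rule sum.cong[OF refl])
        fix p assume "p \<in> ?P"
        then show "m p * ramp p x = m p * x - m p * p" using l by (simp add: ramp_def right_diff_distrib)
      qed
      also have "\<dots> = (\<Sum>p\<in>?P. m p) * x - (\<Sum>p\<in>?P. m p * p)"
        by (simp only: sum_subtractf sum_distrib_right)
      finally have 1: "(\<Sum>p\<in>?P. m p * ramp p x) = (\<Sum>p\<in>?P. m p) * x - (\<Sum>p\<in>?P. m p * p)" .
      have 2: "(\<Sum>p\<in>?P. j p * step p x) = (\<Sum>p\<in>?P. j p)"
      proof (rule sum.cong[OF refl])
        fix p assume "p \<in> ?P"
        then show "j p * step p x = j p" using l by (simp add: step_def)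
      qed
      show ?thesis unfolding 1 2 A_def B_def by (simp add: distrib_right)
    qed
    have "AE x in lebesgue. s 0 < x \<and> x < s (Suc n) \<longrightarrow>
        u x = k + l * x + (m' (s n) * ramp (s n) x + (\<Sum>p\<in>?P. m p * ramp p x))
          + (j' (s n) * step (s n) x + (\<Sum>p\<in>?P. j p * step p x))"
      using ih Suc.prems(2)[of n, simplified] AE_lebesgue_neq[of "s n"]
    proof eventually_elim
      case (elim x)
      show ?case
      proof (intro impI)
        assume x: "s 0 < x \<and> x < s (Suc n)"
        show "u x = k + l * x + (m' (s n) * ramp (s n) x + (\<Sum>p\<in>?P. m p * ramp p x))
          + (j' (s n) * step (s n) x + (\<Sum>p\<in>?P. j p * step p x))"
        proof (cases "x < s n")
          case True
          then show ?thesis using elim(1) x by (simp add: ramp_def step_def)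
        next
          case False
          then have g: "x > s n" using elim(3) by simp
          have "u x = \<alpha> n + \<beta> n * x" using elim(2) g x by simp
          moreover have "m' (s n) * ramp (s n) x = (\<beta> n - B) * (x - s n)" "j' (s n) * step (s n) x = (\<alpha> n + \<beta> n * s n) - (A + B * s n)"
            using g by (auto simp: m'_def j'_def ramp_def step_def)
          ultimately show ?thesis using right[OF g] by (simp add: algebra_simps)
        qed
      qed
    qed
    then have "AE x in lebesgue. s 0 < x \<and> x < s (Suc n) \<longrightarrow>
        u x = k + l * x + (\<Sum>p\<in>insert (s n) ?P. m' p * ramp p x) + (\<Sum>p\<in>insert (s n) ?P. j' p * step p x)"
      by (simp only: sum.insert[OF P] mm jj)
    then show ?thesis unfolding ins by blast
  qed
qed

text \<open>After subtraction of \<open>dprim a b h\<close> the weak second derivative is zero on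
  every piece, so the remainder is affine there and \<open>piecewise_affine\<close> glues
  it.\<close>

lemma piecewise_weak_rep:
  fixes s :: "nat \<Rightarrow> real"
  assumes v: "integrable (leb a b) v" and h: "integrable (leb a b) h"
    and s: "s 0 = a" "s n = b" "\<And>i. i < n \<Longrightarrow> s i < s (Suc i)"
    and w: "\<And>i \<phi>. i < n \<Longrightarrow> \<phi> \<in> test_funs (s i) (s (Suc i)) \<Longrightarrow>
      (pairing a b v (deriv (deriv \<phi>))) = pairing a b h \<phi>"
  shows "\<exists>k l j m. ae_eq a b v (pw_fun a b h k l (s ` {1..<n}) j m)"
proof -
  have le: "a \<le> s i" "s i \<le> b" if "i \<le> n" for i
  proof -
    have m: "s i < s k" if "i < k" "k \<le> n" for i k
      using s(3) that by (rule sequence_strict_mono)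
    show "a \<le> s i" using m[of 0 i] s(1) that by (cases "i = 0") auto
    show "s i \<le> b" using m[of i n] s(2) that by (cases "i = n") auto
  qed
  define u where "u x = v x - dprim a b h x" for x
  have "\<exists>k l. AE x in leb (s i) (s (Suc i)). u x = k + l * x" if i: "i < n" for i
  proof (rule weak_affine[OF s(3)[OF i]])
    have u: "integrable (leb a b) u"
      unfolding u_def by (intro Bochner_Integration.integrable_diff v dprim_integrable h)
    then show "integrable (leb (s i) (s (Suc i))) u"
      by (rule integrable_interval_mono) (use le[of i] le[of "Suc i"] i in auto)
    fix \<phi> assume \<phi>: "\<phi> \<in> test_funs (s i) (s (Suc i))"
    have \<phi>': "\<phi> \<in> test_funs a b"
      by (rule test_funs_mono[OF \<phi>]) (use le[of i] le[of "Suc i"] i in auto)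
    have "pairing (s i) (s (Suc i)) u (deriv (deriv \<phi>))
        = pairing a b u (deriv (deriv \<phi>))"
      by (rule test_integral_subinterval[symmetric])
        (use test_funs_deriv[OF test_funs_deriv[OF \<phi>]] le[of i] le[of "Suc i"] i in auto)
    also have "\<dots> = pairing a b v (deriv (deriv \<phi>))
        - pairing a b (dprim a b h) (deriv (deriv \<phi>))"
      unfolding u_def
      by (rule integral_test_diff[OF v dprim_integrable[OF h] test_funs_deriv[OF test_funs_deriv[OF \<phi>']]])
    also have "\<dots> = 0" using w[OF i \<phi>] dprim_deriv2[OF h \<phi>'] by simp
    finally show "pairing (s i) (s (Suc i)) u (deriv (deriv \<phi>)) = 0" .
  qed
  then obtain \<alpha> \<beta> where "\<And>i. i < n \<Longrightarrow> AE x in leb (s i) (s (Suc i)). u x = \<alpha> i + \<beta> i * x"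
    by metis
  then have "\<And>i. i < n \<Longrightarrow> AE x in lebesgue. s i < x \<and> x < s (Suc i) \<longrightarrow> u x = \<alpha> i + \<beta> i * x"
    unfolding AE_lebesgue_on_interval .
  from piecewise_affine[of n s u \<alpha> \<beta>, OF s(3) this] obtain k l j m where
    "AE x in lebesgue. s 0 < x \<and> x < s n \<longrightarrow>
      u x = k + l * x + (\<Sum>p\<in>s ` {1..<n}. m p * ramp p x) + (\<Sum>p\<in>s ` {1..<n}. j p * step p x)"
    by blast
  then have "AE x in lebesgue. a < x \<and> x < b \<longrightarrow> v x = pw_fun a b h k l (s ` {1..<n}) j m x"
    unfolding s(1,2) by eventually_elim (auto simp: u_def pw_fun_def)
  then show ?thesis unfolding ae_eq_def AE_lebesgue_on_interval by blast
qed

lemma has_weak_deriv2: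
  assumes "has_weak_deriv a b v g" "has_weak_deriv a b g h" "\<phi> \<in> test_funs a b"
  shows "pairing a b v (deriv (deriv \<phi>)) = pairing a b h \<phi>"
  using assms test_funs_deriv[OF assms(3)] unfolding has_weak_deriv_def by simp

lemma has_ac_deriv_ae_eq:
  assumes "has_ac_deriv a b u g" and uv: "ae_eq a b u v" and gh: "ae_eq a b g h"
  shows "has_ac_deriv a b v h"
proof -
  have i: "integrable (leb a b) u" "integrable (leb a b) g"
    using assms(1) by (auto simp: has_ac_deriv_def)
  have e: "pairing a b p \<phi> = pairing a b q \<phi>"
    if "\<phi> \<in> test_funs a b" "ae_eq a b p q" "integrable (leb a b) p" for p q \<phi>
  proof (rule integral_interval_AE)
    show "(\<lambda>x. p x * \<phi> x) \<in> borel_measurable (leb a b)"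
      by (rule borel_measurable_integrable[OF integrable_mult_test[OF that(3,1)]])
    show "AE x in leb a b. p x * \<phi> x = q x * \<phi> x"
      using that(2) unfolding ae_eq_def by eventually_elim simp
  qed
  have "integrable (leb a b) v" "integrable (leb a b) h"
    using integrable_interval_AE[OF i(1)] integrable_interval_AE[OF i(2)] uv gh by (auto simp: ae_eq_def)
  then show ?thesis
    using assms(1) e[OF _ gh i(2)] e[OF test_funs_deriv uv i(1)] unfolding has_ac_deriv_def by simp
qed

lemma ac_deriv_ae_eq:
  assumes "has_ac_deriv a b u g"
  shows "ae_eq a b (ac_deriv a b u) g"
  unfolding ac_deriv_def
  by (rule has_ac_deriv_unique[OF someI[of "has_ac_deriv a b u", OF assms] assms])

lemma weak_deriv_ae_eq:
  assumes "has_weak_deriv a b u g"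
  shows "ae_eq a b (weak_deriv a b u) g"
  unfolding weak_deriv_def
  by (rule has_ac_deriv_unique[OF has_weak_deriv_imp_has_ac_deriv[OF someI[of "has_weak_deriv a b u", OF assms]]
        has_weak_deriv_imp_has_ac_deriv[OF assms]])


subsection \<open>Weak cluster points in \<open>L\<^sup>2\<close>\<close>

text \<open>Vector valued, so that the four sequences of the minimization can be packed into one and
  share a cluster point.\<close>

definition square_integrable :: "'x measure \<Rightarrow> ('x \<Rightarrow> 'b::euclidean_space) set" where
  "square_integrable M = {z. z \<in> borel_measurable M \<and> integrable M (\<lambda>x. z x \<bullet> z x)}"

definition ip :: "'x measure \<Rightarrow> ('x \<Rightarrow> 'b::euclidean_space) \<Rightarrow> ('x \<Rightarrow> 'b) \<Rightarrow> real" where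
  "ip M z w = (\<integral>x. z x \<bullet> w x \<partial>M)"

text \<open>Young's inequality, from the square of \<open>t *\<^sub>R a - b\<close>. Its free weight
  \<open>t\<close> does the work of the Cauchy-Schwarz inequality in the estimates below.\<close>

lemma inner_le_weighted:
  fixes a b :: "'b::real_inner"
  assumes "t > 0"
  shows "2 * (a \<bullet> b) \<le> t * (a \<bullet> a) + (b \<bullet> b) / t"
proof -
  have "0 \<le> (t *\<^sub>R a - b) \<bullet> (t *\<^sub>R a - b)" by (rule inner_ge_zero)
  also have "\<dots> = t * (t * (a \<bullet> a)) - 2 * t * (a \<bullet> b) + b \<bullet> b"
    by (simp add: inner_diff_left inner_diff_right inner_commute)
  finally have "t * (2 * (a \<bullet> b)) \<le> t * (t * (a \<bullet> a)) + b \<bullet> b" by simp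
  also have "\<dots> = t * (t * (a \<bullet> a) + (b \<bullet> b) / t)" using assms by (simp add: field_simps)
  finally show ?thesis using assms by simp
qed

lemma square_integrable_inner:
  assumes "z \<in> square_integrable M" "w \<in> square_integrable M"
  shows "integrable M (\<lambda>x. z x \<bullet> w x)"
proof (rule Bochner_Integration.integrable_bound)
  show "integrable M (\<lambda>x. z x \<bullet> z x + w x \<bullet> w x)" using assms by (simp add: square_integrable_def)
  show "(\<lambda>x. z x \<bullet> w x) \<in> borel_measurable M"
    using assms unfolding square_integrable_def by (intro borel_measurable_inner) auto
  have "\<bar>a \<bullet> b\<bar> \<le> \<bar>a \<bullet> a + b \<bullet> b\<bar>" for a b :: 'b
    using inner_le_weighted[of 1 a b] inner_le_weighted[of 1 "- a" b] inner_ge_zero[of a] inner_ge_zero[of b]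
    unfolding inner_minus_left inner_minus_right by linarith
  then show "AE x in M. norm (z x \<bullet> w x) \<le> norm (z x \<bullet> z x + w x \<bullet> w x)"
    by (intro AE_I2) (simp only: real_norm_def)
qed

text \<open>Differences are later written as \<open>1 *\<^sub>R z x + (-1) *\<^sub>R w x\<close>,
  and midpoints with factors \<open>1/2\<close>, so that this single expansion serves both.\<close>

lemma square_integrable_lincomb:
  assumes z: "z \<in> square_integrable M" and w: "w \<in> square_integrable M"
  shows "(\<lambda>x. c *\<^sub>R z x + d *\<^sub>R w x) \<in> square_integrable M"
    and "ip M (\<lambda>x. c *\<^sub>R z x + d *\<^sub>R w x) (\<lambda>x. c *\<^sub>R z x + d *\<^sub>R w x) =
      c\<^sup>2 * ip M z z + 2 * c * d * ip M z w + d\<^sup>2 * ip M w w"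
proof -
  have e: "(c *\<^sub>R z x + d *\<^sub>R w x) \<bullet> (c *\<^sub>R z x + d *\<^sub>R w x)
      = c\<^sup>2 * (z x \<bullet> z x) + 2 * c * d * (z x \<bullet> w x) + d\<^sup>2 * (w x \<bullet> w x)" for x
    by (simp add: inner_add_left inner_add_right inner_commute power2_eq_square algebra_simps)
  have i: "integrable M (\<lambda>x. z x \<bullet> z x)" "integrable M (\<lambda>x. z x \<bullet> w x)" "integrable M (\<lambda>x. w x \<bullet> w x)"
    by (intro square_integrable_inner z w)+
  have "(\<lambda>x. c *\<^sub>R z x + d *\<^sub>R w x) \<in> borel_measurable M"
    using z w unfolding square_integrable_def
    by (intro borel_measurable_add borel_measurable_scaleR borel_measurable_const) auto
  moreover have "integrable M (\<lambda>x. (c *\<^sub>R z x + d *\<^sub>R w x) \<bullet> (c *\<^sub>R z x + d *\<^sub>R w x))"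
    unfolding e using i by simp
  ultimately show "(\<lambda>x. c *\<^sub>R z x + d *\<^sub>R w x) \<in> square_integrable M"
    unfolding square_integrable_def by blast
  show "ip M (\<lambda>x. c *\<^sub>R z x + d *\<^sub>R w x) (\<lambda>x. c *\<^sub>R z x + d *\<^sub>R w x) =
      c\<^sup>2 * ip M z z + 2 * c * d * ip M z w + d\<^sup>2 * ip M w w"
    unfolding ip_def e using i by simp
qed

lemma ip_lincomb_right:
  assumes "L \<in> square_integrable M" "z \<in> square_integrable M" "w \<in> square_integrable M"
  shows "ip M L (\<lambda>x. c *\<^sub>R z x + d *\<^sub>R w x) = c * ip M L z + d * ip M L w"
  unfolding ip_def inner_add_right inner_scaleR_right
  using square_integrable_inner[OF assms(1,2)] square_integrable_inner[OF assms(1,3)] by simp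

lemma ip_ge_0: "0 \<le> ip M z z"
  unfolding ip_def by (rule Bochner_Integration.integral_nonneg) simp

lemma ip_le_weighted:
  assumes "t > 0" "z \<in> square_integrable M" "w \<in> square_integrable M"
  shows "2 * ip M z w \<le> t * ip M z z + ip M w w / t"
proof -
  have i: "integrable M (\<lambda>x. z x \<bullet> z x)" "integrable M (\<lambda>x. z x \<bullet> w x)" "integrable M (\<lambda>x. w x \<bullet> w x)"
    by (intro square_integrable_inner assms)+
  have "(\<integral>x. 2 * (z x \<bullet> w x) \<partial>M) \<le> (\<integral>x. t * (z x \<bullet> z x) + (w x \<bullet> w x) / t \<partial>M)"
    by (rule integral_mono) (use i inner_le_weighted[OF assms(1)] in auto)
  then show ?thesis unfolding ip_def using i by simp
qed

text \<open>The Riesz-Fischer argument with an explicit rate: a fast subsequence has increments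
  summable almost everywhere, because on a finite measure space the square norm controls the L^1
  norm, and Fatou's lemma transfers the Cauchy bound \<open>e n\<close> to the limit.\<close>

lemma square_integrable_complete:
  fixes y :: "nat \<Rightarrow> 'x \<Rightarrow> 'b::euclidean_space"
  assumes "finite_measure M" and y: "\<And>n. y n \<in> square_integrable M" and e: "e \<longlonglongrightarrow> 0"
    and cauchy: "\<And>n m. n \<le> m \<Longrightarrow> ip M (\<lambda>x. 1 *\<^sub>R y n x + (-1) *\<^sub>R y m x) (\<lambda>x. 1 *\<^sub>R y n x + (-1) *\<^sub>R y m x) \<le> e n"
  shows "\<exists>w\<in>square_integrable M. \<forall>n. ip M (\<lambda>x. 1 *\<^sub>R w x + (-1) *\<^sub>R y n x) (\<lambda>x. 1 *\<^sub>R w x + (-1) *\<^sub>R y n x) \<le> e n"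
proof -
  interpret finite_measure M by fact
  have ym: "y n \<in> borel_measurable M" for n using y[of n] by (simp add: square_integrable_def)
  have q: "\<exists>n0. \<forall>n\<ge>n0. e n \<le> (1/4)^i" for i :: nat
  proof -
    have "\<forall>\<^sub>F n in sequentially. e n < (1/4)^i" by (rule order_tendstoD(2)[OF e]) simp
    then show ?thesis unfolding eventually_sequentially by (meson less_imp_le)
  qed
  then obtain q where q: "\<And>i n. q i \<le> n \<Longrightarrow> e n \<le> (1/4)^i" by metis
  \<comment> \<open>The summand \<open>i\<close> makes \<open>r\<close> strictly increasing, the sum
    makes it at least \<open>q i\<close>.\<close>
  define r where "r i = i + (\<Sum>k\<le>i. q k)" for i
  have r: "strict_mono r" unfolding strict_mono_Suc_iff r_def by simp
  have rq: "q i \<le> r i" for i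
    unfolding r_def using member_le_sum[of i "{..i}" q] by simp
  define \<Delta> where "\<Delta> i x = 1 *\<^sub>R y (r i) x + (-1) *\<^sub>R y (r (Suc i)) x" for i x
  have \<Delta>s: "\<Delta> i \<in> square_integrable M" for i
    unfolding \<Delta>_def[abs_def] by (rule square_integrable_lincomb[OF y y])
  have \<Delta>: "ip M (\<Delta> i) (\<Delta> i) \<le> (1/4)^i" for i
    unfolding \<Delta>_def[abs_def]
    by (rule order_trans[OF cauchy q[OF rq]]) (simp add: strict_mono_less_eq[OF r])
  have \<Delta>m: "\<Delta> i \<in> borel_measurable M" for i using \<Delta>s by (simp add: square_integrable_def)
  define K where "K = 1 + measure M (space M)"
  have b: "(\<integral>\<^sup>+x. ennreal (norm (\<Delta> i x)) \<partial>M) \<le> ennreal (K * (1/2)^i)" for i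
  proof -
    \<comment> \<open>The weight \<open>2^i\<close> balances the bound \<open>(1/4)^i\<close> on the
      square norm: both terms integrate to a multiple of \<open>(1/2)^i\<close>.\<close>
    have "norm d \<le> 2^i * (d \<bullet> d) + (1/2)^i" for d :: 'b
    proof -
      have "2 * norm d * 1 \<le> 2^i * (norm d)\<^sup>2 + (1/2)^i"
        using inner_le_weighted[of "2^i" "norm d" "1::real"] by (simp add: power2_eq_square power_one_over)
      then have "norm d \<le> 2^i * (norm d)\<^sup>2 + (1/2)^i" using norm_ge_zero[of d] by linarith
      then show ?thesis by (simp only: power2_norm_eq_inner)
    qed
    then have "(\<integral>\<^sup>+x. ennreal (norm (\<Delta> i x)) \<partial>M) \<le> (\<integral>\<^sup>+x. ennreal (2^i * (\<Delta> i x \<bullet> \<Delta> i x) + (1/2)^i) \<partial>M)"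
      by (intro nn_integral_mono ennreal_leI)
    also have "\<dots> = ennreal (\<integral>x. 2^i * (\<Delta> i x \<bullet> \<Delta> i x) + (1/2)^i \<partial>M)"
      by (rule nn_integral_eq_integral) (use square_integrable_inner[OF \<Delta>s \<Delta>s] in auto)
    also have "(\<integral>x. 2^i * (\<Delta> i x \<bullet> \<Delta> i x) + (1/2)^i \<partial>M) = 2^i * ip M (\<Delta> i) (\<Delta> i) + (1/2)^i * measure M (space M)"
      unfolding ip_def using square_integrable_inner[OF \<Delta>s \<Delta>s] by simp
    also have "\<dots> \<le> 2^i * (1/4)^i + (1/2)^i * measure M (space M)"
      using \<Delta> by (intro add_right_mono mult_left_mono) auto
    also have "2^i * (1/4)^i = (1/2::real)^i" by (simp add: power_mult_distrib[symmetric])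
    finally show ?thesis by (simp add: K_def algebra_simps ennreal_leI)
  qed
  have "(\<integral>\<^sup>+x. (\<Sum>i. ennreal (norm (\<Delta> i x))) \<partial>M) = (\<Sum>i. \<integral>\<^sup>+x. ennreal (norm (\<Delta> i x)) \<partial>M)"
    by (rule nn_integral_suminf) (use \<Delta>m in measurable)
  also have "\<dots> \<le> (\<Sum>i. ennreal (K * (1/2)^i))" by (rule suminf_le) (use b in auto)
  also have "\<dots> = ennreal (\<Sum>i. K * (1/2)^i)"
    by (rule suminf_ennreal2) (auto simp: K_def intro!: summable_mult summable_geometric)
  finally have "(\<integral>\<^sup>+x. (\<Sum>i. ennreal (norm (\<Delta> i x))) \<partial>M) \<noteq> \<infinity>" by (auto simp: top_unique)
  then have "AE x in M. (\<Sum>i. ennreal (norm (\<Delta> i x))) \<noteq> \<infinity>"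
    by (rule nn_integral_PInf_AE[rotated]) (use \<Delta>m in measurable)
  then have conv: "AE x in M. convergent (\<lambda>i. y (r i) x)"
  proof eventually_elim
    case (elim x)
    then have "summable (\<lambda>i. norm (\<Delta> i x))" by (intro summable_suminf_not_top) auto
    then have "summable (\<lambda>i. \<Delta> i x)" by (rule summable_norm_cancel)
    then have "convergent (\<lambda>n. \<Sum>i<n. \<Delta> i x)" by (simp add: summable_iff_convergent)
    then have "convergent (\<lambda>n. y (r 0) x - (\<Sum>i<n. \<Delta> i x))"
      by (rule convergent_diff[OF convergent_const])
    moreover have "y (r 0) x - (\<Sum>i<n. \<Delta> i x) = y (r n) x" for n
      by (induction n) (auto simp: \<Delta>_def algebra_simps)
    ultimately show ?case by simp
  qed
  define w where "w x = lim (\<lambda>i. y (r i) x)" for x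
  have wm: "w \<in> borel_measurable M" unfolding w_def[abs_def] by (rule borel_measurable_lim_metric) (rule ym)
  \<comment> \<open>Here \<open>n\<close> is fixed and \<open>y (r i)\<close> tends to
    \<open>w\<close> almost everywhere, so the bound on the distances to \<open>y n\<close> is
    inherited by \<open>w\<close>.\<close>
  have fatou: "(\<lambda>x. 1 *\<^sub>R w x + (-1) *\<^sub>R y n x) \<in> square_integrable M \<and>
      ip M (\<lambda>x. 1 *\<^sub>R w x + (-1) *\<^sub>R y n x) (\<lambda>x. 1 *\<^sub>R w x + (-1) *\<^sub>R y n x) \<le> e n" for n
  proof -
    let ?f = "\<lambda>i x. 1 *\<^sub>R y n x + (-1) *\<^sub>R y (r i) x"
    let ?g = "\<lambda>x. 1 *\<^sub>R w x + (-1) *\<^sub>R y n x"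
    have gm: "?g \<in> borel_measurable M" using wm ym by measurable
    have fs: "?f i \<in> square_integrable M" for i by (rule square_integrable_lincomb[OF y y])
    have fm: "?f i \<in> borel_measurable M" for i using ym by measurable
    have lim: "AE x in M. (\<lambda>i. ennreal (?f i x \<bullet> ?f i x)) \<longlonglongrightarrow> ennreal (?g x \<bullet> ?g x)"
      using conv
    proof eventually_elim
      case (elim x)
      then have "(\<lambda>i. y (r i) x) \<longlonglongrightarrow> w x" unfolding w_def by (simp add: convergent_LIMSEQ_iff)
      then have "(\<lambda>i. ?f i x) \<longlonglongrightarrow> 1 *\<^sub>R y n x + (-1) *\<^sub>R w x" by (intro tendsto_intros)
      then have "(\<lambda>i. ?f i x \<bullet> ?f i x) \<longlonglongrightarrow> (1 *\<^sub>R y n x + (-1) *\<^sub>R w x) \<bullet> (1 *\<^sub>R y n x + (-1) *\<^sub>R w x)"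
        by (intro tendsto_inner)
      moreover have "(1 *\<^sub>R y n x + (-1) *\<^sub>R w x) \<bullet> (1 *\<^sub>R y n x + (-1) *\<^sub>R w x) = ?g x \<bullet> ?g x"
        by (simp add: inner_diff_left inner_diff_right inner_commute)
      ultimately show ?case by (simp only:) (rule tendsto_ennrealI)
    qed
    have "(\<integral>\<^sup>+x. ennreal (?g x \<bullet> ?g x) \<partial>M) = (\<integral>\<^sup>+x. liminf (\<lambda>i. ennreal (?f i x \<bullet> ?f i x)) \<partial>M)"
    proof (rule nn_integral_cong_AE)
      show "AE x in M. ennreal (?g x \<bullet> ?g x) = liminf (\<lambda>i. ennreal (?f i x \<bullet> ?f i x))"
        using lim by eventually_elim (rule lim_imp_Liminf[OF sequentially_bot, symmetric])
    qed
    also have "\<dots> \<le> liminf (\<lambda>i. \<integral>\<^sup>+x. ennreal (?f i x \<bullet> ?f i x) \<partial>M)"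
      by (rule nn_integral_liminf) (use fm in measurable)
    also have "\<dots> \<le> ennreal (e n)"
    proof (rule Liminf_le)
      have "ip M (?f i) (?f i) \<le> e n" if "i \<ge> n" for i
        by (rule cauchy) (use that seq_suble[OF r, of i] in linarith)
      moreover have "(\<integral>\<^sup>+x. ennreal (?f i x \<bullet> ?f i x) \<partial>M) = ennreal (ip M (?f i) (?f i))" for i
        unfolding ip_def by (rule nn_integral_eq_integral[OF square_integrable_inner[OF fs fs]]) simp
      ultimately show "\<forall>\<^sub>F i in sequentially. (\<integral>\<^sup>+x. ennreal (?f i x \<bullet> ?f i x) \<partial>M) \<le> ennreal (e n)"
        unfolding eventually_sequentially by (metis ennreal_leI)
    qed simp
    finally have le: "(\<integral>\<^sup>+x. ennreal (?g x \<bullet> ?g x) \<partial>M) \<le> ennreal (e n)" .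
    have int: "integrable M (\<lambda>x. ?g x \<bullet> ?g x)"
    proof (rule integrableI_nonneg)
      show "(\<lambda>x. ?g x \<bullet> ?g x) \<in> borel_measurable M" by (rule borel_measurable_inner[OF gm gm])
      show "(\<integral>\<^sup>+x. ennreal (?g x \<bullet> ?g x) \<partial>M) < \<infinity>" using le le_less_trans by fastforce
    qed simp
    have "0 \<le> e n" using order_trans[OF ip_ge_0 cauchy[OF order_refl]] .
    moreover have "ennreal (ip M ?g ?g) \<le> ennreal (e n)"
      using le nn_integral_eq_integral[OF int] unfolding ip_def by simp
    ultimately have "ip M ?g ?g \<le> e n" using ennreal_le_iff by blast
    then show ?thesis using gm int unfolding square_integrable_def by blast
  qed
  have "(\<lambda>x. 1 *\<^sub>R (1 *\<^sub>R w x + (-1) *\<^sub>R y 0 x) + 1 *\<^sub>R y 0 x) \<in> square_integrable M"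
    by (rule square_integrable_lincomb[OF _ y]) (use fatou[of 0] in blast)
  then have "w \<in> square_integrable M" by simp
  then show ?thesis using fatou by blast
qed

text \<open>
  The cluster point is found in the intersection of the closed convex hulls \<open>C n\<close> of the tails,
  as the limit of almost norm-minimal elements of \<open>C n\<close>.
\<close>

lemma bounded_weak_cluster:
  fixes z :: "nat \<Rightarrow> 'x \<Rightarrow> 'b::euclidean_space"
  assumes fin: "finite_measure M" and z: "\<And>k. z k \<in> square_integrable M" and bd: "\<And>k. ip M (z k) (z k) \<le> K"
  obtains w where "w \<in> square_integrable M"
    "\<And>L c. L \<in> square_integrable M \<Longrightarrow> eventually (\<lambda>k. ip M L (z k) \<le> c) sequentially \<Longrightarrow> ip M L w \<le> c"
proof -
  \<comment> \<open>The closed convex hull of the tail, encoded as the intersection of the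
    half-spaces containing it. Convexity and the passage to limits then need only linearity, and the
    cluster property is membership in every \<open>C n\<close>.\<close>
  define C where "C n = {y \<in> square_integrable M. \<forall>L\<in>square_integrable M. \<forall>c. (\<forall>k\<ge>n. ip M L (z k) \<le> c) \<longrightarrow> ip M L y \<le> c}" for n
  have CD: "ip M L y \<le> c" if "y \<in> C n" "L \<in> square_integrable M" "\<And>k. k \<ge> n \<Longrightarrow> ip M L (z k) \<le> c" for n y L c
    using that unfolding C_def by blast
  have CS: "y \<in> square_integrable M" if "y \<in> C n" for y n using that unfolding C_def by blast
  have zC: "z n \<in> C n" for n using z unfolding C_def by blast
  have Cmono: "C m \<subseteq> C n" if "n \<le> m" for n m
    unfolding C_def using that by (auto intro: order_trans)
  have mid: "(\<lambda>x. (1/2) *\<^sub>R y x + (1/2) *\<^sub>R y' x) \<in> C n" if "y \<in> C n" "y' \<in> C n" for y y' n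
    unfolding C_def
  proof (intro CollectI conjI ballI allI impI)
    show "(\<lambda>x. (1/2) *\<^sub>R y x + (1/2) *\<^sub>R y' x) \<in> square_integrable M"
      by (rule square_integrable_lincomb[OF CS CS]) (fact that)+
    fix L c assume L: "L \<in> square_integrable M" "\<forall>k\<ge>n. ip M L (z k) \<le> c"
    have "ip M L (\<lambda>x. (1/2) *\<^sub>R y x + (1/2) *\<^sub>R y' x) = (1/2) * ip M L y + (1/2) * ip M L y'"
      by (rule ip_lincomb_right[OF L(1) CS CS]) (fact that)+
    moreover have "ip M L y \<le> c" "ip M L y' \<le> c" using CD[OF that(1) L(1)] CD[OF that(2) L(1)] L(2) by blast+
    ultimately show "ip M L (\<lambda>x. (1/2) *\<^sub>R y x + (1/2) *\<^sub>R y' x) \<le> c" by linarith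
  qed
  define N where "N n = (\<lambda>y. ip M y y) ` C n" for n
  define d where "d n = Inf (N n)" for n
  have bb: "bdd_below (N n)" for n unfolding N_def by (rule bdd_belowI2[of _ 0]) (rule ip_ge_0)
  have ne: "N n \<noteq> {}" for n unfolding N_def using zC by blast
  have dle: "d n \<le> ip M y y" if "y \<in> C n" for n y
    unfolding d_def by (rule cInf_lower[OF _ bb]) (use that in \<open>simp add: N_def\<close>)
  \<comment> \<open>Infima over shrinking sets grow, and \<open>K\<close> bounds them because
    \<open>z n\<close> lies in \<open>C n\<close>.\<close>
  have "incseq d"
    unfolding incseq_def d_def
    by (intro allI impI cInf_superset_mono ne bb) (use Cmono in \<open>auto simp: N_def\<close>)
  moreover have "d n \<le> K" for n using dle[OF zC] bd order_trans by blast
  ultimately obtain D where D: "d \<longlonglongrightarrow> D" "\<And>n. d n \<le> D" using incseq_convergent by metis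
  have "\<exists>y\<in>C n. ip M y y < d n + inverse (real (Suc n))" for n
  proof -
    have "Inf (N n) < d n + inverse (real (Suc n))" unfolding d_def by simp
    then obtain t where "t \<in> N n" "t < d n + inverse (real (Suc n))" using cInf_lessD[OF ne] by blast
    then show ?thesis unfolding N_def by blast
  qed
  then obtain y where y: "\<And>n. y n \<in> C n" "\<And>n. ip M (y n) (y n) < d n + inverse (real (Suc n))" by metis
  \<comment> \<open>By the parallelogram identity the squared distance of \<open>y n\<close> and
    \<open>y m\<close> is twice the sum of their squared norms minus four times that of the
    midpoint, which is at least \<open>d n\<close>; the norms exceed \<open>d n\<close> and
    \<open>d m \<le> D\<close> by at most \<open>inverse (real (Suc n))\<close>.\<close>
  define e where "e n = 2 * (D - d n) + 4 * inverse (real (Suc n))" for n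
  have "e \<longlonglongrightarrow> 2 * (D - D) + 4 * 0"
    unfolding e_def[abs_def] by (intro tendsto_intros D(1) LIMSEQ_inverse_real_of_nat)
  then have e0: "e \<longlonglongrightarrow> 0" by simp
  have cauchy: "ip M (\<lambda>x. 1 *\<^sub>R y n x + (-1) *\<^sub>R y m x) (\<lambda>x. 1 *\<^sub>R y n x + (-1) *\<^sub>R y m x) \<le> e n" if "n \<le> m" for n m
  proof -
    have ym: "y m \<in> C n" using y(1) Cmono[OF that] by blast
    have "d n \<le> ip M (\<lambda>x. (1/2) *\<^sub>R y n x + (1/2) *\<^sub>R y m x) (\<lambda>x. (1/2) *\<^sub>R y n x + (1/2) *\<^sub>R y m x)"
      by (rule dle[OF mid[OF y(1) ym]])
    then have "4 * d n \<le> ip M (y n) (y n) + 2 * ip M (y n) (y m) + ip M (y m) (y m)"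
      unfolding square_integrable_lincomb(2)[OF CS[OF y(1)] CS[OF ym]] by (simp add: power2_eq_square)
    moreover have "ip M (\<lambda>x. 1 *\<^sub>R y n x + (-1) *\<^sub>R y m x) (\<lambda>x. 1 *\<^sub>R y n x + (-1) *\<^sub>R y m x)
        = ip M (y n) (y n) - 2 * ip M (y n) (y m) + ip M (y m) (y m)"
      unfolding square_integrable_lincomb(2)[OF CS[OF y(1)] CS[OF ym]] by simp
    moreover have "inverse (real (Suc m)) \<le> inverse (real (Suc n))"
      by (rule le_imp_inverse_le) (use that in auto)
    ultimately show ?thesis
      unfolding e_def using y(2)[of n] y(2)[of m] D(2)[of m] by argo
  qed
  obtain w where w: "w \<in> square_integrable M"
    "\<And>n. ip M (\<lambda>x. 1 *\<^sub>R w x + (-1) *\<^sub>R y n x) (\<lambda>x. 1 *\<^sub>R w x + (-1) *\<^sub>R y n x) \<le> e n"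
    using square_integrable_complete[OF fin CS[OF y(1)] e0 cauchy] by blast
  have "ip M L w \<le> c" if L: "L \<in> square_integrable M" and ev: "eventually (\<lambda>k. ip M L (z k) \<le> c) sequentially" for L c
  proof (rule field_le_epsilon)
    fix \<epsilon> :: real assume "\<epsilon> > 0"
    obtain n where n: "\<And>k. k \<ge> n \<Longrightarrow> ip M L (z k) \<le> c" using ev unfolding eventually_sequentially by blast
    \<comment> \<open>With this weight both terms of Young's inequality for \<open>L\<close> and
      \<open>w - y m\<close> are at most \<open>\<epsilon>\<close>. The summand 1 avoids division by
      zero when \<open>L\<close> vanishes.\<close>
    define t where "t = \<epsilon> / (ip M L L + 1)"
    have pos: "ip M L L + 1 > 0" using ip_ge_0[of M L] by linarith
    have t: "t > 0" unfolding t_def using \<open>\<epsilon> > 0\<close> pos by simp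
    have "\<forall>\<^sub>F m in sequentially. e m < \<epsilon> * t" by (rule order_tendstoD(2)[OF e0]) (use \<open>\<epsilon> > 0\<close> t in simp)
    then obtain m where m: "m \<ge> n" "e m < \<epsilon> * t" unfolding eventually_sequentially by (metis nat_le_linear)
    let ?d = "\<lambda>x. 1 *\<^sub>R w x + (-1) *\<^sub>R y m x"
    have ds: "?d \<in> square_integrable M" by (rule square_integrable_lincomb[OF w(1) CS[OF y(1)]])
    have "ip M L ?d = ip M L w - ip M L (y m)"
      using ip_lincomb_right[OF L w(1) CS[OF y(1)], of 1 "-1" m] by simp
    moreover have "ip M L (y m) \<le> c"
      by (rule CD[OF y(1) L n]) (use m in auto)
    moreover have "2 * ip M L ?d \<le> t * ip M L L + ip M ?d ?d / t" by (rule ip_le_weighted[OF t L ds])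
    moreover have "t * ip M L L \<le> \<epsilon>"
    proof -
      have "t * ip M L L \<le> t * (ip M L L + 1)" using t by simp
      also have "\<dots> = \<epsilon>" unfolding t_def using pos by simp
      finally show ?thesis .
    qed
    moreover have "ip M ?d ?d / t \<le> \<epsilon>" using w(2)[of m] m(2) t by (simp add: divide_le_eq)
    ultimately show "ip M L w \<le> c + \<epsilon>" by linarith
  qed
  then show ?thesis using that w(1) by blast
qed


subsection \<open>Characterization of piecewise \<open>H\<^sup>2\<close> by weak second derivatives\<close>

lemma integral_test_ae_eq:
  assumes "\<phi> \<in> test_funs c d" "ae_eq a b p q" "integrable (leb a b) p"
  shows "pairing a b p \<phi> = pairing a b q \<phi>"
proof (rule integral_interval_AE)
  show "(\<lambda>x. p x * \<phi> x) \<in> borel_measurable (leb a b)"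
    by (rule borel_measurable_integrable[OF integrable_mult_test[OF assms(3,1)]])
  show "AE x in leb a b. p x * \<phi> x = q x * \<phi> x"
    using assms(2) unfolding ae_eq_def by eventually_elim simp
qed

lemma ae_eq_integrable:
  "ae_eq a b p q \<Longrightarrow> integrable (leb a b) p \<Longrightarrow> integrable (leb a b) q"
  unfolding ae_eq_def by (rule integrable_interval_AE)

lemma has_weak_deriv_ae_eq:
  assumes "has_weak_deriv a b u g" and uv: "ae_eq a b u v"
  shows "has_weak_deriv a b v g"
proof -
  have i: "integrable (leb a b) u" using assms(1) by (simp add: has_weak_deriv_def)
  show ?thesis
    using assms(1) ae_eq_integrable[OF uv i] integral_test_ae_eq[OF test_funs_deriv uv i]
    unfolding has_weak_deriv_def by simp
qed

lemma ae_eq_mono: "ae_eq a b u v \<Longrightarrow> a \<le> c \<Longrightarrow> d \<le> b \<Longrightarrow> ae_eq c d u v"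
  unfolding ae_eq_def by (rule AE_interval_mono)

lemma L2_mono:
  assumes "f \<in> L2 a b" "a \<le> c" "d \<le> b"
  shows "f \<in> L2 c d"
proof -
  have "f \<in> borel_measurable (leb c d)"
    by (rule borel_measurable_integrable[OF integrable_interval_mono[OF L2_integrable[OF assms(1)] assms(2,3)]])
  moreover have "integrable (leb c d) (\<lambda>x. (f x)\<^sup>2)"
    by (rule integrable_interval_mono[OF _ assms(2,3)]) (use assms(1) in \<open>simp add: L2_def\<close>)
  ultimately show ?thesis by (simp add: L2_def)
qed

lemma L2_ae_eq: "ae_eq a b f g \<Longrightarrow> f \<in> L2 a b \<Longrightarrow> g \<in> L2 a b"
  unfolding ae_eq_def by (rule L2_AE)

lemma ex_partition:
  fixes P :: "real set"
  assumes "finite P" "P \<subseteq> {a<..<b}" "a < b"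
  shows "\<exists>n s. s 0 = a \<and> s n = b \<and> (\<forall>i<n. s i < s (Suc i)) \<and> s ` {1..<n} = P"
  using assms
proof (induction P arbitrary: b rule: finite_linorder_max_induct)
  case empty
  then show ?case
    by (intro exI[of _ "1::nat"] exI[of _ "\<lambda>i. if i = 0 then a else b"]) simp
next
  case (insert p A)
  have "A \<subseteq> {a<..<p}" "a < p" using insert by auto
  then obtain n s where ns: "s 0 = a" "s n = p" "\<And>i. i < n \<Longrightarrow> s i < s (Suc i)" "s ` {1..<n} = A"
    using insert.IH by metis
  have "n \<noteq> 0" using ns \<open>a < p\<close> by (metis less_irrefl)
  define t where "t = s(Suc n := b)"
  have t: "t i = s i" if "i \<le> n" for i using that by (simp add: t_def)
  have "t 0 = a" "t (Suc n) = b" using ns(1) by (simp_all add: t_def)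
  moreover have "t i < t (Suc i)" if "i < Suc n" for i
  proof (cases "i = n")
    case True
    then show ?thesis using ns(2) insert.prems(1) by (simp add: t_def)
  next
    case False
    then show ?thesis using ns(3)[of i] that t by simp
  qed
  moreover have "t ` {1..<Suc n} = insert p A"
  proof -
    have "{1..<Suc n} = insert n {1..<n}" using \<open>n \<noteq> 0\<close> by auto
    moreover have "t ` {1..<n} = s ` {1..<n}" by (rule image_cong) (auto simp: t)
    ultimately show ?thesis using ns(2,4) t[of n] by simp
  qed
  ultimately show ?case by (intro exI[of _ "Suc n"] exI[of _ t]) blast
qed

lemma partition_cover:
  fixes s :: "nat \<Rightarrow> real"
  assumes "\<And>i. i < n \<Longrightarrow> s i < s (Suc i)" "s 0 < x" "x < s n" "x \<notin> s ` {..n}"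
  shows "\<exists>i<n. s i < x \<and> x < s (Suc i)"
  using assms
proof (induction n)
  case (Suc n)
  show ?case
  proof (cases "x < s n")
    case True
    then obtain i where "i < n" "s i < x \<and> x < s (Suc i)"
      using Suc.IH Suc.prems by (metis atMost_Suc image_insert insertI2 less_Suc_eq)
    then show ?thesis using less_SucI by blast
  next
    case False
    moreover have "x \<noteq> s n" using Suc.prems(4) by auto
    ultimately show ?thesis using Suc.prems(3) by (intro exI[of _ n]) auto
  qed
qed simp

lemma partition_disjoint:
  fixes s :: "nat \<Rightarrow> real"
  assumes "\<And>i. i < n \<Longrightarrow> s i < s (Suc i)" "i < n" "k \<le> n" "s i < s k" "s k < s (Suc i)"
  shows False
proof -
  have m: "s i < s k" if "i < k" "k \<le> n" for i k
    using assms(1) that by (rule sequence_strict_mono)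
  have "k \<noteq> i" "k \<noteq> Suc i" using assms(4,5) by auto
  then have "k < i \<or> Suc i < k" by linarith
  then show False using m[of k i] m[of "Suc i" k] assms(2-5) by auto
qed

lemma partition_bounds:
  fixes s :: "nat \<Rightarrow> real"
  assumes "\<And>i. i < n \<Longrightarrow> s i < s (Suc i)" "i \<le> n"
  shows "s 0 \<le> s i" "s i \<le> s n"
proof -
  have m: "s i < s k" if "i < k" "k \<le> n" for i k
    using assms(1) that by (rule sequence_strict_mono)
  show "s 0 \<le> s i" using m[of 0 i] assms(2) by (cases "i = 0") auto
  show "s i \<le> s n" using m[of i n] assms(2) by (cases "i = n") auto
qed

lemma AE_interval_cover:
  fixes s :: "nat \<Rightarrow> real"
  assumes s: "\<And>i. i < n \<Longrightarrow> s i < s (Suc i)"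
    and P: "\<And>i x. i < n \<Longrightarrow> s i < x \<Longrightarrow> x < s (Suc i) \<Longrightarrow> P x"
  shows "AE x in leb (s 0) (s n). P x"
proof -
  have "AE x in lborel. x \<notin> s ` {..n}" by (rule AE_not_in[OF finite_imp_null_set_lborel]) simp
  then have "AE x in lebesgue. x \<notin> s ` {..n}" by (rule AE_completion)
  then show ?thesis
    unfolding AE_lebesgue_on_interval
  proof eventually_elim
    case (elim x)
    show ?case
    proof
      assume "s 0 < x \<and> x < s n"
      then obtain i where "i < n" "s i < x \<and> x < s (Suc i)"
        using partition_cover[of n s x] s elim by blast
      then show "P x" using P by blast
    qed
  qed
qed

lemma sum_cut_partition:
  fixes s :: "nat \<Rightarrow> real"
  assumes s: "\<And>i. i < n \<Longrightarrow> s i < s (Suc i)" and i: "i < n" and x: "s i < x" "x < s (Suc i)"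
  shows "(\<Sum>k<n. cut (s k) (s (Suc k)) (f k) x) = f i x"
proof -
  have m: "s i < s k" if "i < k" "k \<le> n" for i k
    using s that by (rule sequence_strict_mono)
  have z: "cut (s k) (s (Suc k)) (f k) x = (if k = i then f i x else 0)" if "k < n" for k
  proof -
    consider "k = i" | "k < i" | "i < k" by linarith
    then show ?thesis
    proof cases
      case 1
      then show ?thesis using x by (simp add: cut_def)
    next
      case 2
      then have "s (Suc k) \<le> s i" using m[of "Suc k" i] i by (cases "Suc k = i") auto
      then show ?thesis using 2 x by (simp add: cut_def)
    next
      case 3
      then have "s (Suc i) \<le> s k" using m[of "Suc i" k] that by (cases "Suc i = k") auto
      then show ?thesis using 3 x by (simp add: cut_def)
    qed
  qed
  have "(\<Sum>k<n. cut (s k) (s (Suc k)) (f k) x) = (\<Sum>k<n. if k = i then f i x else 0)"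
    by (rule sum.cong[OF refl]) (use z in simp)
  then show ?thesis using i by simp
qed

text \<open>The partition is hidden in the definition of \<open>piecewise_H2\<close>; here it is
  traded for one global formula. The densities on the pieces are cut off and added up to
  \<open>h\<close>, and the pieces are glued by \<open>piecewise_weak_rep\<close>.\<close>

lemma piecewise_H2_rep:
  assumes "v \<in> piecewise_H2 a b" "a < b"
  shows "\<exists>h k l S j m. finite S \<and> S \<subseteq> {a<..<b} \<and> h \<in> L2 a b \<and> v \<in> L2 a b \<and> ae_eq a b v (pw_fun a b h k l S j m)"
proof -
  obtain n s where s: "s 0 = a" "s n = b" "\<And>i. i < n \<Longrightarrow> s i < s (Suc i)"
    and vH: "\<And>i. i < n \<Longrightarrow> v \<in> H2 (s i) (s (Suc i))"
    using assms(1) unfolding piecewise_H2_def by blast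
  have "\<exists>h. i < n \<longrightarrow> (h \<in> L2 (s i) (s (Suc i)) \<and> (\<forall>\<phi>\<in>test_funs (s i) (s (Suc i)).
      (pairing (s i) (s (Suc i)) v (deriv (deriv \<phi>))) = pairing (s i) (s (Suc i)) h \<phi>))" for i
  proof (cases "i < n")
    case True
    then obtain g h where gh: "h \<in> L2 (s i) (s (Suc i))" "has_weak_deriv (s i) (s (Suc i)) v g" "has_weak_deriv (s i) (s (Suc i)) g h"
      using vH[OF True] unfolding H2_def by blast
    then show ?thesis using has_weak_deriv2[OF gh(2,3)] by blast
  qed simp
  then obtain H where H: "\<And>i. i < n \<Longrightarrow> H i \<in> L2 (s i) (s (Suc i))"
    and Hw: "\<And>i \<phi>. i < n \<Longrightarrow> \<phi> \<in> test_funs (s i) (s (Suc i)) \<Longrightarrow>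
      (pairing (s i) (s (Suc i)) v (deriv (deriv \<phi>))) = pairing (s i) (s (Suc i)) (H i) \<phi>"
    by metis
  have bd: "a \<le> s i" "s i \<le> b" if "i \<le> n" for i using partition_bounds[of n s i] s that by auto
  define h where "h x = (\<Sum>k<n. cut (s k) (s (Suc k)) (H k) x)" for x
  have hL: "h \<in> L2 a b"
    unfolding h_def[abs_def] by (rule L2_sum) (auto intro!: cut_L2 H bd)
  have vL2: "v \<in> L2 (s i) (s (Suc i))" if "i < n" for i using vH[OF that] by (simp add: H2_def)
  \<comment> \<open>Cut into pieces and added up again, \<open>v\<close> is unchanged almost
    everywhere; this transfers square integrability from the pieces to (a, b).\<close>
  have "(\<lambda>x. \<Sum>k<n. cut (s k) (s (Suc k)) v x) \<in> L2 a b"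
    by (rule L2_sum) (auto intro!: cut_L2 vL2 bd)
  moreover have "AE x in leb (s 0) (s n). (\<Sum>k<n. cut (s k) (s (Suc k)) v x) = v x"
  proof (rule AE_interval_cover)
    fix i x assume "i < n" "s i < x" "x < s (Suc i)"
    then show "(\<Sum>k<n. cut (s k) (s (Suc k)) v x) = v x"
      using sum_cut_partition[of n s i x "\<lambda>_. v"] s(3) by simp
  qed (rule s(3))
  ultimately have vL: "v \<in> L2 a b" unfolding s(1,2) by (rule L2_AE)
  have "\<exists>k l j m. ae_eq a b v (pw_fun a b h k l (s ` {1..<n}) j m)"
  proof (rule piecewise_weak_rep[OF L2_integrable[OF vL] L2_integrable[OF hL] s])
    fix i \<phi> assume i: "i < n" and \<phi>: "\<phi> \<in> test_funs (s i) (s (Suc i))"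
    have le: "a \<le> s i" "s (Suc i) \<le> b" using bd[of i] bd[of "Suc i"] i by auto
    have "pairing a b v (deriv (deriv \<phi>)) = pairing (s i) (s (Suc i)) (H i) \<phi>"
      using test_integral_subinterval[OF test_funs_deriv[OF test_funs_deriv[OF \<phi>]] le] Hw[OF i \<phi>] by simp
    also have "\<dots> = pairing (s i) (s (Suc i)) h \<phi>"
    proof (rule Bochner_Integration.integral_cong[OF refl])
      fix x assume "x \<in> space (leb (s i) (s (Suc i)))"
      then have "s i < x" "x < s (Suc i)" by simp_all
      then show "H i x * \<phi> x = h x * \<phi> x"
        unfolding h_def using sum_cut_partition[of n s i x H] s(3) i by simp
    qed
    also have "\<dots> = pairing a b h \<phi>"
      by (rule test_integral_subinterval[OF \<phi> le, symmetric])
    finally show "pairing a b v (deriv (deriv \<phi>)) = pairing a b h \<phi>" .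
  qed
  then obtain k l j m where rep: "ae_eq a b v (pw_fun a b h k l (s ` {1..<n}) j m)" by blast
  have "s ` {1..<n} \<subseteq> {a<..<b}"
  proof
    fix p assume "p \<in> s ` {1..<n}"
    then obtain i where "i \<in> {1..<n}" and pi: "p = s i" by blast
    then have i: "0 < i" "i < n" by simp_all
    have m: "s i < s k" if "i < k" "k \<le> n" for i k
      using s(3) that by (rule sequence_strict_mono)
    show "p \<in> {a<..<b}" using m[of 0 i] m[of i n] i pi s(1,2) by simp
  qed
  then show ?thesis using hL vL rep by blast
qed

lemma step_L2: "step s \<in> L2 a b"
proof -
  have "(\<lambda>x. (step s x)\<^sup>2) = step s" by (auto simp: step_def)
  then show ?thesis using step_integrable[of a b s] unfolding L2_def by (simp add: borel_measurable_integrable)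
qed

lemma pw_der_L2:
  assumes "integrable (leb a b) h" "finite S"
  shows "pw_der a b h l S m \<in> L2 a b"
  unfolding pw_der_def[abs_def]
  by (intro L2_add L2_sum L2_cmult step_L2 assms L2_continuous prim_cut_continuous_on continuous_on_const)

text \<open>All ingredients of the functional are read off the representation: by uniqueness the
  \<open>SOME\<close>-chosen derivatives agree almost everywhere with explicit functions, and the
  discontinuity sets are the nodes with nonzero coefficient.\<close>

lemma ac_derivs_rep:
  assumes h: "integrable (leb a b) h" and S: "finite S" "S \<subseteq> {a<..<b}"
    and rep: "ae_eq a b v (pw_fun a b h k l S j m)"
  shows "ae_eq a b (ac_deriv a b v) (pw_der a b h l S m)"
    and "ae_eq a b (ac_deriv a b (ac_deriv a b v)) h"
    and "disc a b v = {s \<in> S. j s \<noteq> 0}"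
    and "disc a b (ac_deriv a b v) = {s \<in> S. m s \<noteq> 0}"
proof -
  show 1: "ae_eq a b (ac_deriv a b v) (pw_der a b h l S m)"
    by (rule ac_deriv_ae_eq[OF has_ac_deriv_ae_eq[OF pw_fun_has_ac_deriv[OF h S(1)] ae_eq_sym[OF rep]]])
      (simp add: ae_eq_def)
  show "ae_eq a b (ac_deriv a b (ac_deriv a b v)) h"
    by (rule ac_deriv_ae_eq[OF has_ac_deriv_ae_eq[OF pw_der_has_ac_deriv[OF h S(1)] ae_eq_sym[OF 1]]])
      (simp add: ae_eq_def)
  show "disc a b v = {s \<in> S. j s \<noteq> 0}"
    unfolding disc_ae_eq[OF rep] disc_pw_fun[OF h S(1)] using S(2) by auto
  show "disc a b (ac_deriv a b v) = {s \<in> S. m s \<noteq> 0}"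
    unfolding disc_ae_eq[OF 1] disc_pw_der[OF h S(1)] using S(2) by auto
qed

lemma pw_fun_deriv2:
  assumes h: "integrable (leb a b) h" and \<phi>: "\<phi> \<in> test_funs a b"
  shows "pairing a b (pw_fun a b h k l S j m) (deriv (deriv \<phi>))
    = pairing a b h \<phi> + (\<Sum>s\<in>S. m s * \<phi> s) - (\<Sum>s\<in>S. j s * deriv \<phi> s)"
  unfolding pw_fun_deriv[OF h test_funs_deriv[OF \<phi>]] pw_der_deriv[OF h \<phi>] by simp

text \<open>The distributional second derivative is a density plus point masses at creases minus
  derivatives of point masses at jumps. The sums run exactly over the discontinuity sets, so that
  the positions of the singular points are those counted by the functional.\<close>

lemma piecewise_H2_weak:
  assumes "v \<in> piecewise_H2 a b" "a < b"
  obtains h j m where "h \<in> L2 a b" "v \<in> L2 a b" "ae_eq a b (ac_deriv a b (ac_deriv a b v)) h"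
    "finite (disc a b v)" "finite (disc a b (ac_deriv a b v))" "\<And>s. s \<in> disc a b v \<Longrightarrow> j s \<noteq> 0"
    "\<And>\<phi>. \<phi> \<in> test_funs a b \<Longrightarrow> (pairing a b v (deriv (deriv \<phi>)))
      = pairing a b h \<phi>
        + (\<Sum>s\<in>disc a b (ac_deriv a b v). m s * \<phi> s) - (\<Sum>s\<in>disc a b v. j s * deriv \<phi> s)"
proof -
  obtain h k l S j m where S: "finite S" "S \<subseteq> {a<..<b}" and hv: "h \<in> L2 a b" "v \<in> L2 a b"
    and rep: "ae_eq a b v (pw_fun a b h k l S j m)"
    using piecewise_H2_rep[OF assms] by blast
  note h = L2_integrable[OF hv(1)]
  note d = ac_derivs_rep[OF h S rep]
  show ?thesis
  proof (rule that[OF hv d(2)])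
    show "finite (disc a b v)" "finite (disc a b (ac_deriv a b v))" unfolding d(3,4) using S(1) by auto
    show "j s \<noteq> 0" if "s \<in> disc a b v" for s using that unfolding d(3) by simp
    fix \<phi> assume \<phi>: "\<phi> \<in> test_funs a b"
    have "pairing a b v (deriv (deriv \<phi>))
        = pairing a b (pw_fun a b h k l S j m) (deriv (deriv \<phi>))"
      by (rule integral_test_ae_eq[OF test_funs_deriv[OF test_funs_deriv[OF \<phi>]] rep L2_integrable[OF hv(2)]])
    also have "\<dots> = pairing a b h \<phi> + (\<Sum>s\<in>S. m s * \<phi> s) - (\<Sum>s\<in>S. j s * deriv \<phi> s)"
      by (rule pw_fun_deriv2[OF h \<phi>])
    also have "(\<Sum>s\<in>S. m s * \<phi> s) = (\<Sum>s\<in>disc a b (ac_deriv a b v). m s * \<phi> s)"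
      by (rule sum.mono_neutral_right[OF S(1)]) (auto simp: d(4))
    also have "(\<Sum>s\<in>S. j s * deriv \<phi> s) = (\<Sum>s\<in>disc a b v. j s * deriv \<phi> s)"
      by (rule sum.mono_neutral_right[OF S(1)]) (auto simp: d(3))
    finally show "pairing a b v (deriv (deriv \<phi>))
      = pairing a b h \<phi>
        + (\<Sum>s\<in>disc a b (ac_deriv a b v). m s * \<phi> s) - (\<Sum>s\<in>disc a b v. j s * deriv \<phi> s)" .
  qed
qed

lemma has_weak_deriv_subinterval:
  assumes "a \<le> c" "d \<le> b" and u: "integrable (leb a b) u" and g: "integrable (leb a b) g"
    and S: "S \<inter> {c<..<d} = {}"
    and eq: "\<And>\<phi>. \<phi> \<in> test_funs a b \<Longrightarrow> (pairing a b u (deriv \<phi>))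
      = - (pairing a b g \<phi> + (\<Sum>s\<in>S. j s * \<phi> s))"
  shows "has_weak_deriv c d u g"
  unfolding has_weak_deriv_def
proof (intro conjI ballI)
  show "integrable (leb c d) u" "integrable (leb c d) g"
    by (rule integrable_interval_mono[OF u assms(1,2)], rule integrable_interval_mono[OF g assms(1,2)])
  fix \<phi> assume \<phi>: "\<phi> \<in> test_funs c d"
  have "(\<Sum>s\<in>S. j s * \<phi> s) = 0"
  proof (rule sum.neutral, rule ballI)
    fix s assume "s \<in> S"
    then have "\<phi> s = 0" using S by (intro test_funs_zero_outside[OF \<phi>]) blast
    then show "j s * \<phi> s = 0" by simp
  qed
  then show "pairing c d u (deriv \<phi>) = - pairing c d g \<phi>"
    using eq[OF test_funs_mono[OF \<phi> assms(1,2)]] test_integral_subinterval[OF \<phi> assms(1,2)]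
      test_integral_subinterval[OF test_funs_deriv[OF \<phi>] assms(1,2)] by simp
qed

text \<open>The converse direction, by which the weak limit is recognized. Nothing is demanded
  across the points of \<open>P\<close>, so the affine remainders on adjacent pieces may jump and
  crease there and nowhere else.\<close>

lemma weak_off_points_rep:
  assumes "a < b" and v: "v \<in> L2 a b" and h: "h \<in> L2 a b" and P: "finite P" "P \<subseteq> {a<..<b}"
    and w: "\<And>c d \<phi>. a \<le> c \<Longrightarrow> d \<le> b \<Longrightarrow> P \<inter> {c<..<d} = {} \<Longrightarrow> \<phi> \<in> test_funs c d \<Longrightarrow>
      (pairing a b v (deriv (deriv \<phi>))) = pairing a b h \<phi>"
  shows "\<exists>k l j m. ae_eq a b v (pw_fun a b h k l P j m)" and "v \<in> piecewise_H2 a b"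
proof -
  obtain n s where s: "s 0 = a" "s n = b" "\<And>i. i < n \<Longrightarrow> s i < s (Suc i)" and sP: "s ` {1..<n} = P"
    using ex_partition[OF P \<open>a < b\<close>] by blast
  have le: "a \<le> s i" "s (Suc i) \<le> b" if "i < n" for i
    using partition_bounds[of n s i] partition_bounds[of n s "Suc i"] s that by auto
  have dis: "P \<inter> {s i<..<s (Suc i)} = {}" if "i < n" for i
  proof -
    have "False" if "k < n" "s i < s k" "s k < s (Suc i)" for k
      using partition_disjoint[of n s i k] s(3) \<open>i < n\<close> that by auto
    then show ?thesis unfolding sP[symmetric] by auto
  qed
  have "\<exists>k l j m. ae_eq a b v (pw_fun a b h k l (s ` {1..<n}) j m)"
  proof (rule piecewise_weak_rep[OF L2_integrable[OF v] L2_integrable[OF h] s])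
    fix i \<phi> assume "i < n" "\<phi> \<in> test_funs (s i) (s (Suc i))"
    then show "pairing a b v (deriv (deriv \<phi>)) = pairing a b h \<phi>"
      by (intro w[OF le dis])
  qed
  then show ex: "\<exists>k l j m. ae_eq a b v (pw_fun a b h k l P j m)" unfolding sP .
  then obtain k l j m where rep: "ae_eq a b v (pw_fun a b h k l P j m)" by blast
  note hi = L2_integrable[OF h]
  have "v \<in> H2 (s i) (s (Suc i))" if i: "i < n" for i
  proof -
    have "has_weak_deriv (s i) (s (Suc i)) (pw_fun a b h k l P j m) (pw_der a b h l P m)"
      by (rule has_weak_deriv_subinterval[OF le[OF i] pw_fun_integrable[OF hi] pw_der_integrable[OF hi] dis[OF i] pw_fun_deriv[OF hi]])
    moreover have "ae_eq (s i) (s (Suc i)) (pw_fun a b h k l P j m) v"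
      by (rule ae_eq_mono[OF ae_eq_sym[OF rep] le[OF i]])
    ultimately have "has_weak_deriv (s i) (s (Suc i)) v (pw_der a b h l P m)" by (rule has_weak_deriv_ae_eq)
    moreover have "has_weak_deriv (s i) (s (Suc i)) (pw_der a b h l P m) h"
      by (rule has_weak_deriv_subinterval[OF le[OF i] pw_der_integrable[OF hi] hi dis[OF i] pw_der_deriv[OF hi]])
    ultimately show ?thesis
      unfolding H2_def
      using L2_mono[OF v le[OF i]] L2_mono[OF h le[OF i]] L2_mono[OF pw_der_L2[OF hi P(1)] le[OF i]] by blast
  qed
  then show "v \<in> piecewise_H2 a b" unfolding piecewise_H2_def using s by blast
qed

lemma H2_weak:
  assumes "v \<in> H2 a b"
  obtains h where "h \<in> L2 a b" "ae_eq a b (weak_deriv a b (weak_deriv a b v)) h"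
    "\<And>\<phi>. \<phi> \<in> test_funs a b \<Longrightarrow> (pairing a b v (deriv (deriv \<phi>))) = pairing a b h \<phi>"
proof -
  obtain g h where gh: "h \<in> L2 a b" "has_weak_deriv a b v g" "has_weak_deriv a b g h"
    using assms unfolding H2_def by blast
  have "has_weak_deriv a b (weak_deriv a b v) h"
    by (rule has_weak_deriv_ae_eq[OF gh(3) ae_eq_sym[OF weak_deriv_ae_eq[OF gh(2)]]])
  then show ?thesis using that[OF gh(1) weak_deriv_ae_eq has_weak_deriv2[OF gh(2,3)]] by blast
qed

text \<open>The case of an empty set of exceptional points.\<close>

lemma weak_imp_H2:
  assumes "a < b" and v: "v \<in> L2 a b" and h: "h \<in> L2 a b"
    and w: "\<And>\<phi>. \<phi> \<in> test_funs a b \<Longrightarrow>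
      (pairing a b v (deriv (deriv \<phi>))) = pairing a b h \<phi>"
  shows "v \<in> H2 a b" and "ae_eq a b (weak_deriv a b (weak_deriv a b v)) h"
    and "\<exists>k l. ae_eq a b v (\<lambda>x. dprim a b h x + k + l * x)"
proof -
  have "\<exists>k l j m. ae_eq a b v (pw_fun a b h k l {} j m)"
    by (rule weak_off_points_rep[OF assms(1-3)]) (use w test_funs_mono in auto)
  then obtain k l j m where rep: "ae_eq a b v (pw_fun a b h k l {} j m)" by blast
  then show "\<exists>k l. ae_eq a b v (\<lambda>x. dprim a b h x + k + l * x)" unfolding pw_fun_def[abs_def] by auto
  note hi = L2_integrable[OF h]
  have "has_weak_deriv a b (pw_fun a b h k l {} j m) (pw_der a b h l {} m)"
    by (rule has_weak_deriv_subinterval[OF _ _ pw_fun_integrable[OF hi] pw_der_integrable[OF hi] _ pw_fun_deriv[OF hi]]) auto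
  then have 1: "has_weak_deriv a b v (pw_der a b h l {} m)" by (rule has_weak_deriv_ae_eq[OF _ ae_eq_sym[OF rep]])
  have 2: "has_weak_deriv a b (pw_der a b h l {} m) h"
    by (rule has_weak_deriv_subinterval[OF _ _ pw_der_integrable[OF hi] hi _ pw_der_deriv[OF hi]]) auto
  show "v \<in> H2 a b" unfolding H2_def using v h 1 2 pw_der_L2[OF hi, of "{}"] by blast
  show "ae_eq a b (weak_deriv a b (weak_deriv a b v)) h"
    by (rule weak_deriv_ae_eq[OF has_weak_deriv_ae_eq[OF 2 ae_eq_sym[OF weak_deriv_ae_eq[OF 1]]]])
qed


subsection \<open>The obstacle condition\<close>

lemma AE_interval_finite:
  assumes "finite S"
  shows "AE x in leb a b. x \<notin> S"
  unfolding AE_lebesgue_on_interval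
  using AE_completion[OF AE_not_in[OF finite_imp_null_set_lborel[OF assms]]] by eventually_elim simp

text \<open>\<open>v\<close> has a representative with one-sided limits everywhere, \<open>p\<close>
  a continuous one, so an a.e. inequality passes to all limits in question. Conversely, only the
  finitely many jumps and the points -1 and 1 are left out by the pointwise condition; outside
  [-1, 1] the two functions agree. The a.e. form is the one that weak limits preserve.\<close>

lemma obstacle_iff_AE:
  assumes v: "v \<in> piecewise_H2 (-2) 2" and p: "p \<in> H2 (-2) 2"
    and out: "ae_eq (-2) (-1) v p" "ae_eq 1 2 v p"
  shows "obstacle v p \<longleftrightarrow> (AE x in leb (-2) 2. p x \<le> v x)"
proof -
  obtain h k l S j m where S: "finite S" "S \<subseteq> {-2<..<2}" and hL: "h \<in> L2 (-2) 2"
    and rep: "ae_eq (-2) 2 v (pw_fun (-2) 2 h k l S j m)"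
    using piecewise_H2_rep[OF v] by auto
  note h = L2_integrable[OF hL]
  define V where "V = pw_fun (-2) 2 h k l S j m"
  have V: "ae_eq (-2) 2 v V" using rep by (simp add: V_def)
  have dv: "disc (-2) 2 v = {s \<in> S. j s \<noteq> 0}" by (rule ac_derivs_rep(3)[OF h S rep])
  have pL: "p \<in> L2 (-2) 2" using p by (simp add: H2_def)
  obtain h' where h': "h' \<in> L2 (-2) 2" and pw: "\<And>\<phi>. \<phi> \<in> test_funs (-2) 2 \<Longrightarrow>
      (pairing (-2) 2 p (deriv (deriv \<phi>))) = pairing (-2) 2 h' \<phi>"
    using H2_weak[OF p] by blast
  obtain k' l' where "ae_eq (-2) 2 p (\<lambda>x. dprim (-2) 2 h' x + k' + l' * x)"
    using weak_imp_H2(3)[OF _ pL h' pw] by auto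
  moreover define Q where "Q x = dprim (-2) 2 h' x + k' + l' * x" for x
  ultimately have Q: "ae_eq (-2) 2 p Q" by (simp add: Q_def[abs_def])
  have Qc: "isCont Q x" for x
    unfolding Q_def[abs_def] by (intro continuous_intros dprim_isCont L2_integrable h')
  have Ql: "(Q \<longlongrightarrow> Q x) F" if "F = at x \<or> F = at_left x \<or> F = at_right x" for x F
    using Qc[of x] that unfolding isCont_def filterlim_at_split by (metis filterlim_at_split)
  have plim: "ae_lim (-2) 2 p F = Q x" if "F = at x \<or> F = at_left x \<or> F = at_right x" "-2 < x" "x < 2" for x F
    by (rule ae_lim_eq[OF Q that(2,3,1) Ql[OF that(1)]])
  have Vc: "(V \<longlongrightarrow> V x) (at x)" if "x \<notin> disc (-2) 2 v" for x
  proof -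
    have "isCont V x" unfolding V_def by (rule pw_fun_isCont[OF h S(1)]) (use that in \<open>auto simp: dv\<close>)
    then show ?thesis by (simp add: isCont_def)
  qed
  show ?thesis
  proof
    assume ob: "obstacle v p"
    have in_le: "Q x \<le> V x" if "-1 < x" "x < 1" "x \<notin> disc (-2) 2 v" for x
    proof -
      have "ae_lim (-2) 2 p (at x) \<le> ae_lim (-2) 2 v (at x)"
        using ob that unfolding obstacle_def by auto
      moreover have "ae_lim (-2) 2 v (at x) = V x"
        by (rule ae_lim_eq[OF V _ _ _ Vc[OF that(3)]]) (use that in auto)
      ultimately show ?thesis using plim[of "at x" x] that by simp
    qed
    have fin: "finite (disc (-2) 2 v \<union> {-1, 1})" using S(1) by (simp add: dv)
    have "AE x in lebesgue. -2 < x \<and> x < 2 \<longrightarrow> p x \<le> v x"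
      using AE_interval_finite[OF fin, of "-2" 2, unfolded AE_lebesgue_on_interval]
        V[unfolded ae_eq_def AE_lebesgue_on_interval] Q[unfolded ae_eq_def AE_lebesgue_on_interval]
        out(1)[unfolded ae_eq_def AE_lebesgue_on_interval] out(2)[unfolded ae_eq_def AE_lebesgue_on_interval]
    proof eventually_elim
      case (elim x)
      show ?case
      proof
        assume x: "-2 < x \<and> x < 2"
        then have n: "x \<notin> disc (-2) 2 v" "x \<noteq> -1" "x \<noteq> 1" using elim(1) by blast+
        consider "x < -1" | "-1 < x" "x < 1" | "1 < x" using n(2,3) by linarith
        then show "p x \<le> v x"
        proof cases
          case 1
          then show ?thesis using elim(4) x by simp
        next
          case 2
          then show ?thesis using in_le[OF 2 n(1)] elim(2,3) x by simp
        next
          case 3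
          then show ?thesis using elim(5) x by simp
        qed
      qed
    qed
    then show "AE x in leb (-2) 2. p x \<le> v x" unfolding AE_lebesgue_on_interval .
  next
    assume ae: "AE x in leb (-2) 2. p x \<le> v x"
    have aeVQ: "AE x in leb (-2) 2. Q x \<le> V x"
      using ae V[unfolded ae_eq_def] Q[unfolded ae_eq_def] by eventually_elim simp
    \<comment> \<open>The filter is left open, so that one argument serves the two-sided limit and
      both one-sided limits.\<close>
    have le: "ae_lim (-2) 2 p (at x) \<le> ae_lim (-2) 2 v F"
      if F: "F = at x \<or> F = at_left x \<or> F = at_right x" and x: "-2 < x" "x < 2" and lim: "(V \<longlongrightarrow> r) F" for x F r
    proof -
      have "Q x \<le> r" by (rule AE_interval_limit_le[OF aeVQ x F Ql[OF F] lim])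
      then show ?thesis using plim[OF _ x, of "at x"] ae_lim_eq[OF V x F lim] by simp
    qed
    have d: "-2 < x \<and> x < 2" if "x \<in> disc (-2) 2 v" for x using that by (simp add: disc_def)
    show "obstacle v p"
      unfolding obstacle_def
    proof (intro conjI ballI)
      fix x :: real assume x: "x \<in> {-1..1} - disc (-2) 2 v"
      show "ae_lim (-2) 2 p (at x) \<le> ae_lim (-2) 2 v (at x)"
        by (rule le[of _ x, OF _ _ _ Vc]) (use x in auto)
    next
      fix x :: real assume x: "x \<in> disc (-2) 2 v \<union> {-1}"
      then have x2: "-2 < x" "x < 2" using d by auto
      obtain r where "(V \<longlongrightarrow> r) (at_right x)" using pw_fun_tendsto_right[OF h S(1)] unfolding V_def by blast
      then show "ae_lim (-2) 2 p (at x) \<le> ae_lim (-2) 2 v (at_right x)"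
        by (intro le[of _ x, OF _ x2]) auto
    next
      fix x :: real assume x: "x \<in> disc (-2) 2 v \<union> {1}"
      then have x2: "-2 < x" "x < 2" using d by auto
      have "(V \<longlongrightarrow> V x) (at_left x)" unfolding V_def by (rule pw_fun_tendsto_left[OF h])
      then show "ae_lim (-2) 2 p (at x) \<le> ae_lim (-2) 2 v (at_left x)"
        by (intro le[of _ x, OF _ x2]) auto
    qed
  qed
qed

lemma C2_on_H2:
  assumes "C2_on (-2) 2 w"
  shows "w \<in> H2 (-2) 2"
proof -
  obtain w' w'' where d: "\<And>x. x \<in> {-2..2} \<Longrightarrow> (w has_real_derivative w' x) (at x within {-2..2})"
    "\<And>x. x \<in> {-2..2} \<Longrightarrow> (w' has_real_derivative w'' x) (at x within {-2..2})"
    and c: "continuous_on {-2..2} w''"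
    using assms unfolding C2_on_def by blast
  have cw: "continuous_on {-2..2} w" "continuous_on {-2..2} w'"
    by (rule DERIV_continuous_on[OF d(1)], assumption, rule DERIV_continuous_on[OF d(2)], assumption)
  have wd: "has_weak_deriv (-2) 2 f f'"
    if fd: "\<And>x. x \<in> {-2..2} \<Longrightarrow> (f has_real_derivative f' x) (at x within {-2..2})"
      and fc: "continuous_on {-2..2} f" "continuous_on {-2..2} f'" for f f' :: "real \<Rightarrow> real"
    unfolding has_weak_deriv_def
  proof (intro conjI ballI)
    show i: "integrable (leb (-2) 2) f" "integrable (leb (-2) 2) f'"
      by (rule continuous_integrable_interval[OF fc(1)], rule continuous_integrable_interval[OF fc(2)])
    fix \<phi> :: "real \<Rightarrow> real" assume \<phi>: "\<phi> \<in> test_funs (-2) 2"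
    note sm = test_funs_smooth[OF \<phi>]
    let ?g = "\<lambda>x. f x * deriv \<phi> x + f' x * \<phi> x"
    have gc: "continuous_on {-2..2} ?g"
      by (intro continuous_intros fc smooth_continuous_on sm smooth_deriv)
    have "(?g has_integral (f 2 * \<phi> 2 - f (-2) * \<phi> (-2))) {-2..2}"
    proof (rule fundamental_theorem_of_calculus)
      fix x :: real assume x: "x \<in> {-2..2}"
      have "((\<lambda>x. f x * \<phi> x) has_real_derivative f' x * \<phi> x + deriv \<phi> x * f x) (at x within {-2..2})"
        by (rule DERIV_mult[OF fd[OF x] has_field_derivative_at_within[OF smooth_has_deriv[OF sm]]])
      then show "((\<lambda>x. f x * \<phi> x) has_vector_derivative f x * deriv \<phi> x + f' x * \<phi> x) (at x within {-2..2})"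
        unfolding has_real_derivative_iff_has_vector_derivative[symmetric] by (simp add: algebra_simps)
    qed simp
    moreover have "\<phi> 2 = 0" "\<phi> (-2) = 0" by (auto intro!: test_funs_zero_outside[OF \<phi>])
    ultimately have "(?g has_integral 0) {-2..2}" by simp
    moreover have "integral {-2..2} ?g = integral\<^sup>L (lebesgue_on {-2..2}) ?g"
      by (rule lebesgue_integral_eq_integral[symmetric]) (auto intro!: continuous_imp_integrable_real gc)
    ultimately have 0: "integral\<^sup>L (lebesgue_on {-2..2}) ?g = 0" by (metis integral_unique)
    have "integral\<^sup>L (lebesgue_on {-2..2}) ?g = (\<integral>x. indicator {-2..2} x *\<^sub>R ?g x \<partial>lebesgue)"
      by (subst integral_restrict_space) auto
    also have "(\<lambda>x. indicator {-2..2} x *\<^sub>R ?g x) = (\<lambda>x. indicator {-2<..<2} x *\<^sub>R ?g x)"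
    proof
      fix x :: real
      have "\<phi> x = 0" "deriv \<phi> x = 0" if "x \<notin> {-2<..<2}"
        using test_funs_zero_outside[OF \<phi> that] test_funs_zero_outside[OF test_funs_deriv[OF \<phi>] that] .
      then show "indicator {-2..2} x *\<^sub>R ?g x = indicator {-2<..<2} x *\<^sub>R ?g x"
        by (cases "x \<in> {-2<..<2}") (auto simp: indicator_def)
    qed
    also have "(\<integral>x. indicator {-2<..<2} x *\<^sub>R ?g x \<partial>lebesgue) = integral\<^sup>L (leb (-2) 2) ?g"
      by (subst integral_restrict_space) auto
    also have "\<dots> = pairing (-2) 2 f (deriv \<phi>) + pairing (-2) 2 f' \<phi>"
      by (intro Bochner_Integration.integral_add integrable_mult_test[OF i(1) test_funs_deriv[OF \<phi>]]
          integrable_mult_test[OF i(2) \<phi>])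
    finally show "pairing (-2) 2 f (deriv \<phi>) = - pairing (-2) 2 f' \<phi>"
      using 0 by simp
  qed
  show ?thesis
    unfolding H2_def
    using wd[OF d(1) cw] wd[OF d(2) cw(2) c] L2_continuous[OF cw(1)] L2_continuous[OF cw(2)] L2_continuous[OF c]
    by blast
qed

lemma admissible_self:
  assumes "C2_on (-2) 2 w"
  shows "(w, w) \<in> admissible w"
proof -
  have w: "w \<in> H2 (-2) 2" by (rule C2_on_H2[OF assms])
  have "w \<in> piecewise_H2 (-2) 2"
    unfolding piecewise_H2_def
    by (rule CollectI, rule exI[of _ "1::nat"], rule exI[of _ "\<lambda>i. if i = 0 then -2 else 2"]) (use w in simp)
  moreover from this have "obstacle w w"
    using obstacle_iff_AE[OF _ w, of w] by (simp add: ae_eq_def)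
  ultimately show ?thesis using w unfolding admissible_def ae_eq_def by simp
qed


subsection \<open>Localization and the Poincare inequality\<close>

text \<open>A joint cluster point is essential: the weak equations link different components, and
  cluster points found separately could belong to different subsequences. The four functions become
  the components of one function into
  \<open>(real \<times> real) \<times> (real \<times> real)\<close>.\<close>

lemma L2_weak_cluster4:
  fixes v p h q :: "nat \<Rightarrow> real \<Rightarrow> real"
  assumes L2: "\<And>k. v k \<in> L2 a b" "\<And>k. p k \<in> L2 a b" "\<And>k. h k \<in> L2 a b" "\<And>k. q k \<in> L2 a b"
    and bd: "\<And>k. (sqnorm a b (v k)) \<le> K" "\<And>k. (sqnorm a b (p k)) \<le> K"
      "\<And>k. (sqnorm a b (h k)) \<le> K" "\<And>k. (sqnorm a b (q k)) \<le> K"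
  obtains V P H Q where "V \<in> L2 a b" "P \<in> L2 a b" "H \<in> L2 a b" "Q \<in> L2 a b"
    "\<And>A B C D c. A \<in> L2 a b \<Longrightarrow> B \<in> L2 a b \<Longrightarrow> C \<in> L2 a b \<Longrightarrow> D \<in> L2 a b \<Longrightarrow>
      eventually (\<lambda>k. (pairing a b (v k) A) + pairing a b (p k) B
        + pairing a b (h k) C + pairing a b (q k) D \<le> c) sequentially \<Longrightarrow>
      (pairing a b V A) + pairing a b P B
        + pairing a b H C + pairing a b Q D \<le> c"
proof -
  let ?M = "leb a b"
  define tup :: "(real \<Rightarrow> real) \<Rightarrow> (real \<Rightarrow> real) \<Rightarrow> (real \<Rightarrow> real) \<Rightarrow> (real \<Rightarrow> real) \<Rightarrow> real \<Rightarrow> (real \<times> real) \<times> (real \<times> real)"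
    where "tup A B C D x = ((A x, B x), (C x, D x))" for A B C D x
  have fin: "finite_measure ?M" by (rule finite_measure_lebesgue_on) simp
  have ti: "tup A B C D x \<bullet> tup A' B' C' D' x = A x * A' x + B x * B' x + C x * C' x + D x * D' x" for A B C D A' B' C' D' x
    by (simp add: tup_def inner_prod_def)
  have tS: "tup A B C D \<in> square_integrable ?M"
    if "A \<in> L2 a b" "B \<in> L2 a b" "C \<in> L2 a b" "D \<in> L2 a b" for A B C D
  proof -
    have "integrable ?M (\<lambda>x. tup A B C D x \<bullet> tup A B C D x)"
      unfolding ti by (intro Bochner_Integration.integrable_add L2_mult_integrable that)
    moreover have "tup A B C D \<in> borel_measurable ?M"
      unfolding tup_def[abs_def] by (intro borel_measurable_Pair L2_measurable that)
    ultimately show ?thesis by (simp add: square_integrable_def)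
  qed
  have tip: "ip ?M (tup A B C D) (tup A' B' C' D')
      = pairing a b A A' + pairing a b B B' + pairing a b C C' + pairing a b D D'"
    if L: "A \<in> L2 a b" "B \<in> L2 a b" "C \<in> L2 a b" "D \<in> L2 a b" "A' \<in> L2 a b" "B' \<in> L2 a b" "C' \<in> L2 a b" "D' \<in> L2 a b"
    for A B C D A' B' C' D'
    unfolding ip_def ti
    using L2_mult_integrable[OF L(1,5)] L2_mult_integrable[OF L(2,6)] L2_mult_integrable[OF L(3,7)] L2_mult_integrable[OF L(4,8)]
    by simp
  have "ip ?M (tup (v k) (p k) (h k) (q k)) (tup (v k) (p k) (h k) (q k)) \<le> 4 * K" for k
    unfolding tip[OF L2 L2] using bd[of k] by (simp add: power2_eq_square)
  then obtain w where w: "w \<in> square_integrable ?M"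
    "\<And>L c. L \<in> square_integrable ?M \<Longrightarrow> eventually (\<lambda>k. ip ?M L (tup (v k) (p k) (h k) (q k)) \<le> c) sequentially \<Longrightarrow> ip ?M L w \<le> c"
    using bounded_weak_cluster[OF fin, of "\<lambda>k. tup (v k) (p k) (h k) (q k)"] tS[OF L2] by blast
  have comp: "(\<lambda>x. w x \<bullet> e) \<in> L2 a b" if "e \<bullet> e = 1" for e
  proof -
    have wm: "w \<in> borel_measurable ?M" using w(1) by (simp add: square_integrable_def)
    have m: "(\<lambda>x. w x \<bullet> e) \<in> borel_measurable ?M" by (intro borel_measurable_inner wm borel_measurable_const)
    have "integrable ?M (\<lambda>x. (w x \<bullet> e)\<^sup>2)"
    proof (rule Bochner_Integration.integrable_bound)
      show "integrable ?M (\<lambda>x. w x \<bullet> w x)" using w(1) by (simp add: square_integrable_def)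
      show "(\<lambda>x. (w x \<bullet> e)\<^sup>2) \<in> borel_measurable ?M" using m by measurable
      show "AE x in ?M. norm ((w x \<bullet> e)\<^sup>2) \<le> norm (w x \<bullet> w x)"
        using Cauchy_Schwarz_ineq[of _ e] that by (intro AE_I2) simp
    qed
    then show ?thesis using m by (simp add: L2_def)
  qed
  define V where "V x = w x \<bullet> ((1, 0), (0, 0))" for x
  define P where "P x = w x \<bullet> ((0, 1), (0, 0))" for x
  define H where "H x = w x \<bullet> ((0, 0), (1, 0))" for x
  define Q where "Q x = w x \<bullet> ((0, 0), (0, 1))" for x
  have L: "V \<in> L2 a b" "P \<in> L2 a b" "H \<in> L2 a b" "Q \<in> L2 a b"
    unfolding V_def[abs_def] P_def[abs_def] H_def[abs_def] Q_def[abs_def]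
    by (rule comp, simp add: inner_prod_def)+
  have wt: "w = tup V P H Q"
  proof
    fix x show "w x = tup V P H Q x"
      by (cases "w x") (auto simp: tup_def V_def P_def H_def Q_def inner_prod_def)
  qed
  show ?thesis
  proof (rule that[OF L])
    fix A B C D c
    assume ABCD: "A \<in> L2 a b" "B \<in> L2 a b" "C \<in> L2 a b" "D \<in> L2 a b"
      and ev: "eventually (\<lambda>k. (pairing a b (v k) A) + pairing a b (p k) B
        + pairing a b (h k) C + pairing a b (q k) D \<le> c) sequentially"
    have "ip ?M (tup A B C D) w \<le> c"
      by (rule w(2)[OF tS[OF ABCD]])
        (use ev in \<open>simp add: tip[OF ABCD L2] mult.commute\<close>)
    then show "pairing a b V A + pairing a b P B + pairing a b H C + pairing a b Q D \<le> c"
      unfolding wt tip[OF ABCD L] by (simp add: mult.commute)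
  qed
qed

lemma has_ac_deriv_subinterval:
  assumes "has_ac_deriv a b u g" "a \<le> c" "d \<le> b"
  shows "has_ac_deriv c d u g"
proof -
  obtain M1 M2 :: "real measure" and N where
    i: "integrable (leb a b) u" "integrable (leb a b) g" and
    M: "finite_measure M1" "sets M1 = sets borel" "finite_measure M2" "sets M2 = sets borel"
      "N \<in> null_sets lborel" "emeasure M1 (- N) = 0" "emeasure M2 (- N) = 0" and
    eq: "\<And>\<phi>. \<phi> \<in> test_funs a b \<Longrightarrow> (pairing a b u (deriv \<phi>)) =
             - (pairing a b g \<phi> + (\<integral>x. \<phi> x \<partial>M1) - (\<integral>x. \<phi> x \<partial>M2))"
    using assms(1) unfolding has_ac_deriv_def by blast
  have "pairing c d u (deriv \<phi>) =
      - (pairing c d g \<phi> + (\<integral>x. \<phi> x \<partial>M1) - (\<integral>x. \<phi> x \<partial>M2))"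
    if "\<phi> \<in> test_funs c d" for \<phi>
    using eq[OF test_funs_mono[OF that assms(2,3)]] test_integral_subinterval[OF that assms(2,3)]
      test_integral_subinterval[OF test_funs_deriv[OF that] assms(2,3)] by simp
  then show ?thesis
    unfolding has_ac_deriv_def
    using integrable_interval_mono[OF i(1) assms(2,3)] integrable_interval_mono[OF i(2) assms(2,3)] M
    by (intro conjI exI[of _ M1] exI[of _ M2] exI[of _ N] ballI)
qed

lemma ac_deriv_local:
  assumes "has_ac_deriv a b u g" "has_ac_deriv a b w g'" "a \<le> c" "d \<le> b" "ae_eq c d u w"
  shows "ae_eq c d g g'"
proof -
  have "has_ac_deriv c d w g"
    by (rule has_ac_deriv_ae_eq[OF has_ac_deriv_subinterval[OF assms(1,3,4)] assms(5)]) (simp add: ae_eq_def)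
  then show ?thesis using has_ac_deriv_unique has_ac_deriv_subinterval[OF assms(2-4)] by blast
qed

text \<open>Replacing \<open>u\<close> by \<open>w\<close> inside (c, d) gives a representative of
  \<open>u\<close> that is continuous at \<open>x\<close>.\<close>

lemma disc_local:
  assumes "ae_eq c d u w" "c < x" "x < d" "isCont w x"
  shows "x \<notin> disc a b u"
proof
  assume "x \<in> disc a b u"
  define u' where "u' y = (if c < y \<and> y < d then w y else u y)" for y
  have "ae_eq a b u' u"
    using assms(1) unfolding ae_eq_def AE_lebesgue_on_interval u'_def by eventually_elim auto
  moreover have "isCont u' x"
  proof -
    have "\<forall>\<^sub>F y in nhds x. y \<in> {c<..<d}"
      by (rule eventually_nhds_in_open) (use assms in auto)
    then have "\<forall>\<^sub>F y in nhds x. u' y = w y" by eventually_elim (simp add: u'_def)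
    then show ?thesis using assms(4) isCont_cong by blast
  qed
  ultimately show False using \<open>x \<in> disc a b u\<close> unfolding disc_def by blast
qed

lemma piecewise_H2_ac_derivs:
  assumes "v \<in> piecewise_H2 a b" "a < b"
  shows "has_ac_deriv a b v (ac_deriv a b v)"
    and "has_ac_deriv a b (ac_deriv a b v) (ac_deriv a b (ac_deriv a b v))"
    and "ac_deriv a b (ac_deriv a b v) \<in> L2 a b"
proof -
  obtain h k l S j m where S: "finite S" "S \<subseteq> {a<..<b}" and hv: "h \<in> L2 a b" "v \<in> L2 a b"
    and rep: "ae_eq a b v (pw_fun a b h k l S j m)"
    using piecewise_H2_rep[OF assms] by blast
  note h = L2_integrable[OF hv(1)]
  note d = ac_derivs_rep[OF h S rep]
  show "has_ac_deriv a b v (ac_deriv a b v)"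
    by (rule has_ac_deriv_ae_eq[OF pw_fun_has_ac_deriv[OF h S(1)] ae_eq_sym[OF rep] ae_eq_sym[OF d(1)]])
  show "has_ac_deriv a b (ac_deriv a b v) (ac_deriv a b (ac_deriv a b v))"
    by (rule has_ac_deriv_ae_eq[OF pw_der_has_ac_deriv[OF h S(1)] ae_eq_sym[OF d(1)] ae_eq_sym[OF d(2)]])
  show "ac_deriv a b (ac_deriv a b v) \<in> L2 a b"
    by (rule L2_ae_eq[OF ae_eq_sym[OF d(2)] hv(1)])
qed

lemma H2_continuous_rep:
  assumes "w \<in> H2 a b" "a < b"
  obtains W w1 w2 where "w2 \<in> L2 a b" "ae_eq a b w W" "\<And>x. isCont W x" "\<And>x. isCont w1 x"
    "has_ac_deriv a b w w1" "has_ac_deriv a b w1 w2"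
    "\<And>\<phi>. \<phi> \<in> test_funs a b \<Longrightarrow> (pairing a b w (deriv (deriv \<phi>))) = pairing a b w2 \<phi>"
proof -
  have wL: "w \<in> L2 a b" using assms(1) by (simp add: H2_def)
  obtain h where h: "h \<in> L2 a b" and weak: "\<And>\<phi>. \<phi> \<in> test_funs a b \<Longrightarrow>
      (pairing a b w (deriv (deriv \<phi>))) = pairing a b h \<phi>"
    using H2_weak[OF assms(1)] by blast
  note hi = L2_integrable[OF h]
  obtain k l where kl: "ae_eq a b w (\<lambda>x. dprim a b h x + k + l * x)"
    using weak_imp_H2(3)[OF assms(2) wL h weak] by blast
  have e: "(\<lambda>x. dprim a b h x + k + l * x) = pw_fun a b h k l {} (\<lambda>_. 0) (\<lambda>_. 0)"
    by (simp add: pw_fun_def[abs_def])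
  show ?thesis
  proof (rule that[OF h kl])
    show "isCont (\<lambda>x. dprim a b h x + k + l * x) x" for x
      by (intro continuous_intros dprim_isCont hi)
    show "isCont (pw_der a b h l {} (\<lambda>_. 0)) x" for x
      unfolding pw_der_def[abs_def] by simp (intro continuous_intros prim_isCont integrable_cut hi)
    show "has_ac_deriv a b w (pw_der a b h l {} (\<lambda>_. 0))"
      by (rule has_ac_deriv_ae_eq[OF pw_fun_has_ac_deriv[OF hi] ae_eq_sym[OF kl[unfolded e]]]) (simp_all add: ae_eq_def)
    show "has_ac_deriv a b (pw_der a b h l {} (\<lambda>_. 0)) h"
      by (rule pw_der_has_ac_deriv[OF hi]) simp
  qed (rule weak)
qed

text \<open>Against test functions supported in (c, d) the second derivatives of \<open>p\<close>
  and \<open>w\<close> agree; the fundamental lemma does the rest.\<close>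

lemma H2_second_local:
  assumes p: "p \<in> H2 a b" and w: "\<And>\<phi>. \<phi> \<in> test_funs a b \<Longrightarrow>
      (pairing a b w (deriv (deriv \<phi>))) = pairing a b w2 \<phi>"
    and w2: "w2 \<in> L2 a b" and q: "q \<in> L2 a b" and pq: "\<And>\<phi>. \<phi> \<in> test_funs a b \<Longrightarrow>
      (pairing a b p (deriv (deriv \<phi>))) = pairing a b q \<phi>"
    and sub: "a \<le> c" "d \<le> b" and eq: "ae_eq c d p w"
  shows "ae_eq c d q w2"
proof -
  have "AE x in leb c d. q x - w2 x = 0"
  proof (rule fundamental_lemma)
    show "integrable (leb c d) (\<lambda>x. q x - w2 x)"
      by (rule integrable_interval_mono[OF L2_integrable[OF L2_diff[OF q w2]] sub])
    fix \<phi> assume \<phi>: "\<phi> \<in> test_funs c d"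
    note \<phi>' = test_funs_mono[OF \<phi> sub]
    note dd = test_funs_deriv[OF test_funs_deriv[OF \<phi>]]
    have pi: "integrable (leb c d) p"
      by (rule integrable_interval_mono[OF L2_integrable sub]) (use p in \<open>simp add: H2_def\<close>)
    have "pairing a b p (deriv (deriv \<phi>)) = pairing a b w (deriv (deriv \<phi>))"
      unfolding test_integral_subinterval[OF dd sub] by (rule integral_test_ae_eq[OF dd eq pi])
    then have "pairing a b q \<phi> - pairing a b w2 \<phi> = 0"
      using w[OF \<phi>'] pq[OF \<phi>'] by simp
    then have "(\<integral>x. (q x - w2 x) * \<phi> x \<partial>leb a b) = 0"
      using integral_test_diff[OF L2_integrable[OF q] L2_integrable[OF w2] \<phi>] by simp
    then show "(\<integral>x. (q x - w2 x) * \<phi> x \<partial>leb c d) = 0"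
      by (simp add: test_integral_subinterval[OF \<phi> sub])
  qed
  then show ?thesis unfolding ae_eq_def by eventually_elim simp
qed

text \<open>Cauchy-Schwarz against the constant 1, obtained by optimizing the weight in Young's
  inequality.\<close>

lemma integral_abs_le_L2:
  assumes f: "f \<in> L2 a b" and "a < b"
  shows "(\<integral>x. \<bar>f x\<bar> \<partial>leb a b)\<^sup>2 \<le> (b - a) * sqnorm a b f"
proof -
  let ?M = "leb a b"
  define A where "A = (\<integral>x. \<bar>f x\<bar> \<partial>?M)"
  define B where "B = sqnorm a b f"
  have B0: "B \<ge> 0" unfolding B_def by (rule Bochner_Integration.integral_nonneg) simp
  have A0: "A \<ge> 0" unfolding A_def by (rule Bochner_Integration.integral_nonneg) simp
  have i: "integrable ?M (\<lambda>x. \<bar>f x\<bar>)" "integrable ?M (\<lambda>x. (f x)\<^sup>2)"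
    using L2_integrable[OF f] f by (auto simp: L2_def)
  have m: "(\<integral>x. t \<partial>?M) = t * (b - a)" for t :: real
    using \<open>a < b\<close> by (simp add: measure_restrict_space)
  have key: "2 * A \<le> B / t + t * (b - a)" if "t > 0" for t
  proof -
    have "2 * \<bar>y\<bar> \<le> y\<^sup>2 / t + t" for y :: real
      using inner_le_weighted[of t 1 "\<bar>y\<bar>"] that by (simp add: power2_eq_square)
    then have "(\<integral>x. 2 * \<bar>f x\<bar> \<partial>?M) \<le> (\<integral>x. (f x)\<^sup>2 / t + t \<partial>?M)"
      by (intro integral_mono) (use i integrable_const' in auto)
    also have "\<dots> = B / t + t * (b - a)"
      unfolding B_def m[symmetric] using i integrable_const'
      by (subst Bochner_Integration.integral_add) auto
    finally show ?thesis unfolding A_def by simp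
  qed
  have "A\<^sup>2 \<le> (b - a) * B"
  proof (cases "A = 0")
    case True
    then show ?thesis using B0 \<open>a < b\<close> by simp
  next
    case False
    then have A: "A > 0" using A0 by simp
    \<comment> \<open>The weight \<open>A / (b - a)\<close> turns the second term into
      \<open>A\<close>. It must be positive, which is why \<open>A = 0\<close> is treated
      apart.\<close>
    have "2 * A \<le> B / (A / (b - a)) + A / (b - a) * (b - a)" by (rule key) (use A \<open>a < b\<close> in simp)
    then have "A \<le> B / (A / (b - a))" using \<open>a < b\<close> by simp
    then show ?thesis using A \<open>a < b\<close> by (simp add: field_simps power2_eq_square)
  qed
  then show ?thesis by (simp add: A_def B_def)
qed

lemma cut_abs_integral:
  "(\<integral>x. \<bar>cut a b f x\<bar> \<partial>lebesgue) = (\<integral>x. \<bar>f x\<bar> \<partial>leb a b)"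
proof -
  have "(\<integral>x. \<bar>f x\<bar> \<partial>leb a b) = (\<integral>x. indicator {a<..<b} x *\<^sub>R \<bar>f x\<bar> \<partial>lebesgue)"
    by (subst integral_restrict_space) auto
  also have "(\<lambda>x. indicator {a<..<b} x *\<^sub>R \<bar>f x\<bar>) = (\<lambda>x. \<bar>cut a b f x\<bar>)"
    by (auto simp: cut_def indicator_def)
  finally show ?thesis by simp
qed

text \<open>\<open>r\<close> is \<open>dprim\<close> of \<kappa> plus an affine function; both
  \<open>r\<close> and this primitive vanish on (-2, -1), so the affine part is zero. With
  \<open>A\<close> the L^1 norm of \<kappa>, integrating twice over length 4 gives
  \<open>\<bar>r\<bar> \<le> 4 * A\<close>, the square integrates to at most
  \<open>64 * A\<^sup>2\<close>, and \<open>A\<^sup>2\<close> is at most 4 times the square norm of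
  \<kappa>: hence 256.\<close>

lemma poincare:
  assumes r: "r \<in> L2 (-2) 2" and \<kappa>: "\<kappa> \<in> L2 (-2) 2"
    and weak: "\<And>\<phi>. \<phi> \<in> test_funs (-2) 2 \<Longrightarrow>
      (pairing (-2) 2 r (deriv (deriv \<phi>))) = pairing (-2) 2 \<kappa> \<phi>"
    and r0: "ae_eq (-2) (-1) r (\<lambda>x. 0)" and \<kappa>0: "ae_eq (-2) (-1) \<kappa> (\<lambda>x. 0)"
  shows "sqnorm (-2) 2 r \<le> 256 * sqnorm (-2) 2 \<kappa>"
proof -
  let ?M = "leb (-2) 2"
  note \<kappa>i = L2_integrable[OF \<kappa>]
  obtain k l where kl: "ae_eq (-2) 2 r (\<lambda>x. dprim (-2) 2 \<kappa> x + k + l * x)"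
    using weak_imp_H2(3)[OF _ r \<kappa> weak] by auto
  have pz: "prim f x = 0" if "AE t in lebesgue. t < x \<longrightarrow> f t = 0" for f x
    unfolding prim_def by (rule integral_eq_zero_AE) (use that in eventually_elim, simp)
  have p0: "prim (cut (-2) 2 \<kappa>) x = 0" if "x \<le> -1" for x
  proof (rule pz)
    show "AE t in lebesgue. t < x \<longrightarrow> cut (-2) 2 \<kappa> t = 0"
      using \<kappa>0[unfolded ae_eq_def AE_lebesgue_on_interval] by eventually_elim (use that in \<open>auto simp: cut_def\<close>)
  qed
  have d0: "dprim (-2) 2 \<kappa> x = 0" if "x \<le> -1" for x
    unfolding dprim_def by (rule pz, rule AE_I2) (use p0 that in \<open>auto simp: cut_def\<close>)
  have z: "AE x in leb (-2) (-1). k + l * x = 0"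
    using r0[unfolded ae_eq_def AE_lebesgue_on_interval] kl[unfolded ae_eq_def AE_lebesgue_on_interval]
    unfolding AE_lebesgue_on_interval by eventually_elim (auto simp: d0)
  \<comment> \<open>Disjoint intervals provide two distinct zeros of the affine function.\<close>
  obtain x where x: "x \<in> {-2<..<-3/2}" "k + l * x = 0" using AE_interval_ex[OF z, of "-2" "-3/2"] by auto
  obtain y where y: "y \<in> {-3/2<..<-1}" "k + l * y = 0" using AE_interval_ex[OF z, of "-3/2" "-1"] by auto
  have "l * (y - x) = (k + l * y) - (k + l * x)" by (simp add: right_diff_distrib)
  then have "l * (y - x) = 0" unfolding x(2) y(2) by simp
  then have l: "l = 0" using x(1) y(1) by auto
  then have k: "k = 0" using x(2) by simp
  define A where "A = (\<integral>x. \<bar>\<kappa> x\<bar> \<partial>?M)"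
  have g: "\<bar>prim (cut (-2) 2 \<kappa>) x\<bar> \<le> A" for x
    using prim_abs_le[OF integrable_cut[OF \<kappa>i]] unfolding A_def cut_abs_integral .
  have m: "(\<integral>x. t \<partial>?M) = t * 4" for t :: real by (simp add: measure_restrict_space)
  have "\<bar>dprim (-2) 2 \<kappa> x\<bar> \<le> 4 * A" for x
  proof -
    have "\<bar>dprim (-2) 2 \<kappa> x\<bar> \<le> (\<integral>x. \<bar>prim (cut (-2) 2 \<kappa>) x\<bar> \<partial>?M)"
      using prim_abs_le[OF integrable_cut[OF dprim_inner_integrable[OF \<kappa>i]]] unfolding dprim_def cut_abs_integral .
    also have "\<dots> \<le> (\<integral>x. A \<partial>?M)"
      by (rule integral_mono) (use dprim_inner_integrable[OF \<kappa>i] integrable_const' g in auto)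
    finally show ?thesis unfolding m by simp
  qed
  then have d: "(dprim (-2) 2 \<kappa> x)\<^sup>2 \<le> (4 * A)\<^sup>2" for x by (metis abs_le_square_iff abs_ge_self order_trans)
  have "AE x in ?M. (r x)\<^sup>2 \<le> (4 * A)\<^sup>2"
    using kl unfolding ae_eq_def
  proof eventually_elim
    case (elim x)
    then have "r x = dprim (-2) 2 \<kappa> x" by (simp add: l k)
    then show ?case using d[of x] by (simp only:)
  qed
  then have "sqnorm (-2) 2 r \<le> (\<integral>x. (4 * A)\<^sup>2 \<partial>?M)"
    by (rule integral_mono_AE[rotated 2]) (use r integrable_const' in \<open>auto simp: L2_def\<close>)
  also have "\<dots> = 64 * A\<^sup>2" unfolding m by (simp add: power_mult_distrib)
  also have "A\<^sup>2 \<le> 4 * sqnorm (-2) 2 \<kappa>" using integral_abs_le_L2[OF \<kappa>] by (simp add: A_def)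
  finally show ?thesis by simp
qed


section \<open>Square norms on (-1, 1) and on (-2, 2)\<close>

lemma integral_cut_mult:
  assumes "a \<le> c" "d \<le> b"
  shows "pairing a b f (cut c d A) = pairing c d f A"
proof -
  have "pairing a b f (cut c d A) = (\<integral>x. indicator {a<..<b} x *\<^sub>R (f x * cut c d A x) \<partial>lebesgue)"
    by (subst integral_restrict_space) auto
  also have "(\<lambda>x. indicator {a<..<b} x *\<^sub>R (f x * cut c d A x)) = (\<lambda>x. indicator {c<..<d} x *\<^sub>R (f x * A x))"
    using assms by (auto simp: cut_def indicator_def fun_eq_iff)
  also have "(\<integral>x. indicator {c<..<d} x *\<^sub>R (f x * A x) \<partial>lebesgue) = pairing c d f A"
    by (subst integral_restrict_space) auto
  finally show ?thesis .
qed

lemma L2_sq_integrable: "f \<in> L2 a b \<Longrightarrow> integrable (leb a b) (\<lambda>x. (f x)\<^sup>2)"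
  by (simp add: L2_def)

lemma L2_sq_mono:
  assumes "f \<in> L2 a b" "a \<le> c" "d \<le> b"
  shows "sqnorm c d f \<le> sqnorm a b f"
proof -
  have "sqnorm c d f = pairing a b f (cut c d f)"
    using integral_cut_mult[OF assms(2,3), of f f] by (simp add: power2_eq_square)
  also have "\<dots> \<le> sqnorm a b f"
  proof (rule integral_mono)
    show "integrable (leb a b) (\<lambda>x. f x * cut c d f x)"
      by (rule L2_mult_integrable[OF assms(1) cut_L2[OF L2_mono[OF assms] assms(2,3)]])
    show "integrable (leb a b) (\<lambda>x. (f x)\<^sup>2)" by (rule L2_sq_integrable[OF assms(1)])
    show "f x * cut c d f x \<le> (f x)\<^sup>2" for x by (simp add: cut_def power2_eq_square)
  qed
  finally show ?thesis .
qed

lemma L2_sq_split: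
  assumes f: "f \<in> L2 (-2) 2" and g: "g \<in> L2 (-2) 2"
    and eq: "ae_eq (-2) (-1) f g" "ae_eq 1 2 f g"
  shows "sqnorm (-2) 2 f \<le> sqnorm (-1) 1 f + sqnorm (-2) 2 g"
proof -
  let ?M = "leb (-2) 2"
  have c: "integrable ?M (\<lambda>x. f x * cut (-1) 1 f x)"
    by (rule L2_mult_integrable[OF f cut_L2[OF L2_mono[OF f]]]) auto
  have "AE x in ?M. (f x)\<^sup>2 \<le> f x * cut (-1) 1 f x + (g x)\<^sup>2"
    using eq[unfolded ae_eq_def AE_lebesgue_on_interval] AE_lebesgue_neq[of "-1"] AE_lebesgue_neq[of 1]
    unfolding AE_lebesgue_on_interval
  proof eventually_elim
    case (elim x)
    show ?case
    proof
      assume x: "-2 < x \<and> x < 2"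
      show "(f x)\<^sup>2 \<le> f x * cut (-1) 1 f x + (g x)\<^sup>2"
      proof (cases "-1 < x \<and> x < 1")
        case True
        then show ?thesis by (simp add: cut_def power2_eq_square)
      next
        case False
        then have "f x = g x" using elim x by linarith
        then show ?thesis using False by (simp add: cut_def)
      qed
    qed
  qed
  then have "sqnorm (-2) 2 f \<le> (\<integral>x. f x * cut (-1) 1 f x + (g x)\<^sup>2 \<partial>?M)"
    by (rule integral_mono_AE[OF L2_sq_integrable[OF f] Bochner_Integration.integrable_add[OF c L2_sq_integrable[OF g]]])
  also have "\<dots> = pairing (-2) 2 f (cut (-1) 1 f) + sqnorm (-2) 2 g"
    by (rule Bochner_Integration.integral_add[OF c L2_sq_integrable[OF g]])
  also have "pairing (-2) 2 f (cut (-1) 1 f) = sqnorm (-1) 1 f"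
    using integral_cut_mult[of "-2" "-1" 1 2 f f] by (simp add: power2_eq_square)
  finally show ?thesis .
qed

lemma L2_sq_add_le:
  assumes f: "f \<in> L2 a b" and g: "g \<in> L2 a b"
  shows "(\<integral>x. (f x + g x)\<^sup>2 \<partial>leb a b)
    \<le> 2 * sqnorm a b f + 2 * sqnorm a b g"
proof -
  have "(\<integral>x. (f x + g x)\<^sup>2 \<partial>leb a b) \<le> (\<integral>x. 2 * (f x)\<^sup>2 + 2 * (g x)\<^sup>2 \<partial>leb a b)"
  proof (rule integral_mono)
    show "integrable (leb a b) (\<lambda>x. (f x + g x)\<^sup>2)" by (rule L2_sq_integrable[OF L2_add[OF f g]])
    show "integrable (leb a b) (\<lambda>x. 2 * (f x)\<^sup>2 + 2 * (g x)\<^sup>2)"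
      using L2_sq_integrable[OF f] L2_sq_integrable[OF g] by simp
    fix x
    have "0 \<le> (f x - g x)\<^sup>2" by simp
    then show "(f x + g x)\<^sup>2 \<le> 2 * (f x)\<^sup>2 + 2 * (g x)\<^sup>2" by (simp add: power2_sum power2_diff)
  qed
  also have "\<dots> = 2 * sqnorm a b f + 2 * sqnorm a b g"
    using L2_sq_integrable[OF f] L2_sq_integrable[OF g] by simp
  finally show ?thesis .
qed

subsection \<open>The energy\<close>

text \<open>The second derivatives are independent arguments. The energy is then a convex quadratic
  function of four L^2 functions, and the weak limits \<open>H\<close> and \<open>Q\<close> can be
  inserted before they are identified with derivatives of \<open>V\<close> and
  \<open>P\<close>.\<close>

definition energy :: "real \<Rightarrow> real \<Rightarrow> real \<Rightarrow> (real \<Rightarrow> real) \<Rightarrow> (real \<Rightarrow> real) \<Rightarrow>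
    (real \<Rightarrow> real) \<Rightarrow> (real \<Rightarrow> real) \<Rightarrow> (real \<Rightarrow> real) \<Rightarrow> (real \<Rightarrow> real) \<Rightarrow> real" where
  "energy \<eta> \<mu> \<gamma> f\<^sub>r f\<^sub>p v p h q = (\<integral>x. \<eta> * (h x)\<^sup>2 - f\<^sub>r x * v x \<partial>leb (-1) 1)
     + \<mu> * (\<integral>x. (v x - p x)\<^sup>2 \<partial>leb (-1) 1) + (\<integral>x. \<gamma> * (q x)\<^sup>2 - f\<^sub>p x * p x \<partial>leb (-1) 1)"

lemma energy_expand:
  assumes L: "f\<^sub>r \<in> L2 (-1) 1" "f\<^sub>p \<in> L2 (-1) 1" "v \<in> L2 (-1) 1" "p \<in> L2 (-1) 1" "h \<in> L2 (-1) 1" "q \<in> L2 (-1) 1"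
  shows "energy \<eta> \<mu> \<gamma> f\<^sub>r f\<^sub>p v p h q = (\<integral>x. \<eta> * (h x)\<^sup>2 - f\<^sub>r x * v x + \<mu> * (v x - p x)\<^sup>2 + (\<gamma> * (q x)\<^sup>2 - f\<^sub>p x * p x) \<partial>leb (-1) 1)"
    and "integrable (leb (-1) 1) (\<lambda>x. \<eta> * (h x)\<^sup>2 - f\<^sub>r x * v x + \<mu> * (v x - p x)\<^sup>2 + (\<gamma> * (q x)\<^sup>2 - f\<^sub>p x * p x))"
proof -
  note i = L2_sq_integrable[OF L(5)] L2_mult_integrable[OF L(1,3)] L2_sq_integrable[OF L2_diff[OF L(3,4)]]
    L2_sq_integrable[OF L(6)] L2_mult_integrable[OF L(2,4)]
  show "energy \<eta> \<mu> \<gamma> f\<^sub>r f\<^sub>p v p h q = (\<integral>x. \<eta> * (h x)\<^sup>2 - f\<^sub>r x * v x + \<mu> * (v x - p x)\<^sup>2 + (\<gamma> * (q x)\<^sup>2 - f\<^sub>p x * p x) \<partial>leb (-1) 1)"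
    unfolding energy_def using i by simp
  show "integrable (leb (-1) 1) (\<lambda>x. \<eta> * (h x)\<^sup>2 - f\<^sub>r x * v x + \<mu> * (v x - p x)\<^sup>2 + (\<gamma> * (q x)\<^sup>2 - f\<^sub>p x * p x))"
    using i by simp
qed

text \<open>The load is rewritten as
  \<open>f\<^sub>r * (v - p) + (f\<^sub>r + f\<^sub>p) * p\<close>. Young's inequality charges the
  first part to half of the \<mu> term and the second to \<delta> times the square norm of
  \<open>p\<close>, with \<delta> still to be chosen.\<close>

lemma energy_coercive:
  assumes L: "f\<^sub>r \<in> L2 (-1) 1" "f\<^sub>p \<in> L2 (-1) 1" "v \<in> L2 (-1) 1" "p \<in> L2 (-1) 1" "h \<in> L2 (-1) 1" "q \<in> L2 (-1) 1"
    and pos: "\<mu> > 0" "\<delta> > 0"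
  shows "energy \<eta> \<mu> \<gamma> f\<^sub>r f\<^sub>p v p h q \<ge> \<eta> * sqnorm (-1) 1 h
    + \<mu> / 2 * (\<integral>x. (v x - p x)\<^sup>2 \<partial>leb (-1) 1) + \<gamma> * sqnorm (-1) 1 q
    - \<delta> * sqnorm (-1) 1 p
    - (sqnorm (-1) 1 (f\<^sub>r) / (2 * \<mu>) + (\<integral>x. (f\<^sub>r x + f\<^sub>p x)\<^sup>2 \<partial>leb (-1) 1) / (4 * \<delta>))"
proof -
  let ?M = "leb (-1) 1"
  let ?low = "\<lambda>x. \<eta> * (h x)\<^sup>2 + \<mu> / 2 * (v x - p x)\<^sup>2 + \<gamma> * (q x)\<^sup>2 - \<delta> * (p x)\<^sup>2
    - ((f\<^sub>r x)\<^sup>2 / (2 * \<mu>) + (f\<^sub>r x + f\<^sub>p x)\<^sup>2 / (4 * \<delta>))"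
  note i = L2_sq_integrable[OF L(5)] L2_sq_integrable[OF L2_diff[OF L(3,4)]] L2_sq_integrable[OF L(6)]
    L2_sq_integrable[OF L(4)] L2_sq_integrable[OF L(1)] L2_sq_integrable[OF L2_add[OF L(1,2)]]
  have "(\<integral>x. ?low x \<partial>?M) \<le> energy \<eta> \<mu> \<gamma> f\<^sub>r f\<^sub>p v p h q"
    unfolding energy_expand(1)[OF L]
  proof (rule integral_mono)
    show "integrable ?M ?low" using i by simp
    fix x
    have 1: "2 * ((v x - p x) * f\<^sub>r x) \<le> \<mu> * (v x - p x)\<^sup>2 + (f\<^sub>r x)\<^sup>2 / \<mu>"
      using inner_le_weighted[OF pos(1), of "v x - p x" "f\<^sub>r x"] by (simp add: power2_eq_square)
    have 2: "2 * (p x * (f\<^sub>r x + f\<^sub>p x)) \<le> (2 * \<delta>) * (p x)\<^sup>2 + (f\<^sub>r x + f\<^sub>p x)\<^sup>2 / (2 * \<delta>)"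
      using inner_le_weighted[of "2 * \<delta>" "p x" "f\<^sub>r x + f\<^sub>p x"] pos(2) by (simp add: power2_eq_square)
    have e: "(f\<^sub>r x)\<^sup>2 / \<mu> = 2 * ((f\<^sub>r x)\<^sup>2 / (2 * \<mu>))" "(f\<^sub>r x + f\<^sub>p x)\<^sup>2 / (2 * \<delta>) = 2 * ((f\<^sub>r x + f\<^sub>p x)\<^sup>2 / (4 * \<delta>))"
      by simp_all
    have "(v x - p x) * f\<^sub>r x + p x * (f\<^sub>r x + f\<^sub>p x) = f\<^sub>r x * v x + f\<^sub>p x * p x" by (simp add: algebra_simps)
    then show "?low x \<le> \<eta> * (h x)\<^sup>2 - f\<^sub>r x * v x + \<mu> * (v x - p x)\<^sup>2 + (\<gamma> * (q x)\<^sup>2 - f\<^sub>p x * p x)"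
      using 1 2 unfolding e by argo
  qed (rule energy_expand(2)[OF L])
  moreover have "(\<integral>x. ?low x \<partial>?M) = \<eta> * sqnorm (-1) 1 h
    + \<mu> / 2 * (\<integral>x. (v x - p x)\<^sup>2 \<partial>?M) + \<gamma> * sqnorm (-1) 1 q - \<delta> * sqnorm (-1) 1 p
    - (sqnorm (-1) 1 (f\<^sub>r) / (2 * \<mu>) + (\<integral>x. (f\<^sub>r x + f\<^sub>p x)\<^sup>2 \<partial>?M) / (4 * \<delta>))"
    using i by simp
  ultimately show ?thesis by simp
qed

text \<open>\<open>lin\<close> is the derivative of the energy at \<open>(v, p, h, q)\<close>. The
  energy minus its tangent is the quadratic part evaluated at the differences, which is
  nonnegative.\<close>

lemma energy_convex:
  assumes L: "f\<^sub>r \<in> L2 (-1) 1" "f\<^sub>p \<in> L2 (-1) 1" "v \<in> L2 (-1) 1" "p \<in> L2 (-1) 1" "h \<in> L2 (-1) 1" "q \<in> L2 (-1) 1"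
    and L': "v' \<in> L2 (-1) 1" "p' \<in> L2 (-1) 1" "h' \<in> L2 (-1) 1" "q' \<in> L2 (-1) 1"
    and pos: "\<eta> > 0" "\<mu> > 0" "\<gamma> > 0"
    and lin: "lin = (\<lambda>v' p' h' q'. (\<integral>x. v' x * (2 * \<mu> * (v x - p x) - f\<^sub>r x) \<partial>leb (-1) 1)
      + (\<integral>x. p' x * ((- 2 * \<mu>) * (v x - p x) - f\<^sub>p x) \<partial>leb (-1) 1)
      + (\<integral>x. h' x * (2 * \<eta> * h x) \<partial>leb (-1) 1) + (\<integral>x. q' x * (2 * \<gamma> * q x) \<partial>leb (-1) 1))"
  shows "energy \<eta> \<mu> \<gamma> f\<^sub>r f\<^sub>p v p h q + lin v' p' h' q' - lin v p h q \<le> energy \<eta> \<mu> \<gamma> f\<^sub>r f\<^sub>p v' p' h' q'"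
proof -
  let ?M = "leb (-1) 1"
  let ?d = "\<lambda>v' p' h' q' x. v' x * (2 * \<mu> * (v x - p x) - f\<^sub>r x) + p' x * ((- 2 * \<mu>) * (v x - p x) - f\<^sub>p x)
      + h' x * (2 * \<eta> * h x) + q' x * (2 * \<gamma> * q x)"
  have dL: "(\<lambda>x. 2 * \<mu> * (v x - p x) - f\<^sub>r x) \<in> L2 (-1) 1" "(\<lambda>x. (- 2 * \<mu>) * (v x - p x) - f\<^sub>p x) \<in> L2 (-1) 1"
    "(\<lambda>x. 2 * \<eta> * h x) \<in> L2 (-1) 1" "(\<lambda>x. 2 * \<gamma> * q x) \<in> L2 (-1) 1"
    by (intro L2_diff L2_cmult L)+
  have di: "integrable ?M (?d v' p' h' q')" and dl: "lin v' p' h' q' = (\<integral>x. ?d v' p' h' q' x \<partial>?M)"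
    if "v' \<in> L2 (-1) 1" "p' \<in> L2 (-1) 1" "h' \<in> L2 (-1) 1" "q' \<in> L2 (-1) 1" for v' p' h' q'
  proof -
    note i = L2_mult_integrable[OF that(1) dL(1)] L2_mult_integrable[OF that(2) dL(2)]
      L2_mult_integrable[OF that(3) dL(3)] L2_mult_integrable[OF that(4) dL(4)]
    show "integrable ?M (?d v' p' h' q')" by (intro Bochner_Integration.integrable_add i)
    have "(\<integral>x. ?d v' p' h' q' x \<partial>?M) = lin v' p' h' q'"
      unfolding lin Bochner_Integration.integral_add[OF Bochner_Integration.integrable_add[OF
            Bochner_Integration.integrable_add[OF i(1,2)] i(3)] i(4)]
        Bochner_Integration.integral_add[OF Bochner_Integration.integrable_add[OF i(1,2)] i(3)]
        Bochner_Integration.integral_add[OF i(1,2)] by (rule refl)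
    then show "lin v' p' h' q' = (\<integral>x. ?d v' p' h' q' x \<partial>?M)" by simp
  qed
  let ?Q = "\<lambda>v p h q x. \<eta> * (h x)\<^sup>2 - f\<^sub>r x * v x + \<mu> * (v x - p x)\<^sup>2 + (\<gamma> * (q x)\<^sup>2 - f\<^sub>p x * p x)"
  have "(\<integral>x. ?Q v p h q x + ?d v' p' h' q' x - ?d v p h q x \<partial>?M) \<le> (\<integral>x. ?Q v' p' h' q' x \<partial>?M)"
  proof (rule integral_mono)
    show "integrable ?M (\<lambda>x. ?Q v p h q x + ?d v' p' h' q' x - ?d v p h q x)"
      by (intro Bochner_Integration.integrable_add Bochner_Integration.integrable_diff energy_expand(2)[OF L] di[OF L'] di[OF L(3-6)])
    show "integrable ?M (?Q v' p' h' q')" by (rule energy_expand(2)[OF L(1,2) L'])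
    fix x
    have "?Q v' p' h' q' x - (?Q v p h q x + ?d v' p' h' q' x - ?d v p h q x)
        = \<eta> * (h' x - h x)\<^sup>2 + \<mu> * ((v' x - p' x) - (v x - p x))\<^sup>2 + \<gamma> * (q' x - q x)\<^sup>2"
      by (simp add: power2_eq_square algebra_simps)
    also have "\<dots> \<ge> 0" using pos by (intro add_nonneg_nonneg mult_nonneg_nonneg) auto
    finally show "?Q v p h q x + ?d v' p' h' q' x - ?d v p h q x \<le> ?Q v' p' h' q' x" by linarith
  qed
  moreover have "(\<integral>x. ?Q v p h q x + ?d v' p' h' q' x - ?d v p h q x \<partial>?M)
      = (\<integral>x. ?Q v p h q x \<partial>?M) + (\<integral>x. ?d v' p' h' q' x \<partial>?M) - (\<integral>x. ?d v p h q x \<partial>?M)"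
    unfolding Bochner_Integration.integral_diff[OF Bochner_Integration.integrable_add[OF energy_expand(2)[OF L] di[OF L']] di[OF L(3-6)]]
      Bochner_Integration.integral_add[OF energy_expand(2)[OF L] di[OF L']] by (rule refl)
  ultimately show ?thesis
    unfolding energy_expand(1)[OF L] energy_expand(1)[OF L(1,2) L'] dl[OF L'] dl[OF L(3-6)] by simp
qed

lemma counting_finite: "finite S \<Longrightarrow> counting S = ereal (real (card S))"
  by (simp add: counting_def ennreal_of_nat_eq_real_of_nat)

lemma F1_eq:
  assumes "finite (disc (-2) 2 v)" "finite (disc (-2) 2 (ac_deriv (-2) 2 v))"
  shows "F1 \<alpha> \<beta> \<eta> \<mu> \<gamma> f\<^sub>r f\<^sub>p v p = ereal (\<alpha> * real (card (disc (-2) 2 v))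
    + \<beta> * real (card (disc (-2) 2 (ac_deriv (-2) 2 v) - disc (-2) 2 v))
    + energy \<eta> \<mu> \<gamma> f\<^sub>r f\<^sub>p v p (ac_deriv (-2) 2 (ac_deriv (-2) 2 v)) (weak_deriv (-2) 2 (weak_deriv (-2) 2 p)))"
  using assms by (simp add: F1_def energy_def counting_finite Let_def)

lemma energy_ae_cong:
  assumes hq: "ae_eq (-1) 1 h h'" "ae_eq (-1) 1 q q'"
    and L: "f\<^sub>r \<in> L2 (-1) 1" "f\<^sub>p \<in> L2 (-1) 1" "v \<in> L2 (-1) 1" "p \<in> L2 (-1) 1" "h \<in> L2 (-1) 1" "q \<in> L2 (-1) 1"
  shows "energy \<eta> \<mu> \<gamma> f\<^sub>r f\<^sub>p v p h q = energy \<eta> \<mu> \<gamma> f\<^sub>r f\<^sub>p v p h' q'"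
  unfolding energy_expand(1)[OF L] energy_expand(1)[OF L(1-4) L2_ae_eq[OF hq(1) L(5)] L2_ae_eq[OF hq(2) L(6)]]
proof (rule integral_interval_AE)
  show "AE x in leb (-1) 1. \<eta> * (h x)\<^sup>2 - f\<^sub>r x * v x + \<mu> * (v x - p x)\<^sup>2 + (\<gamma> * (q x)\<^sup>2 - f\<^sub>p x * p x)
      = \<eta> * (h' x)\<^sup>2 - f\<^sub>r x * v x + \<mu> * (v x - p x)\<^sup>2 + (\<gamma> * (q' x)\<^sup>2 - f\<^sub>p x * p x)"
    using hq unfolding ae_eq_def by eventually_elim simp
qed (rule borel_measurable_integrable[OF energy_expand(2)[OF L]])


section \<open>Pointwise relations from integrals against L^2 functions\<close>

lemma L2_pos_part:
  assumes "f \<in> L2 a b"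
  shows "(\<lambda>x. max 0 (f x)) \<in> L2 a b"
proof -
  have m: "(\<lambda>x. max 0 (f x)) \<in> borel_measurable (leb a b)"
    by (intro borel_measurable_max borel_measurable_const L2_measurable assms)
  have "integrable (leb a b) (\<lambda>x. (max 0 (f x))\<^sup>2)"
  proof (rule Bochner_Integration.integrable_bound[OF L2_sq_integrable[OF assms]])
    show "(\<lambda>x. (max 0 (f x))\<^sup>2) \<in> borel_measurable (leb a b)" using m by measurable
    show "AE x in leb a b. norm ((max 0 (f x))\<^sup>2) \<le> norm ((f x)\<^sup>2)"
      by (intro AE_I2) (simp add: max_def)
  qed
  then show ?thesis using m by (simp add: L2_def)
qed

text \<open>Testing with \<open>f - g\<close> itself makes the square norm of the difference on (c,
  d) vanish.\<close>

lemma L2_eq_of_pairing: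
  assumes f: "f \<in> L2 a b" and g: "g \<in> L2 a b" and sub: "a \<le> c" "d \<le> b"
    and eq: "\<And>A. A \<in> L2 a b \<Longrightarrow> (pairing a b f (cut c d A)) = pairing a b g (cut c d A)"
  shows "ae_eq c d f g"
proof -
  let ?M = "leb c d"
  define A where "A x = f x - g x" for x
  have A: "A \<in> L2 a b" unfolding A_def[abs_def] by (rule L2_diff[OF f g])
  note m = L2_mono[OF f sub] L2_mono[OF g sub] L2_mono[OF A sub]
  have "pairing c d f A - pairing c d g A = 0"
    using eq[OF A] unfolding integral_cut_mult[OF sub] by simp
  then have "(\<integral>x. f x * A x - g x * A x \<partial>?M) = 0"
    using L2_mult_integrable[OF m(1,3)] L2_mult_integrable[OF m(2,3)] by simp
  then have "sqnorm c d A = 0" by (simp add: A_def power2_eq_square algebra_simps)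
  then have "AE x in ?M. (A x)\<^sup>2 = 0"
    using integral_nonneg_eq_0_iff_AE[OF L2_sq_integrable[OF m(3)]] by simp
  then show ?thesis unfolding ae_eq_def by eventually_elim (simp add: A_def)
qed

text \<open>Testing with the positive part of \<open>f - g\<close> makes its square norm vanish. An
  a.e. inequality thus follows from one linear inequality, which weak limits preserve.\<close>

lemma L2_le_of_pairing:
  assumes f: "f \<in> L2 a b" and g: "g \<in> L2 a b"
    and le: "(\<integral>x. g x * max 0 (f x - g x) \<partial>leb a b) \<ge> (\<integral>x. f x * max 0 (f x - g x) \<partial>leb a b)"
  shows "AE x in leb a b. f x \<le> g x"
proof -
  let ?M = "leb a b"
  let ?A = "\<lambda>x. max 0 (f x - g x)"
  have A: "?A \<in> L2 a b" by (rule L2_pos_part[OF L2_diff[OF f g]])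
  have "(\<integral>x. f x * ?A x - g x * ?A x \<partial>?M) \<le> 0"
    using le L2_mult_integrable[OF f A] L2_mult_integrable[OF g A] by simp
  moreover have "(\<lambda>x. f x * ?A x - g x * ?A x) = (\<lambda>x. (?A x)\<^sup>2)"
    by (auto simp: max_def power2_eq_square algebra_simps fun_eq_iff)
  ultimately have "sqnorm a b (?A) \<le> 0" by simp
  moreover have "sqnorm a b (?A) \<ge> 0" by (rule Bochner_Integration.integral_nonneg) simp
  ultimately have "AE x in ?M. (?A x)\<^sup>2 = 0"
    using integral_nonneg_eq_0_iff_AE[OF L2_sq_integrable[OF A]] by simp
  then show ?thesis by eventually_elim (simp add: max_def split: if_splits)
qed

section \<open>Admissible pairs with a fixed boundary datum\<close>

locale boundary_datum =
  fixes w W w1 w2 :: "real \<Rightarrow> real"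
  assumes w_H2: "w \<in> H2 (-2) 2" and w2_L2: "w2 \<in> L2 (-2) 2" and wW: "ae_eq (-2) 2 w W"
    and W_cont: "\<And>x. isCont W x" and w1_cont: "\<And>x. isCont w1 x"
    and w_ac: "has_ac_deriv (-2) 2 w w1" "has_ac_deriv (-2) 2 w1 w2"
    and w_weak: "\<And>\<phi>. \<phi> \<in> test_funs (-2) 2 \<Longrightarrow>
      (pairing (-2) 2 w (deriv (deriv \<phi>))) = pairing (-2) 2 w2 \<phi>"
begin

abbreviation D1 where "D1 v \<equiv> ac_deriv (-2) 2 v"
abbreviation D2 where "D2 v \<equiv> ac_deriv (-2) 2 (D1 v)"
abbreviation W2 where "W2 p \<equiv> weak_deriv (-2) 2 (weak_deriv (-2) 2 p)"
abbreviation jumps where "jumps v \<equiv> disc (-2) 2 v"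
abbreviation kinks where "kinks v \<equiv> disc (-2) 2 (D1 v)"

lemma w_L2: "w \<in> L2 (-2) 2" using w_H2 by (simp add: H2_def)

lemma admissible_D:
  assumes "(v, p) \<in> admissible w"
  shows "v \<in> piecewise_H2 (-2) 2" "p \<in> H2 (-2) 2"
    "ae_eq (-2) (-1) v w" "ae_eq 1 2 v w" "ae_eq (-2) (-1) p w" "ae_eq 1 2 p w" "obstacle v p"
  using assms by (auto simp: admissible_def)

lemma admissible_le:
  assumes "(v, p) \<in> admissible w"
  shows "AE x in leb (-2) 2. p x \<le> v x"
  using obstacle_iff_AE[OF admissible_D(1,2)[OF assms]
      ae_eq_trans[OF admissible_D(3)[OF assms] ae_eq_sym[OF admissible_D(5)[OF assms]]]
      ae_eq_trans[OF admissible_D(4)[OF assms] ae_eq_sym[OF admissible_D(6)[OF assms]]]]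
    admissible_D(7)[OF assms] by blast

lemma admissible_L2:
  assumes "(v, p) \<in> admissible w"
  shows "v \<in> L2 (-2) 2" "p \<in> L2 (-2) 2" "D2 v \<in> L2 (-2) 2" "W2 p \<in> L2 (-2) 2"
proof -
  note a = admissible_D[OF assms]
  show "v \<in> L2 (-2) 2" using piecewise_H2_rep[OF a(1)] by auto
  show "p \<in> L2 (-2) 2" using a(2) by (simp add: H2_def)
  show "D2 v \<in> L2 (-2) 2" by (rule piecewise_H2_ac_derivs(3)[OF a(1)]) simp
  obtain h where "h \<in> L2 (-2) 2" "ae_eq (-2) 2 (W2 p) h" using H2_weak[OF a(2)] by blast
  then show "W2 p \<in> L2 (-2) 2" using L2_ae_eq ae_eq_sym by blast
qed

lemma admissible_p_weak:
  assumes "(v, p) \<in> admissible w" "\<phi> \<in> test_funs (-2) 2"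
  shows "pairing (-2) 2 p (deriv (deriv \<phi>)) = pairing (-2) 2 (W2 p) \<phi>"
proof -
  obtain h where h: "ae_eq (-2) 2 (W2 p) h" and eq: "\<And>\<phi>. \<phi> \<in> test_funs (-2) 2 \<Longrightarrow>
      (pairing (-2) 2 p (deriv (deriv \<phi>))) = pairing (-2) 2 h \<phi>"
    using H2_weak[OF admissible_D(2)[OF assms(1)]] by blast
  show ?thesis
    unfolding eq[OF assms(2)]
    by (rule integral_test_ae_eq[OF assms(2) h L2_integrable[OF admissible_L2(4)[OF assms(1)]], symmetric])
qed

lemma admissible_v_weak:
  assumes "(v, p) \<in> admissible w"
  obtains j m where "\<And>\<phi>. \<phi> \<in> test_funs (-2) 2 \<Longrightarrow> (pairing (-2) 2 v (deriv (deriv \<phi>)))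
    = pairing (-2) 2 (D2 v) \<phi> + (\<Sum>s\<in>kinks v. m s * \<phi> s) - (\<Sum>s\<in>jumps v. j s * deriv \<phi> s)"
proof -
  have lt: "(-2::real) < 2" by simp
  have "\<exists>h j m. ae_eq (-2) 2 (D2 v) h \<and> (\<forall>\<phi>\<in>test_funs (-2) 2.
      (pairing (-2) 2 v (deriv (deriv \<phi>)))
      = pairing (-2) 2 h \<phi> + (\<Sum>s\<in>kinks v. m s * \<phi> s) - (\<Sum>s\<in>jumps v. j s * deriv \<phi> s))"
    by (rule piecewise_H2_weak[OF admissible_D(1)[OF assms] lt]) blast
  then obtain h j m where h: "ae_eq (-2) 2 (D2 v) h" and eq: "\<And>\<phi>. \<phi> \<in> test_funs (-2) 2 \<Longrightarrow>
      (pairing (-2) 2 v (deriv (deriv \<phi>)))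
      = pairing (-2) 2 h \<phi> + (\<Sum>s\<in>kinks v. m s * \<phi> s) - (\<Sum>s\<in>jumps v. j s * deriv \<phi> s)"
    by blast
  show ?thesis
  proof (rule that)
    fix \<phi> assume \<phi>: "\<phi> \<in> test_funs (-2) 2"
    show "pairing (-2) 2 v (deriv (deriv \<phi>))
      = pairing (-2) 2 (D2 v) \<phi> + (\<Sum>s\<in>kinks v. m s * \<phi> s) - (\<Sum>s\<in>jumps v. j s * deriv \<phi> s)"
      using eq[OF \<phi>] integral_test_ae_eq[OF \<phi> h L2_integrable[OF admissible_L2(3)[OF assms]]] by simp
  qed
qed

lemma admissible_finite:
  assumes "(v, p) \<in> admissible w"
  shows "finite (jumps v)" "finite (kinks v)"
proof -
  have lt: "(-2::real) < 2" by simp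
  have "finite (jumps v) \<and> finite (kinks v)"
    by (rule piecewise_H2_weak[OF admissible_D(1)[OF assms] lt]) blast
  then show "finite (jumps v)" "finite (kinks v)" by blast+
qed

lemma outside_derivs:
  assumes v: "v \<in> piecewise_H2 (-2) 2" and sub: "-2 \<le> c" "d \<le> 2" and eq: "ae_eq c d v w"
  shows "ae_eq c d (D1 v) w1" "ae_eq c d (D2 v) w2"
proof -
  have ac: "has_ac_deriv (-2) 2 v (D1 v)" "has_ac_deriv (-2) 2 (D1 v) (D2 v)"
    using piecewise_H2_ac_derivs[OF v] by auto
  show 1: "ae_eq c d (D1 v) w1" by (rule ac_deriv_local[OF ac(1) w_ac(1) sub eq])
  show "ae_eq c d (D2 v) w2" by (rule ac_deriv_local[OF ac(2) w_ac(2) sub 1])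
qed

lemma outside_smooth:
  assumes v: "v \<in> piecewise_H2 (-2) 2" and sub: "-2 \<le> c" "d \<le> 2" and eq: "ae_eq c d v w" and x: "c < x" "x < d"
  shows "x \<notin> jumps v" "x \<notin> kinks v"
proof -
  have "ae_eq c d v W" by (rule ae_eq_trans[OF eq ae_eq_mono[OF wW sub]])
  then show "x \<notin> jumps v" by (rule disc_local[OF _ x W_cont])
  show "x \<notin> kinks v" by (rule disc_local[OF outside_derivs(1)[OF v sub eq] x w1_cont])
qed

text \<open>On (-2, -1) and (1, 2) the continuous \<open>W\<close> and \<open>w1\<close> represent
  the function and its derivative. The points that remain lie in a compact set, so their limits stay
  inside (-2, 2), where they still count.\<close>

lemma admissible_disc:
  assumes "(v, p) \<in> admissible w"
  shows "jumps v \<subseteq> {-1..1}" "kinks v \<subseteq> {-1..1}"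
proof -
  note a = admissible_D[OF assms]
  have "x \<in> {-1..1}" if "x \<in> jumps v \<or> x \<in> kinks v" for x
  proof (rule ccontr)
    assume "x \<notin> {-1..1}"
    moreover have "-2 < x" "x < 2" using that by (auto simp: disc_def)
    ultimately consider "-2 < x" "x < -1" | "1 < x" "x < 2" by force
    then show False
      using outside_smooth[OF a(1) _ _ a(3), of x] outside_smooth[OF a(1) _ _ a(4), of x] that by cases auto
  qed
  then show "jumps v \<subseteq> {-1..1}" "kinks v \<subseteq> {-1..1}" by blast+
qed

lemma admissible_outside:
  assumes "(v, p) \<in> admissible w"
  shows "ae_eq (-2) (-1) (D2 v) w2" "ae_eq 1 2 (D2 v) w2" "ae_eq (-2) (-1) (W2 p) w2" "ae_eq 1 2 (W2 p) w2"
proof -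
  note a = admissible_D[OF assms]
  show "ae_eq (-2) (-1) (D2 v) w2" by (rule outside_derivs(2)[OF a(1) _ _ a(3)]) auto
  show "ae_eq 1 2 (D2 v) w2" by (rule outside_derivs(2)[OF a(1) _ _ a(4)]) auto
  note l = H2_second_local[OF a(2) w_weak w2_L2 admissible_L2(4)[OF assms] admissible_p_weak[OF assms]]
  show "ae_eq (-2) (-1) (W2 p) w2" by (rule l[OF _ _ _ _ a(5)]) auto
  show "ae_eq 1 2 (W2 p) w2" by (rule l[OF _ _ _ _ a(6)]) auto
qed

text \<open>The Poincare inequality for \<open>p - w\<close>, whose second derivative lives on (-1,
  1). The constant is \<open>2 * 256 * 2\<close>: the outer factors come from
  \<open>(f + g)\<^sup>2 \<le> 2 * f\<^sup>2 + 2 * g\<^sup>2\<close>, once for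
  \<open>p = r + w\<close> and once for \<kappa>.\<close>

lemma admissible_p_bound:
  assumes "(v, p) \<in> admissible w"
  shows "sqnorm (-2) 2 p \<le> (2 * sqnorm (-2) 2 w
    + 1024 * sqnorm (-2) 2 w2) + 1024 * sqnorm (-1) 1 (W2 p)"
proof -
  note a = admissible_D[OF assms] and o = admissible_outside[OF assms] and L = admissible_L2[OF assms]
  define r where "r x = p x - w x" for x
  define \<kappa> where "\<kappa> x = W2 p x - w2 x" for x
  have r: "r \<in> L2 (-2) 2" unfolding r_def[abs_def] by (rule L2_diff[OF L(2) w_L2])
  have \<kappa>: "\<kappa> \<in> L2 (-2) 2" unfolding \<kappa>_def[abs_def] by (rule L2_diff[OF L(4) w2_L2])
  have z: "ae_eq (-2) (-1) \<kappa> (\<lambda>x. 0)" "ae_eq 1 2 \<kappa> (\<lambda>x. 0)" "ae_eq (-2) (-1) r (\<lambda>x. 0)"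
    using o(3,4) a(5) unfolding ae_eq_def \<kappa>_def r_def by simp_all
  have "sqnorm (-2) 2 r \<le> 256 * sqnorm (-2) 2 \<kappa>"
  proof (rule poincare[OF r \<kappa> _ z(3,1)])
    fix \<phi> assume \<phi>: "\<phi> \<in> test_funs (-2) 2"
    note dd = test_funs_deriv[OF test_funs_deriv[OF \<phi>]]
    show "pairing (-2) 2 r (deriv (deriv \<phi>)) = pairing (-2) 2 \<kappa> \<phi>"
      unfolding r_def \<kappa>_def integral_test_diff[OF L2_integrable[OF L(2)] L2_integrable[OF w_L2] dd]
        integral_test_diff[OF L2_integrable[OF L(4)] L2_integrable[OF w2_L2] \<phi>]
      using admissible_p_weak[OF assms \<phi>] w_weak[OF \<phi>] by simp
  qed
  also have "sqnorm (-2) 2 \<kappa> \<le> sqnorm (-1) 1 \<kappa>"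
    using L2_sq_split[OF \<kappa> _ z(1,2)] L2_continuous[of "-2" 2 "\<lambda>_. 0"] by simp
  also have "\<dots> \<le> 2 * sqnorm (-1) 1 (W2 p) + 2 * sqnorm (-1) 1 w2"
    using L2_sq_add_le[OF L2_mono[OF L(4)] L2_mono[OF L2_cmult[OF w2_L2, of "-1"]], of "-1" 1] by (simp add: \<kappa>_def)
  also have "sqnorm (-1) 1 w2 \<le> sqnorm (-2) 2 w2"
    by (rule L2_sq_mono[OF w2_L2]) auto
  finally have "sqnorm (-2) 2 r \<le> 256 * (2 * sqnorm (-1) 1 (W2 p)
      + 2 * sqnorm (-2) 2 w2)" by simp
  moreover have "sqnorm (-2) 2 p
      \<le> 2 * sqnorm (-2) 2 r + 2 * sqnorm (-2) 2 w"
    using L2_sq_add_le[OF r w_L2] by (simp add: r_def)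
  ultimately show ?thesis by argo
qed

end

section \<open>Coercivity on admissible pairs\<close>

locale relaxed_problem = boundary_datum +
  fixes \<alpha> \<beta> \<eta> \<mu> \<gamma> :: real and f\<^sub>r f\<^sub>p :: "real \<Rightarrow> real"
  assumes pos: "\<eta> > 0" "\<mu> > 0" "\<gamma> > 0" and f_L2: "f\<^sub>r \<in> L2 (-1) 1" "f\<^sub>p \<in> L2 (-1) 1"
    and ab: "0 < \<beta>" "\<beta> \<le> \<alpha>" "\<alpha> \<le> 2 * \<beta>"
begin

abbreviation en where "en v p \<equiv> energy \<eta> \<mu> \<gamma> f\<^sub>r f\<^sub>p v p (D2 v) (W2 p)"

definition val where
  "val v p = \<alpha> * real (card (jumps v)) + \<beta> * real (card (kinks v - jumps v)) + en v p"

lemma F1_val: "(v, p) \<in> admissible w \<Longrightarrow> F1 \<alpha> \<beta> \<eta> \<mu> \<gamma> f\<^sub>r f\<^sub>p v p = ereal (val v p)"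
  unfolding val_def by (rule F1_eq) (erule admissible_finite)+

text \<open>The Poincare inequality pays for the negative \<delta> term of
  \<open>energy_coercive\<close> with half of the \<gamma> term; \<open>C\<close> gathers the norms
  of the data.\<close>

lemma energy_lower_bound:
  obtains C where "\<And>v p. (v, p) \<in> admissible w \<Longrightarrow>
    \<eta> * sqnorm (-1) 1 (D2 v) + \<mu> / 2 * (\<integral>x. (v x - p x)\<^sup>2 \<partial>leb (-1) 1)
    + \<gamma> / 2 * sqnorm (-1) 1 (W2 p) - C \<le> en v p"
proof -
  \<comment> \<open>chosen so that \<open>\<delta>\<close> times the constant \<open>1024\<close> in the bound of \<open>p\<close> by \<open>W2 p\<close> is \<open>\<gamma> / 2\<close>\<close>
  define \<delta> where "\<delta> = \<gamma> / 2048"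
  have \<delta>: "\<delta> > 0" using pos by (simp add: \<delta>_def)
  define c0 where "c0 = 2 * sqnorm (-2) 2 w + 1024 * sqnorm (-2) 2 w2"
  define C1 where "C1 = sqnorm (-1) 1 (f\<^sub>r) / (2 * \<mu>) + (\<integral>x. (f\<^sub>r x + f\<^sub>p x)\<^sup>2 \<partial>leb (-1) 1) / (4 * \<delta>)"
  show ?thesis
  proof (rule that[of "\<delta> * c0 + C1"])
    fix v p assume vp: "(v, p) \<in> admissible w"
    note L = admissible_L2[OF vp]
    have LJ: "f \<in> L2 (-1) 1" if "f \<in> L2 (-2) 2" for f by (rule L2_mono[OF that]) auto
    have "sqnorm (-1) 1 p \<le> sqnorm (-2) 2 p"
      by (rule L2_sq_mono[OF L(2)]) auto
    also have "\<dots> \<le> c0 + 1024 * sqnorm (-1) 1 (W2 p)"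
      using admissible_p_bound[OF vp] by (simp add: c0_def)
    finally have "\<delta> * sqnorm (-1) 1 p \<le> \<delta> * (c0 + 1024 * sqnorm (-1) 1 (W2 p))"
      using \<delta> by simp
    also have "\<dots> = \<delta> * c0 + \<gamma> / 2 * sqnorm (-1) 1 (W2 p)"
      by (simp add: \<delta>_def algebra_simps)
    finally show "\<eta> * sqnorm (-1) 1 (D2 v) + \<mu> / 2 * (\<integral>x. (v x - p x)\<^sup>2 \<partial>leb (-1) 1)
      + \<gamma> / 2 * sqnorm (-1) 1 (W2 p) - (\<delta> * c0 + C1) \<le> en v p"
      using energy_coercive[OF f_L2 LJ[OF L(1)] LJ[OF L(2)] LJ[OF L(3)] LJ[OF L(4)] pos(2) \<delta>, of \<eta> \<gamma>]
      unfolding C1_def[symmetric] by argo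
  qed
qed

lemma sq_int_nonneg: "0 \<le> (\<integral>x. (f x)\<^sup>2 \<partial>M)" for f :: "'a \<Rightarrow> real"
  by (rule Bochner_Integration.integral_nonneg) simp

lemma energy_bounded_below: "\<exists>C. \<forall>v p. (v, p) \<in> admissible w \<longrightarrow> - C \<le> en v p"
proof -
  obtain C where C: "\<And>v p. (v, p) \<in> admissible w \<Longrightarrow>
    \<eta> * sqnorm (-1) 1 (D2 v) + \<mu> / 2 * (\<integral>x. (v x - p x)\<^sup>2 \<partial>leb (-1) 1)
    + \<gamma> / 2 * sqnorm (-1) 1 (W2 p) - C \<le> en v p"
    using energy_lower_bound by blast
  have "- C \<le> en v p" if "(v, p) \<in> admissible w" for v p
  proof -
    have "0 \<le> \<eta> * sqnorm (-1) 1 (D2 v)" "0 \<le> \<mu> / 2 * (\<integral>x. (v x - p x)\<^sup>2 \<partial>leb (-1) 1)"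
      "0 \<le> \<gamma> / 2 * sqnorm (-1) 1 (W2 p)"
      by (intro mult_nonneg_nonneg sq_int_nonneg; use pos in simp)+
    then show ?thesis using C[OF that] by linarith
  qed
  then show ?thesis by blast
qed

text \<open>\<open>p\<close> is bounded through its second derivative. For \<open>v\<close> this
  fails, since jumps and creases are free, so \<open>v\<close> is bounded through
  \<open>v - p\<close> and \<open>p\<close>. On the outer intervals everything equals the
  datum.\<close>

lemma energy_bounds_norms:
  "\<exists>K. \<forall>v p. (v, p) \<in> admissible w \<longrightarrow> en v p \<le> B \<longrightarrow>
    sqnorm (-2) 2 v \<le> K \<and> sqnorm (-2) 2 p \<le> K \<and>
    sqnorm (-2) 2 (D2 v) \<le> K \<and> sqnorm (-2) 2 (W2 p) \<le> K"
proof -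
  obtain C where C: "\<And>v p. (v, p) \<in> admissible w \<Longrightarrow>
    \<eta> * sqnorm (-1) 1 (D2 v) + \<mu> / 2 * (\<integral>x. (v x - p x)\<^sup>2 \<partial>leb (-1) 1)
    + \<gamma> / 2 * sqnorm (-1) 1 (W2 p) - C \<le> en v p"
    using energy_lower_bound by blast
  define nw where "nw = sqnorm (-2) 2 w"
  define nw2 where "nw2 = sqnorm (-2) 2 w2"
  define X0 where "X0 = (B + C) / \<eta>"
  define Y0 where "Y0 = (B + C) / (\<mu> / 2)"
  define Z0 where "Z0 = (B + C) / (\<gamma> / 2)"
  define P0 where "P0 = 2 * nw + 1024 * nw2 + 1024 * Z0"
  \<comment> \<open>The absolute values make the sum dominate each of the four bounds whatever the
    sign of the others.\<close>
  define K where "K = \<bar>X0 + nw2\<bar> + \<bar>Z0 + nw2\<bar> + \<bar>P0\<bar> + \<bar>2 * Y0 + 2 * P0 + nw\<bar>"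
  have "sqnorm (-2) 2 v \<le> K \<and> sqnorm (-2) 2 p \<le> K \<and>
    sqnorm (-2) 2 (D2 v) \<le> K \<and> sqnorm (-2) 2 (W2 p) \<le> K"
    if vp: "(v, p) \<in> admissible w" and B: "en v p \<le> B" for v p
  proof -
    note a = admissible_D[OF vp] and o = admissible_outside[OF vp] and L = admissible_L2[OF vp]
    define X where "X = sqnorm (-1) 1 (D2 v)"
    define Y where "Y = (\<integral>x. (v x - p x)\<^sup>2 \<partial>leb (-1) 1)"
    define Z where "Z = sqnorm (-1) 1 (W2 p)"
    have nn: "0 \<le> \<eta> * X" "0 \<le> \<mu> / 2 * Y" "0 \<le> \<gamma> / 2 * Z"
      unfolding X_def Y_def Z_def by (intro mult_nonneg_nonneg sq_int_nonneg; use pos in simp)+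
    have s: "\<eta> * X + \<mu> / 2 * Y + \<gamma> / 2 * Z \<le> B + C"
      using C[OF vp] B unfolding X_def Y_def Z_def by linarith
    have "\<eta> * X \<le> B + C" "\<mu> / 2 * Y \<le> B + C" "\<gamma> / 2 * Z \<le> B + C" using s nn by linarith+
    then have X: "X \<le> X0" and Y: "Y \<le> Y0" and Z: "Z \<le> Z0"
      using pos unfolding X0_def Y0_def Z0_def by (simp_all add: field_simps)
    have h: "sqnorm (-2) 2 (D2 v) \<le> X + nw2"
      unfolding X_def nw2_def by (rule L2_sq_split[OF L(3) w2_L2 o(1,2)])
    have q: "sqnorm (-2) 2 (W2 p) \<le> Z + nw2"
      unfolding Z_def nw2_def by (rule L2_sq_split[OF L(4) w2_L2 o(3,4)])
    have pp: "sqnorm (-2) 2 p \<le> P0"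
      using admissible_p_bound[OF vp] Z unfolding P0_def nw_def nw2_def Z_def by linarith
    have pJ: "sqnorm (-1) 1 p \<le> sqnorm (-2) 2 p"
      by (rule L2_sq_mono[OF L(2)]) auto
    have "sqnorm (-1) 1 v \<le> 2 * Y + 2 * sqnorm (-1) 1 p"
      using L2_sq_add_le[OF L2_mono[OF L2_diff[OF L(1,2)]] L2_mono[OF L(2)], of "-1" 1] by (simp add: Y_def)
    moreover have "sqnorm (-2) 2 v \<le> sqnorm (-1) 1 v + nw"
      unfolding nw_def by (rule L2_sq_split[OF L(1) w_L2 a(3,4)])
    ultimately have "sqnorm (-2) 2 v \<le> 2 * Y0 + 2 * P0 + nw" using pJ pp Y by linarith
    then show ?thesis using h q pp X Z unfolding K_def by linarith
  qed
  then show ?thesis by blast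
qed

end


subsection \<open>Minimizing sequences\<close>

lemma common_subsequence:
  fixes f :: "nat \<Rightarrow> nat \<Rightarrow> real"
  assumes "\<And>i k. i < N \<Longrightarrow> f k i \<in> {-1..1}"
  shows "\<exists>r l. strict_mono r \<and> (\<forall>i<N. l i \<in> {-1..1} \<and> (\<lambda>k. f (r k) i) \<longlonglongrightarrow> l i)"
  using assms
proof (induction N)
  case 0
  then show ?case by (intro exI[of _ id]) (simp add: strict_mono_def)
next
  case (Suc N)
  obtain r l where r: "strict_mono r" and l: "\<And>i. i < N \<Longrightarrow> l i \<in> {-1..1} \<and> (\<lambda>k. f (r k) i) \<longlonglongrightarrow> l i"
    using Suc.IH Suc.prems less_SucI by metis
  have "seq_compact {-1..1::real}" using compact_imp_seq_compact[OF compact_Icc] .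
  then obtain l' r' where l': "l' \<in> {-1..1}" "strict_mono r'" "((\<lambda>k. f (r k) N) \<circ> r') \<longlonglongrightarrow> l'"
    using seq_compactE[of "{-1..1}" "\<lambda>k. f (r k) N"] Suc.prems[of N] by blast
  show ?case
  proof (intro exI conjI allI impI)
    show "strict_mono (r \<circ> r')" by (rule strict_mono_o[OF r l'(2)])
    fix i assume "i < Suc N"
    then consider "i = N" | "i < N" by linarith
    then show "(l(N := l')) i \<in> {-1..1}" using l l'(1) by cases auto
    show "(\<lambda>k. f ((r \<circ> r') k) i) \<longlonglongrightarrow> (l(N := l')) i"
    proof (cases "i = N")
      case True
      then show ?thesis using l'(3) by (simp add: o_def)
    next
      case False
      then have "(\<lambda>k. f (r k) i) \<longlonglongrightarrow> l i" using l \<open>i < Suc N\<close> by simp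
      from LIMSEQ_subseq_LIMSEQ[OF this l'(2)] show ?thesis using False by (simp add: o_def)
    qed
  qed
qed

text \<open>Labelling jumps before creases lets the index alone tell the type of a point, uniformly
  along the sequence.\<close>

lemma enumerate_two:
  assumes "finite A" "finite B"
  shows "\<exists>g::nat \<Rightarrow> 'a. g ` {..<card A} = A \<and> g ` {card A..<card A + card B} = B"
proof -
  obtain h1 where h1: "bij_betw h1 {0..<card A} A" using ex_bij_betw_nat_finite[OF assms(1)] by blast
  obtain h2 where h2: "bij_betw h2 {0..<card B} B" using ex_bij_betw_nat_finite[OF assms(2)] by blast
  define g where "g i = (if i < card A then h1 i else h2 (i - card A))" for i
  have "g ` {..<card A} = h1 ` {0..<card A}" by (rule image_cong) (auto simp: g_def)
  moreover have "g ` {card A..<card A + card B} = h2 ` {0..<card B}"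
  proof -
    have "{card A..<card A + card B} = (\<lambda>i. i + card A) ` {0..<card B}"
      by (simp add: image_add_atLeastLessThan' add.commute)
    then show ?thesis by (simp only: image_image) (simp add: g_def)
  qed
  ultimately show ?thesis using h1 h2 unfolding bij_betw_def by metis
qed

text \<open>
  Each limit point pays for itself with the weights of the points converging to it: a jump of the
  limit is fed by a jump or, as \<open>\<alpha> \<le> 2 * \<beta>\<close>, by two creases.
\<close>

lemma weighted_count_le:
  fixes l :: "nat \<Rightarrow> 'a" and \<alpha> \<beta> :: real
  assumes D: "D \<subseteq> l ` {..<a + b}" "D' \<subseteq> l ` {..<a + b}" and ab: "0 < \<beta>" "\<beta> \<le> \<alpha>" "\<alpha> \<le> 2 * \<beta>"
    and single: "\<And>x i. x \<in> D \<Longrightarrow> a \<le> i \<Longrightarrow> i < a + b \<Longrightarrow> {k \<in> {..<a + b}. l k = x} \<noteq> {i}"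
  shows "\<alpha> * real (card D) + \<beta> * real (card (D' - D)) \<le> \<alpha> * real a + \<beta> * real b"
proof -
  let ?P = "l ` {..<a + b}"
  define \<omega> where "\<omega> i = (if i < a then \<alpha> else \<beta>)" for i
  define cost where "cost x = (if x \<in> D then \<alpha> else 0) + (if x \<in> D' - D then \<beta> else 0)" for x
  have \<omega>: "\<beta> \<le> \<omega> i" "0 \<le> \<omega> i" for i using ab by (auto simp: \<omega>_def)
  have le: "cost x \<le> sum \<omega> {k \<in> {..<a + b}. l k = x}" if x: "x \<in> ?P" for x
  proof -
    let ?F = "{k \<in> {..<a + b}. l k = x}"
    have fin: "finite ?F" by simp
    obtain i where i: "i \<in> ?F" using x by auto
    have one: "\<omega> k \<le> sum \<omega> ?F" if "k \<in> ?F" for k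
      by (rule member_le_sum[OF that _ fin]) (rule \<omega>(2))
    show ?thesis
    proof (cases "x \<in> D")
      case False
      then have "cost x \<le> \<beta>" using ab by (simp add: cost_def)
      then show ?thesis using \<omega>(1)[of i] one[OF i] by linarith
    next
      case True
      then have c: "cost x = \<alpha>" by (simp add: cost_def)
      show ?thesis
      proof (cases "i < a")
        case True
        then show ?thesis using one[OF i] c by (simp add: \<omega>_def)
      next
        case False
        then have "?F \<noteq> {i}" using single[OF True, of i] i by simp
        then obtain i' where i': "i' \<in> ?F" "i' \<noteq> i" using i by blast
        have "sum \<omega> {i, i'} \<le> sum \<omega> ?F"
          by (rule sum_mono2[OF fin]) (use i i' \<omega>(2) in auto)
        moreover have "sum \<omega> {i, i'} = \<omega> i + \<omega> i'" using i'(2) by simp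
        ultimately show ?thesis using \<omega>(1)[of i] \<omega>(1)[of i'] c ab(3) by linarith
      qed
    qed
  qed
  have fP: "finite ?P" by simp
  have "sum cost ?P = \<alpha> * real (card D) + \<beta> * real (card (D' - D))"
  proof -
    have "(\<Sum>x\<in>?P. if x \<in> S then c else 0) = c * real (card S)" if "S \<subseteq> ?P" for S and c :: real
    proof -
      have "(\<Sum>x\<in>?P. if x \<in> S then c else 0) = (\<Sum>x\<in>?P \<inter> S. c)"
        by (rule sum.inter_restrict[OF fP, symmetric])
      also have "?P \<inter> S = S" using that by blast
      finally show ?thesis by simp
    qed
    moreover have "D' - D \<subseteq> ?P" using D(2) by blast
    ultimately show ?thesis using D(1) unfolding cost_def sum.distrib by metis
  qed
  moreover have "sum cost ?P \<le> (\<Sum>x\<in>?P. sum \<omega> {k \<in> {..<a + b}. l k = x})"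
    by (rule sum_mono) (rule le)
  moreover have "(\<Sum>x\<in>?P. sum \<omega> {k \<in> {..<a + b}. l k = x}) = sum \<omega> {..<a + b}"
    by (rule sum.image_gen[symmetric]) simp
  moreover have "sum \<omega> {..<a + b} = \<alpha> * real a + \<beta> * real b"
  proof (induction b)
    case 0
    have "sum \<omega> {..<a} = (\<Sum>i<a. \<alpha>)" by (rule sum.cong) (auto simp: \<omega>_def)
    then show ?case by simp
  next
    case (Suc b)
    then show ?case by (simp add: \<omega>_def algebra_simps)
  qed
  ultimately show ?thesis by linarith
qed

context relaxed_problem
begin

text \<open>Since the energy is bounded below and both weights are positive, the two counts are
  bounded along a minimizing sequence. The pigeonhole principle makes them constant, after which the
  labelled points form finitely many sequences in [-1, 1].\<close>

lemma minimizing_sequence: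
  assumes ne: "(v0, p0) \<in> admissible w"
  obtains v p :: "nat \<Rightarrow> real \<Rightarrow> real" and pts :: "nat \<Rightarrow> nat \<Rightarrow> real" and l :: "nat \<Rightarrow> real" and a b :: nat and m :: real
  where "\<And>k. (v k, p k) \<in> admissible w" "\<And>k. val (v k) (p k) \<le> m + inverse (real (Suc k))"
    "\<And>u q. (u, q) \<in> admissible w \<Longrightarrow> m \<le> val u q"
    "\<And>k. card (jumps (v k)) = a" "\<And>k. card (kinks (v k) - jumps (v k)) = b"
    "\<And>k. pts k ` {..<a} = jumps (v k)" "\<And>k. pts k ` {a..<a + b} = kinks (v k) - jumps (v k)"
    "\<And>i. i < a + b \<Longrightarrow> l i \<in> {-1..1}" "\<And>i. i < a + b \<Longrightarrow> (\<lambda>k. pts k i) \<longlonglongrightarrow> l i"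
proof -
  obtain C where C: "\<And>v p. (v, p) \<in> admissible w \<Longrightarrow> - C \<le> en v p" using energy_bounded_below by blast
  define Vals where "Vals = {val v p |v p. (v, p) \<in> admissible w}"
  have cnn: "0 \<le> \<alpha> * real n" "0 \<le> \<beta> * real n" for n :: nat using ab by auto
  have en_le: "en v p \<le> val v p" for v p unfolding val_def using cnn by simp
  have bb: "bdd_below Vals"
    unfolding Vals_def using C en_le by (intro bdd_belowI[of _ "- C"]) (force intro: order_trans)
  have nV: "Vals \<noteq> {}" unfolding Vals_def using ne by blast
  define m where "m = Inf Vals"
  have m_le: "m \<le> val u q" if "(u, q) \<in> admissible w" for u q
    unfolding m_def by (rule cInf_lower[OF _ bb]) (use that in \<open>auto simp: Vals_def\<close>)
  have "\<exists>u q. (u, q) \<in> admissible w \<and> val u q < m + inverse (real (Suc k))" for k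
  proof -
    have "Inf Vals < m + inverse (real (Suc k))" unfolding m_def by simp
    then obtain t where "t \<in> Vals" "t < m + inverse (real (Suc k))" using cInf_lessD[OF nV] by blast
    then show ?thesis unfolding Vals_def by blast
  qed
  then obtain v1 p1 where vp1: "\<And>k. (v1 k, p1 k) \<in> admissible w" "\<And>k. val (v1 k) (p1 k) < m + inverse (real (Suc k))"
    by metis
  \<comment> \<open>Values are below \<open>m + 1\<close> and energies at least \<open>- C\<close>,
    so the weighted count is at most \<open>m + 1 + C\<close>; as
    \<open>\<beta> \<le> \<alpha>\<close>, dividing by \<beta> bounds either count.\<close>
  define T where "T = (m + 1 + C) / \<beta>"
  define cnt where "cnt k = (card (jumps (v1 k)), card (kinks (v1 k) - jumps (v1 k)))" for k
  have "cnt k \<in> {..nat \<lceil>T\<rceil>} \<times> {..nat \<lceil>T\<rceil>}" for k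
  proof -
    let ?x = "real (card (jumps (v1 k)))" and ?y = "real (card (kinks (v1 k) - jumps (v1 k)))"
    have "inverse (real (Suc k)) \<le> 1" by (simp add: field_simps)
    then have s: "\<alpha> * ?x + \<beta> * ?y \<le> m + 1 + C"
      using vp1(2)[of k] C[OF vp1(1)[of k]] unfolding val_def by linarith
    have "\<beta> * ?x \<le> \<alpha> * ?x" using ab by (intro mult_right_mono) auto
    then have "\<beta> * ?x \<le> m + 1 + C" "\<beta> * ?y \<le> m + 1 + C" using s cnn by (smt (verit))+
    then have "?x \<le> T" "?y \<le> T" unfolding T_def using ab(1) by (simp_all add: field_simps)
    then have "?x \<le> real (nat \<lceil>T\<rceil>)" "?y \<le> real (nat \<lceil>T\<rceil>)" using real_nat_ceiling_ge[of T] by linarith+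
    then show ?thesis unfolding cnt_def by simp
  qed
  then have "range cnt \<subseteq> {..nat \<lceil>T\<rceil>} \<times> {..nat \<lceil>T\<rceil>}" by (rule image_subsetI)
  then have "finite (range cnt)" by (rule finite_subset) simp
  \<comment> \<open>Finitely many pairs of counts for infinitely many indices.\<close>
  then obtain k0 where k0: "infinite {k \<in> UNIV. cnt k = cnt k0}"
    using pigeonhole_infinite[of "UNIV :: nat set" cnt] by auto
  define r1 where "r1 = enumerate {k \<in> UNIV. cnt k = cnt k0}"
  have r1: "strict_mono r1" unfolding r1_def by (rule strict_mono_enumerate[OF k0])
  have c1: "cnt (r1 k) = cnt k0" for k
    using enumerate_in_set[OF k0, of k] unfolding r1_def by simp
  define a where "a = fst (cnt k0)"
  define b where "b = snd (cnt k0)"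
  have card1: "card (jumps (v1 (r1 k))) = a" "card (kinks (v1 (r1 k)) - jumps (v1 (r1 k))) = b" for k
    using c1[of k] unfolding a_def b_def cnt_def by auto
  have "\<exists>g. g ` {..<a} = jumps (v1 (r1 k)) \<and> g ` {a..<a + b} = kinks (v1 (r1 k)) - jumps (v1 (r1 k))" for k
    using enumerate_two[of "jumps (v1 (r1 k))" "kinks (v1 (r1 k)) - jumps (v1 (r1 k))"]
      admissible_finite[OF vp1(1)] unfolding card1 by blast
  then obtain pt where pt: "\<And>k. pt k ` {..<a} = jumps (v1 (r1 k))"
    "\<And>k. pt k ` {a..<a + b} = kinks (v1 (r1 k)) - jumps (v1 (r1 k))" by metis
  have "pt k i \<in> {-1..1}" if "i < a + b" for i k
  proof -
    have "pt k i \<in> pt k ` {..<a} \<union> pt k ` {a..<a + b}" using that by (cases "i < a") auto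
    then show ?thesis using admissible_disc[OF vp1(1)] unfolding pt by blast
  qed
  then obtain r2 l where r2: "strict_mono r2"
    and l: "\<And>i. i < a + b \<Longrightarrow> l i \<in> {-1..1} \<and> (\<lambda>k. pt (r2 k) i) \<longlonglongrightarrow> l i"
    using common_subsequence[of "a + b" pt] by blast
  define r where "r k = r1 (r2 k)" for k
  \<comment> \<open>Subsequences only run ahead, so the rate \<open>inverse (real (Suc k))\<close>
    is kept.\<close>
  have rk: "k \<le> r k" for k
    unfolding r_def using seq_suble[OF r1, of "r2 k"] seq_suble[OF r2, of k] by linarith
  show ?thesis
  proof (rule that[of "\<lambda>k. v1 (r k)" "\<lambda>k. p1 (r k)" m a b "\<lambda>k. pt (r2 k)" l])
    show "val (v1 (r k)) (p1 (r k)) \<le> m + inverse (real (Suc k))" for k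
    proof -
      have "inverse (real (Suc (r k))) \<le> inverse (real (Suc k))" by (rule le_imp_inverse_le) (use rk in auto)
      then show ?thesis using vp1(2)[of "r k"] by linarith
    qed
  qed (use vp1(1) m_le card1 pt l in \<open>auto simp: r_def\<close>)
qed

end


subsection \<open>Existence of a minimizer\<close>

text \<open>A closed interval strictly inside (c, d) stays away from limit points at
  \<open>c\<close> or \<open>d\<close> too, so that points converging to them eventually leave the
  support.\<close>

lemma test_support_closed:
  assumes "\<phi> \<in> test_funs c d"
  obtains c' d' where "c < c'" "d' < d" "\<And>x. x \<notin> {c'..d'} \<Longrightarrow> \<phi> x = 0 \<and> deriv \<phi> x = 0"
proof -
  obtain c' d' where cd: "c < c'" "d' < d" and z: "\<And>x. \<phi> x \<noteq> 0 \<Longrightarrow> c' \<le> x \<and> x \<le> d'"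
    using assms unfolding test_funs_iff by blast
  have z': "\<phi> x = 0" if "x \<notin> {c'..d'}" for x using z[of x] that by auto
  have "deriv \<phi> x = 0" if "x \<notin> {c'..d'}" for x by (rule deriv_zero_outside[OF z' that])
  then show ?thesis using that[OF cd] z' by blast
qed

lemma L2_pairing_bound:
  assumes f: "f \<in> L2 a b" and g: "g \<in> L2 a b"
  shows "\<bar>\<integral>x. f x * g x \<partial>leb a b\<bar> \<le> sqnorm a b f + sqnorm a b g"
proof -
  have "\<bar>\<integral>x. f x * g x \<partial>leb a b\<bar> \<le> (\<integral>x. \<bar>f x * g x\<bar> \<partial>leb a b)"
    by (rule integral_abs_bound)
  also have "\<dots> \<le> (\<integral>x. (f x)\<^sup>2 + (g x)\<^sup>2 \<partial>leb a b)"
  proof (rule integral_mono)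
    show "integrable (leb a b) (\<lambda>x. \<bar>f x * g x\<bar>)" using L2_mult_integrable[OF f g] by simp
    show "integrable (leb a b) (\<lambda>x. (f x)\<^sup>2 + (g x)\<^sup>2)"
      using L2_sq_integrable[OF f] L2_sq_integrable[OF g] by simp
    fix x
    have "2 * (\<bar>f x\<bar> * \<bar>g x\<bar>) \<le> (f x)\<^sup>2 + (g x)\<^sup>2" using sum_squares_bound[of "\<bar>f x\<bar>" "\<bar>g x\<bar>"] by simp
    moreover have "0 \<le> \<bar>f x\<bar> * \<bar>g x\<bar>" by simp
    ultimately show "\<bar>f x * g x\<bar> \<le> (f x)\<^sup>2 + (g x)\<^sup>2" unfolding abs_mult by linarith
  qed
  also have "\<dots> = sqnorm a b f + sqnorm a b g"
    using L2_sq_integrable[OF f] L2_sq_integrable[OF g] by simp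
  finally show ?thesis .
qed

lemma isolate_point:
  fixes x :: real
  assumes "finite S" "x \<in> {-1..1}"
  obtains c d where "-2 < c" "c < x" "x < d" "d < 2" "\<And>y. y \<in> S \<Longrightarrow> y \<noteq> x \<Longrightarrow> y \<notin> {c..d}"
proof -
  obtain e where e: "e > 0" "\<And>y. y \<in> S \<Longrightarrow> y \<noteq> x \<Longrightarrow> e \<le> dist x y"
    using finite_set_avoid[OF assms(1), of x] by auto
  define t where "t = min (e / 2) (1 / 2)"
  have t: "0 < t" "t < e" "t \<le> 1 / 2" using e(1) by (auto simp: t_def min_def)
  show ?thesis
  proof (rule that[of "x - t" "x + t"])
    show "y \<notin> {x - t..x + t}" if "y \<in> S" "y \<noteq> x" for y
      using e(2)[OF that] t(2) by (auto simp: dist_real_def)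
  qed (use t assms(2) in auto)
qed

context relaxed_problem
begin

lemma minimizer_exists:
  assumes ne: "(w, w) \<in> admissible w"
  shows "\<exists>V P. (V, P) \<in> admissible w \<and> (\<forall>u q. (u, q) \<in> admissible w \<longrightarrow> val V P \<le> val u q)"
proof -
  let ?M = "leb (-2) 2"
  obtain v p :: "nat \<Rightarrow> real \<Rightarrow> real" and pts :: "nat \<Rightarrow> nat \<Rightarrow> real" and l :: "nat \<Rightarrow> real" and a b :: nat and m :: real
    where vp: "\<And>k. (v k, p k) \<in> admissible w" and vm: "\<And>k. val (v k) (p k) \<le> m + inverse (real (Suc k))"
    and m_le: "\<And>u q. (u, q) \<in> admissible w \<Longrightarrow> m \<le> val u q"
    and card: "\<And>k. card (jumps (v k)) = a" "\<And>k. card (kinks (v k) - jumps (v k)) = b"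
    and pts: "\<And>k. pts k ` {..<a} = jumps (v k)" "\<And>k. pts k ` {a..<a + b} = kinks (v k) - jumps (v k)"
    and l1: "\<And>i. i < a + b \<Longrightarrow> l i \<in> {-1..1}" and lim: "\<And>i. i < a + b \<Longrightarrow> (\<lambda>k. pts k i) \<longlonglongrightarrow> l i"
    by (rule minimizing_sequence[OF ne]) blast
  define N where "N = \<alpha> * real a + \<beta> * real b"
  \<comment> \<open>The counts are the same for all \<open>k\<close>, so the energies alone converge
    to \<open>m - N\<close>, and comparing counts with \<open>N\<close> is postponed to the
    end.\<close>
  have en_val: "en (v k) (p k) = val (v k) (p k) - N" for k
    unfolding val_def card N_def by simp
  have inv1: "inverse (real (Suc k)) \<le> 1" for k by (simp add: field_simps)
  obtain K where K: "\<And>u q. (u, q) \<in> admissible w \<Longrightarrow> en u q \<le> m + 1 - N \<Longrightarrow>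
    (sqnorm (-2) 2 u) \<le> K \<and> sqnorm (-2) 2 q \<le> K \<and> sqnorm (-2) 2 (D2 u) \<le> K \<and> sqnorm (-2) 2 (W2 q) \<le> K"
    using energy_bounds_norms[of "m + 1 - N"] by blast
  have "en (v k) (p k) \<le> m + 1 - N" for k using vm[of k] inv1[of k] en_val[of k] by linarith
  then have bd: "sqnorm (-2) 2 (v k) \<le> K" "sqnorm (-2) 2 (p k) \<le> K" "sqnorm (-2) 2 (D2 (v k)) \<le> K" "sqnorm (-2) 2 (W2 (p k)) \<le> K" for k
    using K[OF vp] by blast+
  note L2k = admissible_L2[OF vp]
  obtain V P H Q where VL: "V \<in> L2 (-2) 2" and PL: "P \<in> L2 (-2) 2" and HL: "H \<in> L2 (-2) 2" and QL: "Q \<in> L2 (-2) 2" and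
    CL: "\<And>A B C D c. A \<in> L2 (-2) 2 \<Longrightarrow> B \<in> L2 (-2) 2 \<Longrightarrow> C \<in> L2 (-2) 2 \<Longrightarrow> D \<in> L2 (-2) 2 \<Longrightarrow>
      eventually (\<lambda>k. (pairing (-2) 2 (v k) A) + pairing (-2) 2 (p k) B
        + pairing (-2) 2 (D2 (v k)) C + pairing (-2) 2 (W2 (p k)) D \<le> c) sequentially \<Longrightarrow>
      (pairing (-2) 2 V A) + pairing (-2) 2 P B + pairing (-2) 2 H C + pairing (-2) 2 Q D \<le> c"
    by (rule L2_weak_cluster4[of v "-2" 2 p "\<lambda>k. D2 (v k)" "\<lambda>k. W2 (p k)" K, OF L2k bd]) blast
  have zero: "(\<lambda>_. 0) \<in> L2 (-2) 2" by (rule L2_continuous) simp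
  have AC: "pairing (-2) 2 V A + pairing (-2) 2 H C \<le> c"
    if "A \<in> L2 (-2) 2" "C \<in> L2 (-2) 2" "eventually (\<lambda>k. (pairing (-2) 2 (v k) A) + pairing (-2) 2 (D2 (v k)) C \<le> c) sequentially" for A C c
    using CL[OF that(1) zero that(2) zero, of c] that(3) by simp
  have AB: "pairing (-2) 2 V A + pairing (-2) 2 P B \<le> c"
    if "A \<in> L2 (-2) 2" "B \<in> L2 (-2) 2" "eventually (\<lambda>k. (pairing (-2) 2 (v k) A) + pairing (-2) 2 (p k) B \<le> c) sequentially" for A B c
    using CL[OF that(1,2) zero zero, of c] that(3) by simp
  have BD: "pairing (-2) 2 P B + pairing (-2) 2 Q D \<le> c"
    if "B \<in> L2 (-2) 2" "D \<in> L2 (-2) 2" "eventually (\<lambda>k. (pairing (-2) 2 (p k) B) + pairing (-2) 2 (W2 (p k)) D \<le> c) sequentially" for B D c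
    using CL[OF zero that(1) zero that(2), of c] that(3) by simp
  have neg: "(\<lambda>x. - f x) \<in> L2 (-2) 2" if "f \<in> L2 (-2) 2" for f
    using L2_cmult[OF that, of "-1"] by simp
  \<comment> \<open>The cluster property is one-sided; applying it with both signs gives a bound on
    the absolute value, and for \<open>c = 0\<close> an equation.\<close>
  have ACabs: "\<bar>pairing (-2) 2 V A - (pairing (-2) 2 H C)\<bar> \<le> c"
    if A: "A \<in> L2 (-2) 2" and C: "C \<in> L2 (-2) 2"
      and ev: "eventually (\<lambda>k. \<bar>pairing (-2) 2 (v k) A - (pairing (-2) 2 (D2 (v k)) C)\<bar> \<le> c) sequentially" for A C c
  proof -
    have "eventually (\<lambda>k. (pairing (-2) 2 (v k) A) + (\<integral>x. D2 (v k) x * - C x \<partial>?M) \<le> c) sequentially"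
      using ev by eventually_elim simp
    from AC[OF A neg[OF C] this] have 1: "pairing (-2) 2 V A - pairing (-2) 2 H C \<le> c" by simp
    have "eventually (\<lambda>k. (\<integral>x. v k x * - A x \<partial>?M) + pairing (-2) 2 (D2 (v k)) C \<le> c) sequentially"
      using ev by eventually_elim simp
    from AC[OF neg[OF A] C this] have 2: "pairing (-2) 2 H C - pairing (-2) 2 V A \<le> c" by simp
    show ?thesis using 1 2 by linarith
  qed
  \<comment> \<open>Agreement with \<open>w\<close> on (c, d) means equality of integrals against
    every cut-off L^2 function, that is, two linear inequalities for each of them.\<close>
  have Vout: "ae_eq c d V w" if sub: "-2 \<le> c" "d \<le> 2" and e: "\<And>k. ae_eq c d (v k) w" for c d
  proof (rule L2_eq_of_pairing[OF VL w_L2 sub])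
    fix A assume A: "A \<in> L2 (-2) 2"
    have cA: "cut c d A \<in> L2 (-2) 2" by (rule cut_L2[OF L2_mono[OF A sub] sub])
    have k: "pairing (-2) 2 (v k) (cut c d A) = pairing (-2) 2 w (cut c d A)" for k
      unfolding integral_cut_mult[OF sub]
    proof (rule integral_interval_AE)
      show "(\<lambda>x. v k x * A x) \<in> borel_measurable (leb c d)"
        by (intro borel_measurable_times L2_measurable L2_mono[OF L2k(1) sub] L2_mono[OF A sub])
      show "AE x in leb c d. v k x * A x = w x * A x"
        using e[of k] unfolding ae_eq_def by eventually_elim simp
    qed
    show "pairing (-2) 2 V (cut c d A) = pairing (-2) 2 w (cut c d A)"
      using AB[OF cA zero, of "\<integral>x. w x * cut c d A x \<partial>?M"] AB[OF neg[OF cA] zero, of "- pairing (-2) 2 w (cut c d A)"] k by simp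
  qed
  have Pout: "ae_eq c d P w" if sub: "-2 \<le> c" "d \<le> 2" and e: "\<And>k. ae_eq c d (p k) w" for c d
  proof (rule L2_eq_of_pairing[OF PL w_L2 sub])
    fix A assume A: "A \<in> L2 (-2) 2"
    have cA: "cut c d A \<in> L2 (-2) 2" by (rule cut_L2[OF L2_mono[OF A sub] sub])
    have k: "pairing (-2) 2 (p k) (cut c d A) = pairing (-2) 2 w (cut c d A)" for k
      unfolding integral_cut_mult[OF sub]
    proof (rule integral_interval_AE)
      show "(\<lambda>x. p k x * A x) \<in> borel_measurable (leb c d)"
        by (intro borel_measurable_times L2_measurable L2_mono[OF L2k(2) sub] L2_mono[OF A sub])
      show "AE x in leb c d. p k x * A x = w x * A x"
        using e[of k] unfolding ae_eq_def by eventually_elim simp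
    qed
    show "pairing (-2) 2 P (cut c d A) = pairing (-2) 2 w (cut c d A)"
      using AB[OF zero cA, of "\<integral>x. w x * cut c d A x \<partial>?M"] AB[OF zero neg[OF cA], of "- pairing (-2) 2 w (cut c d A)"] k by simp
  qed
  have out: "ae_eq (-2) (-1) V w" "ae_eq 1 2 V w" "ae_eq (-2) (-1) P w" "ae_eq 1 2 P w"
    using admissible_D[OF vp] by (auto intro!: Vout Pout)
  \<comment> \<open>The test function is built from the limits themselves and is fixed along the
    sequence, so the a.e. inequalities for \<open>p k\<close> and \<open>v k\<close> give one linear
    inequality that passes to the limit.\<close>
  have PV: "AE x in ?M. P x \<le> V x"
  proof (rule L2_le_of_pairing[OF PL VL])
    define g where "g x = max 0 (P x - V x)" for x
    have g: "g \<in> L2 (-2) 2" unfolding g_def[abs_def] by (rule L2_pos_part[OF L2_diff[OF PL VL]])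
    have "(\<integral>x. v k x * - g x \<partial>?M) + pairing (-2) 2 (p k) g \<le> 0" for k
    proof -
      have "pairing (-2) 2 (p k) g \<le> pairing (-2) 2 (v k) g"
      proof (rule integral_mono_AE[OF L2_mult_integrable[OF L2k(2) g] L2_mult_integrable[OF L2k(1) g]])
        show "AE x in ?M. p k x * g x \<le> v k x * g x"
          using admissible_le[OF vp[of k]] by eventually_elim (simp add: g_def mult_right_mono)
      qed
      then show ?thesis by simp
    qed
    then have "(\<integral>x. V x * - g x \<partial>?M) + pairing (-2) 2 P g \<le> 0" by (intro AB[OF neg[OF g] g]) simp
    then show "(\<integral>x. P x * max 0 (P x - V x) \<partial>?M) \<le> (\<integral>x. V x * max 0 (P x - V x) \<partial>?M)"
      by (simp add: g_def)
  qed
  have PQ: "pairing (-2) 2 P (deriv (deriv \<phi>)) = pairing (-2) 2 Q \<phi>" if \<phi>: "\<phi> \<in> test_funs (-2) 2" for \<phi>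
  proof -
    have L: "deriv (deriv \<phi>) \<in> L2 (-2) 2" "\<phi> \<in> L2 (-2) 2"
      by (rule L2_test[OF test_funs_deriv[OF test_funs_deriv[OF \<phi>]]], rule L2_test[OF \<phi>])
    show ?thesis
      using BD[OF L(1) neg[OF L(2)], of 0] BD[OF neg[OF L(1)] L(2), of 0] admissible_p_weak[OF vp \<phi>] by simp
  qed
  have PH2: "P \<in> H2 (-2) 2" and WP: "ae_eq (-2) 2 (W2 P) Q"
    using weak_imp_H2[OF _ PL QL PQ] by auto
  define wk where "wk k j m \<longleftrightarrow> (\<forall>\<phi>\<in>test_funs (-2) 2. (pairing (-2) 2 (v k) (deriv (deriv \<phi>)))
    = pairing (-2) 2 (D2 (v k)) \<phi> + (\<Sum>s\<in>kinks (v k). m s * \<phi> s) - (\<Sum>s\<in>jumps (v k). j s * deriv \<phi> s))" for k j m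
  have "\<exists>j m. wk k j m" for k
    unfolding wk_def by (rule admissible_v_weak[OF vp[of k]]) blast
  then obtain J M where "\<And>k. wk k (J k) (M k)" by metis
  then have weak: "pairing (-2) 2 (v k) (deriv (deriv \<phi>))
    = pairing (-2) 2 (D2 (v k)) \<phi> + (\<Sum>s\<in>kinks (v k). M k s * \<phi> s) - (\<Sum>s\<in>jumps (v k). J k s * deriv \<phi> s)"
    if "\<phi> \<in> test_funs (-2) 2" for k \<phi>
    using that unfolding wk_def by blast
  have away: "eventually (\<lambda>k. \<forall>i\<in>I. pts k i \<notin> {c..d}) sequentially"
    if "I \<subseteq> {..<a + b}" "\<And>i. i \<in> I \<Longrightarrow> l i \<notin> {c..d}" for I c d
  proof (rule eventually_ball_finite)
    show "finite I" using that(1) finite_subset by blast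
    show "\<forall>i\<in>I. eventually (\<lambda>k. pts k i \<notin> {c..d}) sequentially"
    proof
      fix i assume i: "i \<in> I"
      have "open (- {c..d})" by auto
      moreover have "l i \<in> - {c..d}" using that(2)[OF i] by simp
      moreover have "(\<lambda>k. pts k i) \<longlonglongrightarrow> l i" using lim that(1) i by blast
      ultimately have "eventually (\<lambda>k. pts k i \<in> - {c..d}) sequentially" by (metis topological_tendstoD)
      then show "eventually (\<lambda>k. pts k i \<notin> {c..d}) sequentially" by simp
    qed
  qed
  have kinks_pts: "\<exists>i<a + b. s = pts k i" if "s \<in> kinks (v k)" for s k
  proof -
    have "s \<in> pts k ` {..<a} \<union> pts k ` {a..<a + b}" using that unfolding pts by blast
    then obtain i where "i \<in> {..<a} \<union> {a..<a + b}" "s = pts k i" by blast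
    then show ?thesis by (intro exI[of _ i]) auto
  qed
  define S where "S = l ` {..<a + b}"
  have S: "finite S" "S \<subseteq> {-1..1}" unfolding S_def using l1 by auto
  have S2: "S \<subseteq> {-2<..<2}"
  proof
    fix s assume "s \<in> S"
    then have "s \<in> {-1..1}" using S(2) by blast
    then show "s \<in> {-2<..<2}" by auto
  qed
  \<comment> \<open>The support of \<open>\<phi>\<close> contains no limit point, so eventually no
    jump or crease of \<open>v k\<close> lies in it. Both sums vanish, and the identity left over is
    linear in \<open>v k\<close> and its second derivative.\<close>
  have offS: "pairing (-2) 2 V (deriv (deriv \<phi>)) = pairing (-2) 2 H \<phi>"
    if cd: "-2 \<le> c" "d \<le> 2" "S \<inter> {c<..<d} = {}" and \<phi>: "\<phi> \<in> test_funs c d" for c d \<phi>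
  proof -
    obtain c' d' where c': "c < c'" "d' < d" and z: "\<And>x. x \<notin> {c'..d'} \<Longrightarrow> \<phi> x = 0 \<and> deriv \<phi> x = 0"
      using test_support_closed[OF \<phi>] by blast
    note \<phi>2 = test_funs_mono[OF \<phi> cd(1,2)]
    have "l i \<notin> {c'..d'}" if "i \<in> {..<a + b}" for i
      using cd(3) c' that unfolding S_def by auto
    then have "eventually (\<lambda>k. \<forall>i\<in>{..<a + b}. pts k i \<notin> {c'..d'}) sequentially"
      by (intro away) auto
    then have ev: "eventually (\<lambda>k. \<bar>pairing (-2) 2 (v k) (deriv (deriv \<phi>)) - (pairing (-2) 2 (D2 (v k)) \<phi>)\<bar> \<le> 0) sequentially"
    proof eventually_elim
      case (elim k)
      have "(\<Sum>s\<in>kinks (v k). M k s * \<phi> s) = 0"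
      proof (rule sum.neutral, rule ballI)
        fix s assume "s \<in> kinks (v k)"
        then obtain i where "i < a + b" "s = pts k i" using kinks_pts by blast
        then show "M k s * \<phi> s = 0" using elim z by simp
      qed
      moreover have "(\<Sum>s\<in>jumps (v k). J k s * deriv \<phi> s) = 0"
      proof (rule sum.neutral, rule ballI)
        fix s assume "s \<in> jumps (v k)"
        then obtain i where "i < a" "s = pts k i" unfolding pts(1)[symmetric] by blast
        then show "J k s * deriv \<phi> s = 0" using elim z by simp
      qed
      ultimately show ?case using weak[OF \<phi>2, of k] by simp
    qed
    have "\<bar>pairing (-2) 2 V (deriv (deriv \<phi>)) - (pairing (-2) 2 H \<phi>)\<bar> \<le> 0"
      by (rule ACabs[OF L2_test[OF test_funs_deriv[OF test_funs_deriv[OF \<phi>2]]] L2_test[OF \<phi>2] ev])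
    then show ?thesis by simp
  qed
  have Vpw: "V \<in> piecewise_H2 (-2) 2" and exrep: "\<exists>k l j m. ae_eq (-2) 2 V (pw_fun (-2) 2 H k l S j m)"
    using weak_off_points_rep[OF _ VL HL S(1) S2 offS] by auto
  then obtain k1 l1 j1 m1 where rep: "ae_eq (-2) 2 V (pw_fun (-2) 2 H k1 l1 S j1 m1)" by blast
  note Hi = L2_integrable[OF HL]
  note dV = ac_derivs_rep[OF Hi S(1) S2 rep]
  have adm: "(V, P) \<in> admissible w"
    using Vpw PH2 out PV obstacle_iff_AE[OF Vpw PH2 ae_eq_trans[OF out(1) ae_eq_sym[OF out(3)]]
        ae_eq_trans[OF out(2) ae_eq_sym[OF out(4)]]]
    unfolding admissible_def by simp
  \<comment> \<open>a limit point of a single crease is not a jump: test with \<open>(y - x) * \<phi>0 y\<close>, which sees the jump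
    but annihilates the point mass at \<open>x\<close>\<close>
  have single: "{k \<in> {..<a + b}. l k = x} \<noteq> {i}" if x: "x \<in> jumps V" and i: "a \<le> i" "i < a + b" for x i
  proof
    assume F: "{k \<in> {..<a + b}. l k = x} = {i}"
    have jx: "x \<in> S" "j1 x \<noteq> 0" using x unfolding dV(3) by auto
    obtain c d where cd: "-2 < c" "c < x" "x < d" "d < 2" and iso: "\<And>y. y \<in> S \<Longrightarrow> y \<noteq> x \<Longrightarrow> y \<notin> {c..d}"
      using isolate_point[OF S(1), of x] jx(1) S(2) by blast
    define \<phi>0 where "\<phi>0 = bump c d 0"
    have \<phi>0: "\<phi>0 \<in> test_funs (-2) 2" unfolding \<phi>0_def by (rule bump_test_funs[OF cd(1,4)])
    have \<phi>0x: "\<phi>0 x > 0" unfolding \<phi>0_def by (rule bump_pos) (use cd in simp)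
    have \<phi>0z: "\<phi>0 y = 0" if "y \<notin> {c..d}" for y unfolding \<phi>0_def by (rule bump_zero) (use that in auto)
    have others: "eventually (\<lambda>k. \<forall>i'\<in>{..<a + b} - {i}. pts k i' \<notin> {c..d}) sequentially"
    proof (rule away)
      fix i' assume i': "i' \<in> {..<a + b} - {i}"
      then have "l i' \<noteq> x" using F by auto
      then show "l i' \<notin> {c..d}" using iso i' unfolding S_def by blast
    qed auto
    \<comment> \<open>Only the point with index \<open>i\<close> remains in the support. As
      \<open>a \<le> i\<close> it is a crease and not a jump, so it contributes no term with
      \<open>deriv \<phi>\<close>.\<close>
    have kink_id: "eventually (\<lambda>k. (pairing (-2) 2 (v k) (deriv (deriv \<phi>)))
        = pairing (-2) 2 (D2 (v k)) \<phi> + M k (pts k i) * \<phi> (pts k i)) sequentially"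
      if \<phi>: "\<phi> \<in> test_funs (-2) 2" and z: "\<And>y. y \<notin> {c..d} \<Longrightarrow> \<phi> y = 0" for \<phi>
      using others
    proof eventually_elim
      case (elim k)
      have z': "deriv \<phi> y = 0" if "y \<notin> {c..d}" for y by (rule deriv_zero_outside[OF z that])
      have mem: "pts k i \<in> kinks (v k)" using pts(2)[of k] i by force
      have "(\<Sum>s\<in>jumps (v k). J k s * deriv \<phi> s) = 0"
      proof (rule sum.neutral, rule ballI)
        fix s assume "s \<in> jumps (v k)"
        then obtain i' where "i' < a" "s = pts k i'" unfolding pts(1)[symmetric] by blast
        then have "s \<notin> {c..d}" using elim i by auto
        then show "J k s * deriv \<phi> s = 0" using z' by simp
      qed
      moreover have "(\<Sum>s\<in>kinks (v k). M k s * \<phi> s) = M k (pts k i) * \<phi> (pts k i) + (\<Sum>s\<in>kinks (v k) - {pts k i}. M k s * \<phi> s)"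
        by (rule sum.remove[OF admissible_finite(2)[OF vp] mem])
      moreover have "(\<Sum>s\<in>kinks (v k) - {pts k i}. M k s * \<phi> s) = 0"
      proof (rule sum.neutral, rule ballI)
        fix s assume s: "s \<in> kinks (v k) - {pts k i}"
        then obtain i' where i': "i' < a + b" "s = pts k i'" using kinks_pts by blast
        then have "i' \<noteq> i" using s by blast
        then have "s \<notin> {c..d}" using elim i' by simp
        then show "M k s * \<phi> s = 0" using z by simp
      qed
      ultimately show ?case using weak[OF \<phi>, of k] by simp
    qed
    have "i \<in> {k \<in> {..<a + b}. l k = x}" unfolding F by simp
    then have lx: "(\<lambda>k. pts k i) \<longlonglongrightarrow> x" using lim[OF i(2)] by simp
    note dd0 = L2_test[OF test_funs_deriv[OF test_funs_deriv[OF \<phi>0]], of "-2" 2] L2_test[OF \<phi>0, of "-2" 2]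
    define K' where "K' = 2 * K + sqnorm (-2) 2 (deriv (deriv \<phi>0)) + sqnorm (-2) 2 \<phi>0"
    have "(\<lambda>k. \<phi>0 (pts k i)) \<longlonglongrightarrow> \<phi>0 x"
      by (rule isCont_tendsto_compose[OF smooth_isCont[OF test_funs_smooth[OF \<phi>0]] lx])
    then have big: "eventually (\<lambda>k. \<phi>0 x / 2 < \<phi>0 (pts k i)) sequentially"
      by (rule order_tendstoD(1)) (use \<phi>0x in simp)
    have kid0: "eventually (\<lambda>k. (pairing (-2) 2 (v k) (deriv (deriv \<phi>0)))
        = pairing (-2) 2 (D2 (v k)) \<phi>0 + M k (pts k i) * \<phi>0 (pts k i)) sequentially"
      by (rule kink_id[OF \<phi>0]) (rule \<phi>0z)
    \<comment> \<open>\<open>\<phi>0\<close> is bounded away from 0 at \<open>pts k i\<close>, so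
      testing with it isolates the crease strength, while all integrals are bounded through
      \<open>K\<close>.\<close>
    have Mbd: "eventually (\<lambda>k. \<bar>M k (pts k i)\<bar> \<le> K' / (\<phi>0 x / 2)) sequentially"
      using kid0 big
    proof eventually_elim
      case (elim k)
      have "\<bar>M k (pts k i) * \<phi>0 (pts k i)\<bar> \<le> \<bar>\<integral>x. v k x * deriv (deriv \<phi>0) x \<partial>?M\<bar> + \<bar>\<integral>x. D2 (v k) x * \<phi>0 x \<partial>?M\<bar>"
        using elim(1) by linarith
      also have "\<dots> \<le> K'"
        using L2_pairing_bound[OF L2k(1) dd0(1), of k] L2_pairing_bound[OF L2k(3) dd0(2), of k] bd[of k]
        unfolding K'_def by linarith
      finally have "\<bar>M k (pts k i)\<bar> * \<phi>0 (pts k i) \<le> K'" using elim(2) \<phi>0x by (simp add: abs_mult)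
      moreover have "\<bar>M k (pts k i)\<bar> * (\<phi>0 x / 2) \<le> \<bar>M k (pts k i)\<bar> * \<phi>0 (pts k i)"
        using elim(2) by (intro mult_left_mono) auto
      ultimately have "\<bar>M k (pts k i)\<bar> * (\<phi>0 x / 2) \<le> K'" by linarith
      then show ?case using \<phi>0x by (simp add: pos_le_divide_eq)
    qed
    define \<phi> where "\<phi> = (\<lambda>y. (y - x) * \<phi>0 y)"
    have \<phi>: "\<phi> \<in> test_funs (-2) 2" unfolding \<phi>_def by (rule test_funs_times_shift(1)[OF \<phi>0])
    have d\<phi>: "deriv \<phi> = (\<lambda>y. \<phi>0 y + (y - x) * deriv \<phi>0 y)" unfolding \<phi>_def by (rule test_funs_times_shift(2)[OF \<phi>0])
    have \<phi>z: "\<phi> y = 0" if "y \<notin> {c..d}" for y using \<phi>0z[OF that] by (simp add: \<phi>_def)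
    note dd = L2_test[OF test_funs_deriv[OF test_funs_deriv[OF \<phi>]], of "-2" 2] L2_test[OF \<phi>, of "-2" 2]
    have kid: "eventually (\<lambda>k. (pairing (-2) 2 (v k) (deriv (deriv \<phi>)))
        = pairing (-2) 2 (D2 (v k)) \<phi> + M k (pts k i) * \<phi> (pts k i)) sequentially"
      by (rule kink_id[OF \<phi>]) (rule \<phi>z)
    \<comment> \<open>The summand 1 makes \<open>B\<close> positive, so that dividing by it is
      safe.\<close>
    define B where "B = \<bar>K' / (\<phi>0 x / 2)\<bar> + 1"
    have B: "B > 0" unfolding B_def by linarith
    have "(\<lambda>k. \<phi> (pts k i)) \<longlonglongrightarrow> \<phi> x"
      by (rule isCont_tendsto_compose[OF smooth_isCont[OF test_funs_smooth[OF \<phi>]] lx])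
    then have "(\<lambda>k. \<bar>\<phi> (pts k i)\<bar>) \<longlonglongrightarrow> 0" using tendsto_rabs[of _ "\<phi> x"] by (simp add: \<phi>_def)
    then have small: "eventually (\<lambda>k. \<bar>\<phi> (pts k i)\<bar> < \<epsilon> / B) sequentially" if "\<epsilon> > 0" for \<epsilon>
      by (rule order_tendstoD(2)) (use that B in simp)
    have "\<bar>pairing (-2) 2 V (deriv (deriv \<phi>)) - (pairing (-2) 2 H \<phi>)\<bar> \<le> 0 + \<epsilon>" if \<epsilon>: "\<epsilon> > 0" for \<epsilon>
    proof (rule ACabs[OF dd])
      show "eventually (\<lambda>k. \<bar>pairing (-2) 2 (v k) (deriv (deriv \<phi>)) - (pairing (-2) 2 (D2 (v k)) \<phi>)\<bar> \<le> 0 + \<epsilon>) sequentially"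
        using kid Mbd small[OF \<epsilon>]
      proof eventually_elim
        case (elim k)
        have "\<bar>M k (pts k i)\<bar> \<le> B" using elim(2) unfolding B_def by linarith
        then have "\<bar>M k (pts k i)\<bar> * \<bar>\<phi> (pts k i)\<bar> \<le> B * (\<epsilon> / B)"
          using elim(3) B by (intro mult_mono) auto
        also have "\<dots> = \<epsilon>" using B by simp
        finally show ?case using elim(1) by (simp add: abs_mult)
      qed
    qed
    then have "\<bar>pairing (-2) 2 V (deriv (deriv \<phi>)) - (pairing (-2) 2 H \<phi>)\<bar> \<le> 0" by (rule field_le_epsilon)
    then have "pairing (-2) 2 V (deriv (deriv \<phi>)) = pairing (-2) 2 H \<phi>" by simp
    moreover have "pairing (-2) 2 V (deriv (deriv \<phi>)) = pairing (-2) 2 H \<phi> + (\<Sum>s\<in>S. m1 s * \<phi> s) - (\<Sum>s\<in>S. j1 s * deriv \<phi> s)"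
      using integral_test_ae_eq[OF test_funs_deriv[OF test_funs_deriv[OF \<phi>]] rep L2_integrable[OF VL]] pw_fun_deriv2[OF Hi \<phi>] by simp
    moreover have "(\<Sum>s\<in>S. m1 s * \<phi> s) = 0"
    proof (rule sum.neutral, rule ballI)
      fix s assume s: "s \<in> S"
      have "\<phi> s = 0"
      proof (cases "s = x")
        case True
        then show ?thesis by (simp add: \<phi>_def)
      next
        case False
        show ?thesis by (rule \<phi>z[OF iso[OF s False]])
      qed
      then show "m1 s * \<phi> s = 0" by simp
    qed
    \<comment> \<open>\<open>\<phi>\<close> vanishes at \<open>x\<close> but its derivative there is
      \<open>\<phi>0 x\<close>, so the jump term of the limit is all that remains; the other points
      of \<open>S\<close> lie outside the support.\<close>
    moreover have "(\<Sum>s\<in>S. j1 s * deriv \<phi> s) = j1 x * \<phi>0 x"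
    proof -
      have "(\<Sum>s\<in>S - {x}. j1 s * deriv \<phi> s) = 0"
      proof (rule sum.neutral, rule ballI)
        fix s assume s: "s \<in> S - {x}"
        then have "deriv \<phi> s = 0" using iso[of s] by (intro deriv_zero_outside[OF \<phi>z]) auto
        then show "j1 s * deriv \<phi> s = 0" by simp
      qed
      then show ?thesis using sum.remove[OF S(1) jx(1), of "\<lambda>s. j1 s * deriv \<phi> s"] by (simp add: d\<phi>)
    qed
    ultimately have "j1 x * \<phi>0 x = 0" by simp
    then show False using jx(2) \<phi>0x by simp
  qed
  have LJ: "f \<in> L2 (-1) 1" if "f \<in> L2 (-2) 2" for f by (rule L2_mono[OF that]) auto
  let ?E = "energy \<eta> \<mu> \<gamma> f\<^sub>r f\<^sub>p V P H Q"
  \<comment> \<open>convexity replaces the energy by its affine minorant at the limit, to which the cluster property applies\<close>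
  have energy_le: "?E \<le> (m - N) + \<epsilon>" if \<epsilon>: "\<epsilon> > 0" for \<epsilon>
  proof -
    define A where "A x = 2 * \<mu> * (V x - P x) - f\<^sub>r x" for x
    define B where "B x = (- 2 * \<mu>) * (V x - P x) - f\<^sub>p x" for x
    define C where "C x = 2 * \<eta> * H x" for x
    define D where "D x = 2 * \<gamma> * Q x" for x
    have ABCD: "A \<in> L2 (-1) 1" "B \<in> L2 (-1) 1" "C \<in> L2 (-1) 1" "D \<in> L2 (-1) 1"
      unfolding A_def[abs_def] B_def[abs_def] C_def[abs_def] D_def[abs_def]
      by (intro L2_diff L2_cmult f_L2 LJ VL PL HL QL)+
    have cL: "cut (-1) 1 f \<in> L2 (-2) 2" if "f \<in> L2 (-1) 1" for f by (rule cut_L2[OF that]) auto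
    define lin where "lin = (\<lambda>v' p' h' q'. (pairing (-1) 1 v' A)
      + pairing (-1) 1 p' B
      + pairing (-1) 1 h' C + pairing (-1) 1 q' D)"
    \<comment> \<open>The energy lives on (-1, 1), the cluster property on (-2, 2); cutting off the
      weights connects the two.\<close>
    have linI: "lin v' p' h' q' = pairing (-2) 2 v' (cut (-1) 1 A) + pairing (-2) 2 p' (cut (-1) 1 B)
      + pairing (-2) 2 h' (cut (-1) 1 C) + pairing (-2) 2 q' (cut (-1) 1 D)" for v' p' h' q'
      unfolding lin_def by (simp add: integral_cut_mult)
    have "(\<lambda>k. inverse (real (Suc k))) \<longlonglongrightarrow> 0" by (rule LIMSEQ_inverse_real_of_nat)
    then have "eventually (\<lambda>k. inverse (real (Suc k)) < \<epsilon>) sequentially" by (rule order_tendstoD(2)) (rule \<epsilon>)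
    then have "eventually (\<lambda>k. lin (v k) (p k) (D2 (v k)) (W2 (p k)) \<le> (m - N) + \<epsilon> - ?E + lin V P H Q) sequentially"
    proof eventually_elim
      case (elim k)
      have "?E + lin (v k) (p k) (D2 (v k)) (W2 (p k)) - lin V P H Q \<le> en (v k) (p k)"
        by (rule energy_convex[OF f_L2 LJ[OF VL] LJ[OF PL] LJ[OF HL] LJ[OF QL] LJ[OF L2k(1)] LJ[OF L2k(2)]
              LJ[OF L2k(3)] LJ[OF L2k(4)] pos]) (simp add: lin_def A_def B_def C_def D_def)
      then show ?case using en_val[of k] vm[of k] elim by linarith
    qed
    then have "lin V P H Q \<le> (m - N) + \<epsilon> - ?E + lin V P H Q"
      unfolding linI by (intro CL cL ABCD)
    then show ?thesis by linarith
  qed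
  then have E: "?E \<le> m - N" by (rule field_le_epsilon)
  \<comment> \<open>The derivatives of the limits are a.e. equal to the limits of the derivatives,
    by uniqueness.\<close>
  have "en V P = ?E"
    by (rule energy_ae_cong[OF _ _ f_L2 LJ[OF VL] LJ[OF PL] LJ[OF admissible_L2(3)[OF adm]] LJ[OF admissible_L2(4)[OF adm]]])
      (rule ae_eq_mono[OF dV(2)], simp, simp, rule ae_eq_mono[OF WP], simp, simp)
  moreover have "\<alpha> * real (card (jumps V)) + \<beta> * real (card (kinks V - jumps V)) \<le> N"
    unfolding N_def
  proof (rule weighted_count_le[OF _ _ ab single])
    show "jumps V \<subseteq> l ` {..<a + b}" "kinks V \<subseteq> l ` {..<a + b}"
      unfolding dV(3,4) S_def[symmetric] by auto
  qed
  ultimately have "val V P \<le> m" using E unfolding val_def by linarith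
  then show ?thesis using adm m_le order_trans by blast
qed

end

theorem theorem3p8:
  fixes w f\<^sub>r f\<^sub>p :: "real \<Rightarrow> real" and \<alpha> \<beta> \<eta> \<mu> \<gamma> :: real
  assumes "C2_on (-2) 2 w"
    and "\<eta> > 0" and "\<mu> > 0" and "\<gamma> > 0"
    and "f\<^sub>r \<in> L2 (-1) 1" and "f\<^sub>p \<in> L2 (-1) 1"
    and "0 < \<beta>" and "\<beta> \<le> \<alpha>" and "\<alpha> \<le> 2 * \<beta>"
  shows "\<exists>(v\<^sub>r, v\<^sub>p) \<in> admissible w.
           \<bar>F1 \<alpha> \<beta> \<eta> \<mu> \<gamma> f\<^sub>r f\<^sub>p v\<^sub>r v\<^sub>p\<bar> \<noteq> \<infinity> \<and>
           (\<forall>(u\<^sub>r, u\<^sub>p) \<in> admissible w.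
              F1 \<alpha> \<beta> \<eta> \<mu> \<gamma> f\<^sub>r f\<^sub>p v\<^sub>r v\<^sub>p \<le> F1 \<alpha> \<beta> \<eta> \<mu> \<gamma> f\<^sub>r f\<^sub>p u\<^sub>r u\<^sub>p)"
proof -
  have lt: "(-2::real) < 2" by simp
  have wH: "w \<in> H2 (-2) 2" by (rule C2_on_H2[OF assms(1)])
  obtain W w1 w2 where w: "w2 \<in> L2 (-2) 2" "ae_eq (-2) 2 w W" "\<And>x. isCont W x" "\<And>x. isCont w1 x"
    "has_ac_deriv (-2) 2 w w1" "has_ac_deriv (-2) 2 w1 w2"
    "\<And>\<phi>. \<phi> \<in> test_funs (-2) 2 \<Longrightarrow> (\<integral>x. w x * deriv (deriv \<phi>) x \<partial>lebesgue_on {-2<..<2}) = (\<integral>x. w2 x * \<phi> x \<partial>lebesgue_on {-2<..<2})"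
    by (rule H2_continuous_rep[OF wH lt]) blast
  interpret relaxed_problem w W w1 w2 \<alpha> \<beta> \<eta> \<mu> \<gamma> f\<^sub>r f\<^sub>p
    by unfold_locales (fact wH w assms)+
  obtain V P where VP: "(V, P) \<in> admissible w" "\<And>u q. (u, q) \<in> admissible w \<Longrightarrow> val V P \<le> val u q"
    using minimizer_exists[OF admissible_self[OF assms(1)]] by blast
  show ?thesis
  proof (rule bexI[OF _ VP(1)], simp only: prod.case, intro conjI ballI)
    show "\<bar>F1 \<alpha> \<beta> \<eta> \<mu> \<gamma> f\<^sub>r f\<^sub>p V P\<bar> \<noteq> \<infinity>" unfolding F1_val[OF VP(1)] by simp
    fix uq assume uq: "uq \<in> admissible w"
    obtain u q where e: "uq = (u, q)" by (cases uq)
    show "case uq of (u\<^sub>r, u\<^sub>p) \<Rightarrow> F1 \<alpha> \<beta> \<eta> \<mu> \<gamma> f\<^sub>r f\<^sub>p V P \<le> F1 \<alpha> \<beta> \<eta> \<mu> \<gamma> f\<^sub>r f\<^sub>p u\<^sub>r u\<^sub>p"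
      using uq VP(2) unfolding e prod.case by (simp add: F1_val[OF VP(1)] F1_val)
  qed
qed

end
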